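(* Let $k$ be a positive integer, let $f:(\mathbb{Z}/k\mathbb{Z})^2\to \mathbb{Z}/k\mathbb{Z}$ be a $k$-link function, let $X$ be a real-valued random variable with mean $0$, variance $1$ and all higher moments finite, and let $(M_{f,N,X})_{N\in k\mathbb{N}}$ be the associated $k$-periodic family of real symmetric random matrix ensembles. Let $(A_N)_{N\in k\mathbb{N}}$ be a sequence with $A_N$ chosen from the ensemble $M_{f,N,X}$. Then with probability $1$ in the product measure (over $N\in k\mathbb{N}$, of the laws of the $M_{f,N,X}$), the sequence of empirical spectral measures $(\nu_{A_N})_{N\in k\mathbb{N}}$ converges weakly, as $N\to\infty$ along multiples of $k$, to the eigenvalue distribution $\mu_{\tilde{M}_{f,k}}$ of the $k\times k$ complex companion ensemble $\tilde{M}_{f,k}$.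
   Context: Matrices are zero-indexed: the entries of an $N\times N$ matrix are indexed by pairs in $\{0,\dots,N-1\}^2$. $k\mathbb{N}$ denotes the set of positive multiples of $k$. $k$-link function: any function $f:(\mathbb{Z}/k\mathbb{Z})^2\to\mathbb{Z}/k\mathbb{Z}$; it is evaluated on pairs of integers by first reducing both integers mod $k$. The ensemble $M_{f,N,X}$ (for $k\mid N$): the random real symmetric $N\times N$ matrix $(a_{i,j})$ whose entries have the law of $X$ and are i.i.d. apart from the restriction that $a_{i,j}=a_{i',j'}$ if one of the following holds: (1) $i=j'$ and $j=i'$; (2) $i-j\equiv i'-j'\pmod N$ and $f(i,j)=f(i',j')$. That is, entries are equal when their index pairs are equivalent under the equivalence relation generated by (1) and (2), and entries from distinct equivalence classes are independent. The sequence $(M_{f,N,X})_{N\in k\mathbb{N}}$ is called a $k$-periodic family. Gaussians: $\mathcal{N}_{\mathbb{R}}(0,1)$ is the real Gaussian law of mean $0$ and variance $1$; $\mathcal{N}_{\mathbb{C}}(0,1)$ is the law of $(a+ib)/\sqrt{2}$ with $a,b$ i.i.d. $\mathcal{N}_{\mathbb{R}}(0,1)$. Complex companion ensemble: $\tilde{M}_{f,k}$ is the random Hermitian $k\times k$ matrix with entries $c_{\ell,j}$, which are independent apart from the following identifications (and their consequences): (1) $c_{\ell,j}=\overline{c_{j,\ell}}$; (2) $c_{\ell,j}=c_{m,n}$ whenever $\ell-j\equiv m-n \pmod k$ and $f(\ell,j)=f(m,n)$. Explicitly, let $\approx$ be the smallest equivalence relation on index pairs such that $(\ell,j)\approx(m,n)$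 whenever $\ell-j\equiv m-n\pmod k$ and ($f(\ell,j)=f(m,n)$ or $f(j,\ell)=f(n,m)$). Then $c_{\ell,j}=c_{m,n}$ if $(\ell,j)\approx(m,n)$; $c_{\ell,j}=\overline{c_{m,n}}$ if $(\ell,j)\approx(n,m)$; and, taking one index pair from each class of the equivalence relation generated by $\approx$ and $(\ell,j)\leftrightarrow(j,\ell)$, the corresponding entries are jointly independent. The law of $c_{\ell,j}$ is $\mathcal{N}_{\mathbb{R}}(0,1)$ if the identifications force it to be real, that is if $(\ell,j)\approx(j,\ell)$ (in particular whenever $2(j-\ell)\equiv 0\pmod k$ and $f(j,\ell)=f(\ell,j)$), and $\mathcal{N}_{\mathbb{C}}(0,1)$ otherwise. Empirical spectral measure: for a fixed $N\times N$ Hermitian matrix $A$ with eigenvalues $\lambda_1,\dots,\lambda_N$, $\nu_A=\frac1N\sum_{i=1}^N\delta_{\lambda_i/\sqrt N}$. Eigenvalue distribution: for an $n\times n$ Hermitian random matrix ensemble $M_n$, $\mu_{M_n}$ is the law of the real random variable obtained by choosing a matrix according to $M_n$, then choosing one of its $n$ eigenvalues (with multiplicity) uniformly at random, and multiplying it by $1/\sqrt{n}$. Weak convergence $\nu_{A_N}\to\mu$ means $\int g\,d\nu_{A_N}\to\int g\,d\mu$ for every bounded continuous $g:\mathbb{R}\to\mathbb{R}$. *)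

theory Defs
  imports
    "HOL-Probability.Probability"
    "HOL-Number_Theory.Cong"
    "Jordan_Normal_Form.Char_Poly"
begin

text \<open>
  The ring \<open>\<int>/k\<int>\<close> is represented by the residues \<open>{..<k}\<close>. An \<open>N \<times> N\<close> matrix is
  represented by its entries, a function on \<open>{..<N} \<times> {..<N}\<close>, so that matrix ensembles are
  measures on a finite product space; it is turned into a \<^typ>\<open>complex mat\<close> for spectral notions.
\<close>

definition link_function :: "nat \<Rightarrow> (nat \<Rightarrow> nat \<Rightarrow> nat) \<Rightarrow> bool" where
  "link_function k f \<longleftrightarrow> (\<forall>i<k. \<forall>j<k. f i j < k)"

definition link_eval :: "nat \<Rightarrow> (nat \<Rightarrow> nat \<Rightarrow> nat) \<Rightarrow> nat \<times> nat \<Rightarrow> nat" where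
  "link_eval k f = (\<lambda>(i, j). f (i mod k) (j mod k))"

abbreviation indices :: "nat \<Rightarrow> (nat \<times> nat) set" where
  "indices N \<equiv> {..<N} \<times> {..<N}"

definition same_diagonal :: "nat \<Rightarrow> nat \<times> nat \<Rightarrow> nat \<times> nat \<Rightarrow> bool" where
  "same_diagonal N p q \<longleftrightarrow>
     [int (fst p) - int (snd p) = int (fst q) - int (snd q)] (mod int N)"

definition equiv_class :: "('a \<Rightarrow> 'a \<Rightarrow> bool) \<Rightarrow> 'a \<Rightarrow> 'a set" where
  "equiv_class R p = {q. R p q}"


subsection \<open>The ensembles of a periodic family\<close>

definition entry_equiv ::
    "nat \<Rightarrow> (nat \<Rightarrow> nat \<Rightarrow> nat) \<Rightarrow> nat \<Rightarrow> nat \<times> nat \<Rightarrow> nat \<times> nat \<Rightarrow> bool" where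
  "entry_equiv k f N = equivclp (\<lambda>p q. p \<in> indices N \<and> q \<in> indices N \<and>
     (q = prod.swap p \<or> same_diagonal N p q \<and> link_eval k f p = link_eval k f q))"

text \<open>
  The law of the random matrix: draw one independent copy of \<open>X\<close> for each equivalence class of
  index pairs, and put it at all positions in that class.
\<close>

definition periodic_ensemble ::
    "nat \<Rightarrow> (nat \<Rightarrow> nat \<Rightarrow> nat) \<Rightarrow> nat \<Rightarrow> 'w measure \<Rightarrow> ('w \<Rightarrow> real) \<Rightarrow> (nat \<times> nat \<Rightarrow> real) measure"
  where
  "periodic_ensemble k f N \<Omega> X =
     distr (\<Pi>\<^sub>M C\<in>equiv_class (entry_equiv k f N) ` indices N. distr \<Omega> borel X)
           (\<Pi>\<^sub>M p\<in>indices N. borel)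
           (\<lambda>x. \<lambda>p\<in>indices N. x (equiv_class (entry_equiv k f N) p))"


subsection \<open>The complex companion ensemble\<close>

definition real_gaussian :: "real measure" where
  "real_gaussian = density lborel (\<lambda>x. ennreal (std_normal_density x))"

definition complex_gaussian :: "complex measure" where
  "complex_gaussian =
     distr (real_gaussian \<Otimes>\<^sub>M real_gaussian) borel (\<lambda>(a, b). Complex a b / of_real (sqrt 2))"

definition companion_equiv ::
    "nat \<Rightarrow> (nat \<Rightarrow> nat \<Rightarrow> nat) \<Rightarrow> nat \<times> nat \<Rightarrow> nat \<times> nat \<Rightarrow> bool" where
  "companion_equiv k f = equivclp (\<lambda>p q. p \<in> indices k \<and> q \<in> indices k \<and> same_diagonal k p q \<and>
     (link_eval k f p = link_eval k f q \<or>
      link_eval k f (prod.swap p) = link_eval k f (prod.swap q)))"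

definition companion_swap_equiv ::
    "nat \<Rightarrow> (nat \<Rightarrow> nat \<Rightarrow> nat) \<Rightarrow> nat \<times> nat \<Rightarrow> nat \<times> nat \<Rightarrow> bool" where
  "companion_swap_equiv k f =
     equivclp (\<lambda>p q. companion_equiv k f p q \<or> p \<in> indices k \<and> q = prod.swap p)"

definition representative :: "'a set \<Rightarrow> 'a" where
  "representative C = (SOME p. p \<in> C)"

abbreviation forced_real :: "nat \<Rightarrow> (nat \<Rightarrow> nat \<Rightarrow> nat) \<Rightarrow> nat \<times> nat \<Rightarrow> bool" where
  "forced_real k f p \<equiv> companion_equiv k f p (prod.swap p)"

definition hermitian_matrices :: "nat \<Rightarrow> (nat \<times> nat \<Rightarrow> complex) measure" where
  "hermitian_matrices n = restrict_space (\<Pi>\<^sub>M p\<in>indices n. borel)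
     {c. \<forall>p\<in>indices n. c (prod.swap p) = cnj (c p)}"

definition companion_base ::
    "nat \<Rightarrow> (nat \<Rightarrow> nat \<Rightarrow> nat) \<Rightarrow> (((nat \<times> nat) set) \<Rightarrow> complex) measure" where
  "companion_base k f =
     (\<Pi>\<^sub>M C\<in>equiv_class (companion_swap_equiv k f) ` indices k.
        if forced_real k f (representative C)
        then distr real_gaussian borel complex_of_real else complex_gaussian)"

text \<open>
  A class of \<^const>\<open>companion_swap_equiv\<close> is the union of the \<^const>\<open>companion_equiv\<close> classes
  of its representative \<open>r\<close> and of \<open>prod.swap r\<close>; the value drawn for it is put at the former
  positions and its conjugate at the latter. If the two coincide, the value drawn is almost surely
  real; taking its real part makes the matrix Hermitian everywhere and not just almost everywhere.
\<close>

definition companion_entry ::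
    "nat \<Rightarrow> (nat \<Rightarrow> nat \<Rightarrow> nat) \<Rightarrow> ((nat \<times> nat) set \<Rightarrow> complex) \<Rightarrow> nat \<times> nat \<Rightarrow> complex" where
  "companion_entry k f x p =
     (let C = equiv_class (companion_swap_equiv k f) p in
      if forced_real k f p then complex_of_real (Re (x C))
      else if companion_equiv k f (representative C) p then x C
      else cnj (x C))"

definition companion_ensemble ::
    "nat \<Rightarrow> (nat \<Rightarrow> nat \<Rightarrow> nat) \<Rightarrow> (nat \<times> nat \<Rightarrow> complex) measure" where
  "companion_ensemble k f =
     distr (companion_base k f) (hermitian_matrices k)
           (\<lambda>x. restrict (companion_entry k f x) (indices k))"


subsection \<open>Spectral measures\<close>

text \<open>
  The characteristic polynomial of an \<open>n \<times> n\<close> complex matrix has \<open>n\<close> roots counted with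
  multiplicity; for a Hermitian matrix they are real, so \<^const>\<open>Re\<close> only changes their type.
\<close>

definition eigenvalues :: "nat \<Rightarrow> (nat \<times> nat \<Rightarrow> complex) \<Rightarrow> real multiset" where
  "eigenvalues n c = image_mset Re (proots (char_poly (Matrix.mat n n c)))"

definition spectral_measure :: "nat \<Rightarrow> (nat \<times> nat \<Rightarrow> complex) \<Rightarrow> real measure" where
  "spectral_measure n c =
     distr (measure_pmf (pmf_of_multiset (eigenvalues n c))) borel (\<lambda>t. t / sqrt (real n))"

text \<open>Here \<open>P\<close> is a law on \<^term>\<open>hermitian_matrices n\<close>; the bind is the two-stage choice.\<close>

definition eigenvalue_distribution :: "nat \<Rightarrow> (nat \<times> nat \<Rightarrow> complex) measure \<Rightarrow> real measure" where
  "eigenvalue_distribution n P = P \<bind> spectral_measure n"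

definition converges_weakly :: "(nat \<Rightarrow> real measure) \<Rightarrow> real measure \<Rightarrow> bool" where
  "converges_weakly \<nu> \<mu> \<longleftrightarrow>
     (\<forall>g :: real \<Rightarrow> real. continuous_on UNIV g \<and> bounded (range g) \<longrightarrow>
        (\<lambda>m. integral\<^sup>L (\<nu> m) g) \<longlonglongrightarrow> integral\<^sup>L \<mu> g)"

definition positive_multiples :: "nat \<Rightarrow> nat set" where
  "positive_multiples k = {N. 0 < N \<and> k dvd N}"

end

theory Submission
  imports Defs "Jordan_Normal_Form.Schur_Decomposition" "HOL-Real_Asymp.Real_Asymp"
begin

text \<open>
  A member of the ensemble of size \<open>N = k n\<close> is block circulant with \<open>k \<times> k\<close> blocks, so the discrete
  Fourier transform turns it into \<open>n\<close> Hermitian \<open>k \<times> k\<close> matrices \<open>H \<theta>\<close>, \<open>\<theta> < n\<close>, and the trace of its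
  \<open>m\<close>-th power is the sum of the traces of the \<open>H \<theta> ^ m\<close>. The entries of \<open>H \<theta> / \<surd>n\<close> are linear forms
  with small coefficients in the independent matrix entries. Their mixed moments therefore satisfy
  the Wick recursion up to \<open>O (1 / \<surd>n)\<close>, and except for the at most two \<open>\<theta>\<close> with \<open>n dvd 2 \<theta>\<close> their
  covariances are within \<open>O (1 / n)\<close> of those of the companion ensemble, whose moments satisfy the
  recursion exactly.

  For the almost sure convergence, the Efron--Stein inequality is applied to the centred trace and
  to its square, with Parseval's identity in \<open>\<theta>\<close> to estimate the influence of a single entry; it
  gives fourth central moments of order \<open>n powr (-3 / 2)\<close>, which are summable. Finally the moments of the
  limit grow so slowly that the characteristic functions converge.
\<close>

subsection \<open>Functions of polynomial growth and the Efron--Stein inequality\<close>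

text \<open>The trace averages n functions of about n independent variables, so its variance is in
  general of order 1 / n, which is not summable; hence the fourth moments. For bounded entries the
  argument would give n^-2. With finite moments only, the largest squared entry is replaced by the
  fourth root of the sum of the eighth powers, whose fourth power has mean O(n); this costs the
  factor sqrt n that leaves n^(-3/2).

  The law of \<open>X\<close> disappears because every entry has a coefficient O(1 / sqrt n): a
  third or higher moment comes with about n entries times at least three such coefficients. Only
  covariances survive. The two alternatives for the link values in \<open>companion_equiv\<close>
  arise because an identification may hold for two positions or for their transposes.

  If \<open>n dvd 2 * \<theta>\<close>, the phases of two entries with equal offset no longer cancel
  in the sum over the columns, so that a further covariance remains and the block has in general
  another limit. These frequencies weigh at most 2 / n in the average.\<close>

lemma (in product_prob_space) integral_component_times:
  fixes g :: "'a \<Rightarrow> 'c::{real_normed_field, banach, second_countable_topology}"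
    and f :: "('i \<Rightarrow> 'a) \<Rightarrow> 'c"
  assumes L: "finite L" "i \<in> L"
    and indep: "\<And>x y. f (x(i := y)) = f x"
    and f: "integrable (Pi\<^sub>M L M) f"
    and gf: "integrable (Pi\<^sub>M L M) (\<lambda>x. g (x i) * f x)"
  shows "(\<integral>x. g (x i) * f x \<partial>Pi\<^sub>M L M) = (\<integral>y. g y \<partial>M i) * (\<integral>x. f x \<partial>Pi\<^sub>M L M)"
proof -
  define J where "J = L - {i}"
  have J: "finite J" "i \<notin> J" "L = insert i J" using L by (auto simp: J_def)
  have "(\<integral>x. g (x i) * f x \<partial>Pi\<^sub>M L M) = (\<integral>x. (\<integral>y. g y * f x \<partial>M i) \<partial>Pi\<^sub>M J M)"
    unfolding J(3) using product_integral_insert[OF J(1,2) gf[unfolded J(3)]] by (simp add: indep)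
  also have "\<dots> = (\<integral>y. g y \<partial>M i) * (\<integral>x. f x \<partial>Pi\<^sub>M J M)" by simp
  also have "(\<integral>x. f x \<partial>Pi\<^sub>M J M) = (\<integral>x. f x \<partial>Pi\<^sub>M L M)"
    unfolding J(3) using product_integral_insert[OF J(1,2) f[unfolded J(3)]]
    by (simp add: indep M.prob_space)
  finally show ?thesis .
qed

text \<open>A class of functions closed under all operations used below, among them fixing or
  integrating out a coordinate, and integrable because all moments are finite. The majorant is a
  product over the coordinates, so that its integral factorises.\<close>

definition poly_growth ::
    "'i set \<Rightarrow> (('i \<Rightarrow> real) \<Rightarrow> 'b::{real_normed_field, banach, second_countable_topology}) \<Rightarrow> bool" where
  "poly_growth I f \<longleftrightarrow> f \<in> borel_measurable (Pi\<^sub>M I (\<lambda>_. borel)) \<and>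
     (\<exists>C p. \<forall>x. norm (f x) \<le> C * (\<Prod>i\<in>I. (1 + \<bar>x i\<bar>) ^ p))"

lemma poly_growthI:
  assumes "f \<in> borel_measurable (Pi\<^sub>M I (\<lambda>_. borel))"
    and "\<And>x. norm (f x) \<le> C * (\<Prod>i\<in>I. (1 + \<bar>x i\<bar>) ^ p)"
  shows "poly_growth I f"
  using assms unfolding poly_growth_def by blast

lemma poly_growth_measurable: "poly_growth I f \<Longrightarrow> f \<in> borel_measurable (Pi\<^sub>M I (\<lambda>_. borel))"
  by (simp add: poly_growth_def)

lemma poly_growthE:
  assumes "poly_growth I f"
  obtains C p where "C \<ge> 0" "\<And>x. norm (f x) \<le> C * (\<Prod>i\<in>I. (1 + \<bar>x i\<bar>) ^ p)"
proof -
  obtain C p where C: "\<And>x. norm (f x) \<le> C * (\<Prod>i\<in>I. (1 + \<bar>x i\<bar>) ^ p)"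
    using assms unfolding poly_growth_def by blast
  have "0 \<le> norm (f (\<lambda>_. 0))" by simp
  also have "\<dots> \<le> C" using C[of "\<lambda>_. 0"] by simp
  finally show ?thesis using that C by blast
qed

lemma prod_growth_mono:
  "p \<le> q \<Longrightarrow> (\<Prod>i\<in>I. (1 + \<bar>x i :: real\<bar>) ^ p) \<le> (\<Prod>i\<in>I. (1 + \<bar>x i\<bar>) ^ q)"
  by (intro prod_mono conjI power_increasing) auto

lemma prod_growth_nonneg: "0 \<le> (\<Prod>i\<in>I. (1 + \<bar>x i :: real\<bar>) ^ p)"
  by (intro prod_nonneg) auto

lemma prod_growth_ge_1: "1 \<le> (\<Prod>i\<in>I. (1 + \<bar>x i :: real\<bar>) ^ p)"
  by (intro prod_ge_1) auto

lemma poly_growth_const [intro, simp]: "poly_growth I (\<lambda>_. c)"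
  by (rule poly_growthI[where p = 0 and C = "norm c"]) auto

lemma poly_growth_coord [intro]:
  assumes "finite I" "i \<in> I"
  shows "poly_growth I (\<lambda>x. x i)"
proof (rule poly_growthI[where p = 1 and C = 1])
  fix x :: "'a \<Rightarrow> real"
  have "\<bar>x i\<bar> \<le> (1 + \<bar>x i\<bar>) * (\<Prod>j\<in>I - {i}. (1 + \<bar>x j\<bar>) ^ 1)"
    using prod_growth_ge_1[of x 1 "I - {i}"] mult_mono[of "\<bar>x i\<bar>" "1 + \<bar>x i\<bar>" 1] by fastforce
  also have "\<dots> = 1 * (\<Prod>j\<in>I. (1 + \<bar>x j\<bar>) ^ 1)"
    using assms by (simp add: prod.remove)
  finally show "norm (x i) \<le> 1 * (\<Prod>j\<in>I. (1 + \<bar>x j\<bar>) ^ 1)" by simp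
qed (use assms in measurable)

lemma poly_growth_add [intro]:
  assumes "poly_growth I f" "poly_growth I g"
  shows "poly_growth I (\<lambda>x. f x + g x)"
proof -
  obtain C p where C: "C \<ge> 0" "\<And>x. norm (f x) \<le> C * (\<Prod>i\<in>I. (1 + \<bar>x i\<bar>) ^ p)"
    using assms(1) by (rule poly_growthE) blast
  obtain D q where D: "D \<ge> 0" "\<And>x. norm (g x) \<le> D * (\<Prod>i\<in>I. (1 + \<bar>x i\<bar>) ^ q)"
    using assms(2) by (rule poly_growthE) blast
  show ?thesis
  proof (rule poly_growthI[where C = "C + D" and p = "max p q"])
    fix x
    have "norm (f x + g x) \<le> norm (f x) + norm (g x)" by (rule norm_triangle_ineq)
    also have "\<dots> \<le> C * (\<Prod>i\<in>I. (1 + \<bar>x i\<bar>) ^ max p q) + D * (\<Prod>i\<in>I. (1 + \<bar>x i\<bar>) ^ max p q)"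
      using C D by (intro add_mono order_trans[OF C(2)] order_trans[OF D(2)] mult_left_mono
          prod_growth_mono) auto
    finally show "norm (f x + g x) \<le> (C + D) * (\<Prod>i\<in>I. (1 + \<bar>x i\<bar>) ^ max p q)"
      by (simp add: algebra_simps)
  qed (use assms[THEN poly_growth_measurable] in measurable)
qed

lemma poly_growth_mult [intro]:
  assumes "poly_growth I f" "poly_growth I g"
  shows "poly_growth I (\<lambda>x. f x * g x)"
proof -
  obtain C p where C: "C \<ge> 0" "\<And>x. norm (f x) \<le> C * (\<Prod>i\<in>I. (1 + \<bar>x i\<bar>) ^ p)"
    using assms(1) by (rule poly_growthE) blast
  obtain D q where D: "D \<ge> 0" "\<And>x. norm (g x) \<le> D * (\<Prod>i\<in>I. (1 + \<bar>x i\<bar>) ^ q)"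
    using assms(2) by (rule poly_growthE) blast
  show ?thesis
  proof (rule poly_growthI[where C = "C * D" and p = "p + q"])
    fix x
    have "norm (f x * g x) = norm (f x) * norm (g x)" by (rule norm_mult)
    also have "\<dots> \<le> (C * (\<Prod>i\<in>I. (1 + \<bar>x i\<bar>) ^ p)) * (D * (\<Prod>i\<in>I. (1 + \<bar>x i\<bar>) ^ q))"
      using C D by (intro mult_mono mult_nonneg_nonneg prod_growth_nonneg) auto
    finally show "norm (f x * g x) \<le> C * D * (\<Prod>i\<in>I. (1 + \<bar>x i\<bar>) ^ (p + q))"
      by (simp add: power_add prod.distrib mult_ac)
  qed (use assms[THEN poly_growth_measurable] in measurable)
qed

lemma poly_growth_dominated:
  assumes "poly_growth I f" "g \<in> borel_measurable (Pi\<^sub>M I (\<lambda>_. borel))"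
    and "\<And>x. norm (g x) \<le> norm (f x)"
  shows "poly_growth I g"
proof -
  obtain C p where C: "C \<ge> 0" "\<And>x. norm (f x) \<le> C * (\<Prod>i\<in>I. (1 + \<bar>x i\<bar>) ^ p)"
    using assms(1) by (rule poly_growthE) blast
  show ?thesis
    by (rule poly_growthI[where C = C and p = p, OF assms(2)]) (use assms(3) C order_trans in blast)
qed

lemma poly_growth_diff [intro]:
  assumes "poly_growth I f" "poly_growth I g"
  shows "poly_growth I (\<lambda>x. f x - g x)"
  using poly_growth_add[OF assms(1) poly_growth_mult[OF poly_growth_const[of I "-1"] assms(2)]] by simp

lemma poly_growth_power [intro]: "poly_growth I f \<Longrightarrow> poly_growth I (\<lambda>x. f x ^ m)"
  by (induction m) auto

lemma poly_growth_divide [intro]: "poly_growth I f \<Longrightarrow> poly_growth I (\<lambda>x. f x / c)"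
  unfolding divide_inverse by auto

lemma poly_growth_sum [intro]:
  "(\<And>s. s \<in> A \<Longrightarrow> poly_growth I (f s)) \<Longrightarrow> poly_growth I (\<lambda>x. \<Sum>s\<in>A. f s x)"
  by (induction A rule: infinite_finite_induct) auto

lemma poly_growth_prod [intro]:
  "(\<And>s. s \<in> A \<Longrightarrow> poly_growth I (f s)) \<Longrightarrow> poly_growth I (\<lambda>x. \<Prod>s\<in>A. f s x)"
  by (induction A rule: infinite_finite_induct) auto

lemma poly_growth_norm [intro]: "poly_growth I f \<Longrightarrow> poly_growth I (\<lambda>x. norm (f x))"
  by (rule poly_growth_dominated[THEN poly_growthE, of I f f])
    (auto dest: poly_growth_measurable intro!: poly_growthI)

lemma poly_growth_of_real [intro]:
  "poly_growth I f \<Longrightarrow> poly_growth I (\<lambda>x. complex_of_real (f x))"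
  unfolding poly_growth_def by auto

lemma poly_growth_Re [intro]: "poly_growth I f \<Longrightarrow> poly_growth I (\<lambda>x. Re (f x))"
  by (rule poly_growth_dominated[OF poly_growth_norm])
    (auto simp: abs_Re_le_cmod dest: poly_growth_measurable)

lemma poly_growth_Im [intro]: "poly_growth I f \<Longrightarrow> poly_growth I (\<lambda>x. Im (f x))"
  by (rule poly_growth_dominated[OF poly_growth_norm])
    (auto simp: abs_Im_le_cmod dest: poly_growth_measurable)

lemma poly_growth_update:
  assumes "finite I" "i \<in> I" "poly_growth I f"
  shows "poly_growth I (\<lambda>x. f (x(i := c)))"
proof -
  obtain C p where C: "C \<ge> 0" "\<And>x. norm (f x) \<le> C * (\<Prod>i\<in>I. (1 + \<bar>x i\<bar>) ^ p)"
    using assms(3) by (rule poly_growthE) blast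
  show ?thesis
  proof (rule poly_growthI[where p = p and C = "C * (1 + \<bar>c\<bar>) ^ p"])
    have "(\<lambda>x. x(i := c)) \<in> measurable (Pi\<^sub>M I (\<lambda>_. borel)) (Pi\<^sub>M I (\<lambda>_. borel))"
      by (rule measurable_fun_upd[where J = I]) (use assms in auto)
    then show "(\<lambda>x. f (x(i := c))) \<in> borel_measurable (Pi\<^sub>M I (\<lambda>_. borel))"
      using assms(3) poly_growth_measurable measurable_compose by blast
    fix x :: "'a \<Rightarrow> real"
    have "(\<Prod>j\<in>I. (1 + \<bar>(x(i := c)) j\<bar>) ^ p) = (1 + \<bar>c\<bar>) ^ p * (\<Prod>j\<in>I - {i}. (1 + \<bar>x j\<bar>) ^ p)"
      using assms by (subst prod.remove[of I i]) auto
    also have "(\<Prod>j\<in>I - {i}. (1 + \<bar>x j\<bar>) ^ p) \<le> (\<Prod>j\<in>I. (1 + \<bar>x j\<bar>) ^ p)"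
      using assms by (intro prod_mono2) auto
    finally have "(\<Prod>j\<in>I. (1 + \<bar>(x(i := c)) j\<bar>) ^ p) \<le> (1 + \<bar>c\<bar>) ^ p * (\<Prod>j\<in>I. (1 + \<bar>x j\<bar>) ^ p)"
      by simp
    then show "norm (f (x(i := c))) \<le> C * (1 + \<bar>c\<bar>) ^ p * (\<Prod>i\<in>I. (1 + \<bar>x i\<bar>) ^ p)"
      using C order_trans[OF C(2) mult_left_mono] by (simp add: mult.assoc)
  qed
qed

section \<open>Independent coordinates with a common standardised law\<close>

locale iid_moments = prob_space \<nu> for \<nu> :: "real measure" +
  assumes sets_\<nu> [measurable_cong]: "sets \<nu> = sets borel"
    and integrable_power: "\<And>m. integrable \<nu> (\<lambda>x. x ^ m)"
    and mean_0: "(\<integral>x. x \<partial>\<nu>) = 0"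
    and second_moment_1: "(\<integral>x. x\<^sup>2 \<partial>\<nu>) = 1"
begin

abbreviation P :: "'i set \<Rightarrow> ('i \<Rightarrow> real) measure" where "P I \<equiv> Pi\<^sub>M I (\<lambda>_. \<nu>)"

sublocale prod: product_prob_space "\<lambda>_::'i. \<nu>" "UNIV :: 'i set"
  by unfold_locales

lemma space_\<nu> [simp]: "space \<nu> = UNIV"
  using sets_eq_imp_space_eq[OF sets_\<nu>] by simp

lemma measurable_P: "measurable (P I) N = measurable (Pi\<^sub>M I (\<lambda>_. borel)) N"
  by (intro measurable_cong_sets sets_PiM_cong sets_\<nu> refl)

lemma poly_growth_measurable_P: "poly_growth I f \<Longrightarrow> f \<in> borel_measurable (P I)"
  by (simp add: poly_growth_def measurable_P)

lemma integrable_abs_power: "integrable \<nu> (\<lambda>x. \<bar>x\<bar> ^ m)"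
  using integrable_abs[OF integrable_power[of m]] by (simp add: power_abs)

lemma integrable_one_plus_abs_power: "integrable \<nu> (\<lambda>x. (1 + \<bar>x\<bar>) ^ p)"
proof -
  have "integrable \<nu> (\<lambda>x. \<Sum>j\<le>p. of_nat (p choose j) * \<bar>x\<bar> ^ j)"
    by (intro Bochner_Integration.integrable_sum integrable_mult_right integrable_abs_power)
  then show ?thesis by (subst add.commute) (simp add: binomial_ring)
qed

lemma integrable_poly_growth:
  assumes "finite I" "poly_growth I f"
  shows "integrable (P I) f"
proof -
  obtain C p where C: "C \<ge> 0" "\<And>x. norm (f x) \<le> C * (\<Prod>i\<in>I. (1 + \<bar>x i\<bar>) ^ p)"
    using assms(2) by (rule poly_growthE) blast
  have "integrable (P I) (\<lambda>x. C * (\<Prod>i\<in>I. (1 + \<bar>x i\<bar>) ^ p))"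
    using assms(1) by (intro integrable_mult_right prod.product_integrable_prod integrable_one_plus_abs_power)
  then show ?thesis
  proof (rule Bochner_Integration.integrable_bound)
    show "f \<in> borel_measurable (P I)" by (rule poly_growth_measurable_P[OF assms(2)])
    show "AE x in P I. norm (f x) \<le> norm (C * (\<Prod>i\<in>I. (1 + \<bar>x i\<bar>) ^ p))"
      using C(2) unfolding real_norm_def by (intro AE_I2) (meson abs_ge_self order_trans)
  qed
qed

lemma prob_space_P: "prob_space (P I)"
  by (rule prob_space_PiM) (rule prob_space_axioms)

text \<open>The majorant factorises, and the factor of the integrated coordinate only contributes a
  finite moment to the constant. The induction for \<open>efron_stein\<close> integrates out one
  coordinate at a time in this way.\<close>

lemma poly_growth_integral_component:
  assumes I: "finite I" "j \<notin> I" and F: "poly_growth (insert j I) F"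
  shows "poly_growth I (\<lambda>x. \<integral>y. F (x(j := y)) \<partial>\<nu>)"
    and "\<And>x. x \<in> space (P I) \<Longrightarrow> integrable \<nu> (\<lambda>y. F (x(j := y)))"
proof -
  obtain C p where C: "C \<ge> 0" "\<And>x. norm (F x) \<le> C * (\<Prod>i\<in>insert j I. (1 + \<bar>x i\<bar>) ^ p)"
    using F by (rule poly_growthE) blast
  have eq: "(\<Prod>i\<in>insert j I. (1 + \<bar>(x(j := y)) i\<bar>) ^ p) = (1 + \<bar>y\<bar>) ^ p * (\<Prod>i\<in>I. (1 + \<bar>x i\<bar>) ^ p)"
    for x :: "'a \<Rightarrow> real" and y
  proof -
    have "(\<Prod>i\<in>I. (1 + \<bar>(x(j := y)) i\<bar>) ^ p) = (\<Prod>i\<in>I. (1 + \<bar>x i\<bar>) ^ p)"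
      using I by (intro prod.cong) auto
    then show ?thesis using I by simp
  qed
  have meas: "(\<lambda>(x, y). F (x(j := y))) \<in> borel_measurable (Pi\<^sub>M I (\<lambda>_. borel) \<Otimes>\<^sub>M \<nu>)"
  proof -
    have "(\<lambda>(f, y). f(j := y)) \<in> measurable (Pi\<^sub>M I (\<lambda>_. borel) \<Otimes>\<^sub>M borel) (Pi\<^sub>M (insert j I) (\<lambda>_. borel :: real measure))"
      by (rule measurable_add_dim)
    from measurable_compose[OF this poly_growth_measurable[OF F]]
    have "(\<lambda>(x, y). F (x(j := y))) \<in> borel_measurable (Pi\<^sub>M I (\<lambda>_. borel) \<Otimes>\<^sub>M borel)"
      by (simp add: case_prod_beta)
    then show ?thesis
      by (subst measurable_cong_sets[OF sets_pair_measure_cong[OF refl sets_\<nu>] refl])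
  qed
  show "poly_growth I (\<lambda>x. \<integral>y. F (x(j := y)) \<partial>\<nu>)"
  proof (rule poly_growthI[where p = p and C = "C * (\<integral>y. (1 + \<bar>y\<bar>) ^ p \<partial>\<nu>)"])
    show "(\<lambda>x. \<integral>y. F (x(j := y)) \<partial>\<nu>) \<in> borel_measurable (Pi\<^sub>M I (\<lambda>_. borel))"
      using meas by (rule borel_measurable_lebesgue_integral)
    fix x
    show "norm (\<integral>y. F (x(j := y)) \<partial>\<nu>) \<le> C * (\<integral>y. (1 + \<bar>y\<bar>) ^ p \<partial>\<nu>) * (\<Prod>i\<in>I. (1 + \<bar>x i\<bar>) ^ p)"
    proof -
      have "norm (\<integral>y. F (x(j := y)) \<partial>\<nu>) \<le> (\<integral>y. norm (F (x(j := y))) \<partial>\<nu>)"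
        by (rule integral_norm_bound)
      also have "\<dots> \<le> (\<integral>y. C * ((1 + \<bar>y\<bar>) ^ p * (\<Prod>i\<in>I. (1 + \<bar>x i\<bar>) ^ p)) \<partial>\<nu>)"
        using C(2)[of "x(j := _)"] C(1) unfolding eq
        by (intro integral_mono' integrable_mult_right integrable_mult_left
            integrable_one_plus_abs_power) (auto intro!: mult_nonneg_nonneg prod_growth_nonneg)
      finally show ?thesis by (simp add: mult_ac)
    qed
  qed
  show "integrable \<nu> (\<lambda>y. F (x(j := y)))" if "x \<in> space (P I)" for x
  proof (rule Bochner_Integration.integrable_bound)
    show "integrable \<nu> (\<lambda>y. C * ((1 + \<bar>y\<bar>) ^ p * (\<Prod>i\<in>I. (1 + \<bar>x i\<bar>) ^ p)))"
      by (intro integrable_mult_right integrable_mult_left integrable_one_plus_abs_power)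
    have "x \<in> space (Pi\<^sub>M I (\<lambda>_. borel :: real measure))" using that by (simp add: space_PiM)
    from measurable_compose[OF measurable_Pair1'[OF this] meas]
    show "(\<lambda>y. F (x(j := y))) \<in> borel_measurable \<nu>" by simp
    show "AE y in \<nu>. norm (F (x(j := y))) \<le> norm (C * ((1 + \<bar>y\<bar>) ^ p * (\<Prod>i\<in>I. (1 + \<bar>x i\<bar>) ^ p)))"
      using C(2)[of "x(j := _)"] C(1) unfolding eq real_norm_def
      by (intro AE_I2) (meson abs_ge_self order_trans)
  qed
qed

lemma cauchy_schwarz_prob:
  fixes f :: "real \<Rightarrow> real"
  assumes "integrable \<nu> f" "integrable \<nu> (\<lambda>x. (f x)\<^sup>2)"
  shows "(\<integral>x. f x \<partial>\<nu>)\<^sup>2 \<le> (\<integral>x. (f x)\<^sup>2 \<partial>\<nu>)"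
  using variance_positive[of f] variance_eq[OF assms] by linarith

text \<open>The two sides differ by the square of the mean minus \<open>c\<close>. Taking for
  \<open>c\<close> the value at a coordinate set to 0 lets \<open>efron_stein\<close> compare with
  an updated point instead of an independent copy.\<close>

lemma variance_le_second_moment:
  fixes f :: "'z \<Rightarrow> real"
  assumes "prob_space M" "integrable M f" "integrable M (\<lambda>x. (f x)\<^sup>2)"
  shows "(\<integral>x. (f x)\<^sup>2 \<partial>M) - (\<integral>x. f x \<partial>M)\<^sup>2 \<le> (\<integral>x. (f x - c)\<^sup>2 \<partial>M)"
proof -
  interpret M: prob_space M by fact
  have "(\<integral>x. (f x - c)\<^sup>2 \<partial>M) = (\<integral>x. (f x)\<^sup>2 - 2 * c * f x + c\<^sup>2 \<partial>M)"
    by (simp add: power2_diff algebra_simps)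
  also have "\<dots> = (\<integral>x. (f x)\<^sup>2 \<partial>M) - 2 * c * (\<integral>x. f x \<partial>M) + c\<^sup>2"
    using assms(2,3) by (simp add: M.prob_space)
  finally have "(\<integral>x. (f x - c)\<^sup>2 \<partial>M) - ((\<integral>x. (f x)\<^sup>2 \<partial>M) - (\<integral>x. f x \<partial>M)\<^sup>2) = ((\<integral>x. f x \<partial>M) - c)\<^sup>2"
    by (simp add: power2_eq_square algebra_simps)
  then show ?thesis using zero_le_power2[of "(\<integral>x. f x \<partial>M) - c"] by linarith
qed

lemma expectation_insert:
  fixes F :: "_ \<Rightarrow> real"
  assumes "finite I" "j \<notin> I" "poly_growth (insert j I) F"
  shows "(\<integral>x. F x \<partial>P (insert j I)) = (\<integral>x. (\<integral>y. F (x(j := y)) \<partial>\<nu>) \<partial>P I)"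
  using assms by (intro prod.product_integral_insert integrable_poly_growth) auto

text \<open>Induction on the coordinates. The law of total variance splits off the variance in the
  new coordinate \<open>j\<close>, bounded by the second moment about the value at 0; what remains
  is the variance of the partial mean \<open>G\<close>, to which the induction hypothesis
  applies.\<close>

lemma efron_stein:
  fixes F :: "('i \<Rightarrow> real) \<Rightarrow> real"
  assumes "finite I" "poly_growth I F"
  shows "(\<integral>x. (F x)\<^sup>2 \<partial>P I) - (\<integral>x. F x \<partial>P I)\<^sup>2 \<le> (\<Sum>i\<in>I. \<integral>x. (F x - F (x(i := 0)))\<^sup>2 \<partial>P I)"
  using assms
proof (induction I arbitrary: F rule: finite_induct)
  case empty
  interpret E: prob_space "P ({} :: 'i set)" by (rule prob_space_P)
  have sp: "space (P ({} :: 'i set)) = {\<lambda>_. undefined}" by (simp add: space_PiM)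
  have *: "(\<integral>x. G x \<partial>P {}) = G (\<lambda>_. undefined)" for G :: "('i \<Rightarrow> real) \<Rightarrow> real"
  proof -
    have "(\<integral>x. G x \<partial>P {}) = (\<integral>x. G (\<lambda>_. undefined) \<partial>P ({} :: 'i set))"
      by (intro Bochner_Integration.integral_cong refl) (auto simp: sp)
    then show ?thesis by (simp add: E.prob_space)
  qed
  show ?case by (simp add: *)
next
  case (insert j I)
  note F = insert.prems
  note fin = insert.hyps(1) and j = insert.hyps(2)
  have fin': "finite (insert j I)" using fin by simp
  define G where "G x = (\<integral>y. F (x(j := y)) \<partial>\<nu>)" for x
  have G: "poly_growth I G"
    unfolding G_def by (rule poly_growth_integral_component[OF fin j F])
  have F2: "poly_growth (insert j I) (\<lambda>x. (F x)\<^sup>2)" using F by auto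
  have D: "poly_growth (insert j I) (\<lambda>x. (F x - F (x(i := 0)))\<^sup>2)" if "i \<in> insert j I" for i
    by (intro poly_growth_power poly_growth_diff poly_growth_update[OF fin' that F] F)
  have upd: "x(j := y, i := 0) = x(i := 0, j := y)" if "i \<in> I" for x :: "'i \<Rightarrow> real" and i y
    using that j by (auto simp: fun_eq_iff)
  have int: "integrable \<nu> (\<lambda>y. F (x(j := y)))" "integrable \<nu> (\<lambda>y. (F (x(j := y)))\<^sup>2)" if "x \<in> space (P I)" for x
    by (rule poly_growth_integral_component(2)[OF fin j F that]
        poly_growth_integral_component(2)[OF fin j F2 that])+
  have eF: "(\<integral>x. F x \<partial>P (insert j I)) = (\<integral>x. G x \<partial>P I)"
    unfolding G_def by (rule expectation_insert[OF fin j F])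
  have "(\<integral>x. (F x)\<^sup>2 \<partial>P (insert j I)) - (\<integral>x. F x \<partial>P (insert j I))\<^sup>2
      = (\<integral>x. (\<integral>y. (F (x(j := y)))\<^sup>2 \<partial>\<nu>) - (G x)\<^sup>2 \<partial>P I) + ((\<integral>x. (G x)\<^sup>2 \<partial>P I) - (\<integral>x. G x \<partial>P I)\<^sup>2)"
    unfolding eF expectation_insert[OF fin j F2]
    using integrable_poly_growth[OF fin poly_growth_integral_component(1)[OF fin j F2]]
      integrable_poly_growth[OF fin poly_growth_power[OF G, of 2]]
    by simp
  also have "(\<integral>x. (\<integral>y. (F (x(j := y)))\<^sup>2 \<partial>\<nu>) - (G x)\<^sup>2 \<partial>P I)
      \<le> (\<integral>x. (\<integral>y. (F (x(j := y)) - F (x(j := 0)))\<^sup>2 \<partial>\<nu>) \<partial>P I)"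
  proof (rule integral_mono)
    show "integrable (P I) (\<lambda>x. (\<integral>y. (F (x(j := y)))\<^sup>2 \<partial>\<nu>) - (G x)\<^sup>2)"
      using G poly_growth_integral_component(1)[OF fin j F2] by (auto intro!: integrable_poly_growth fin)
    have "poly_growth I (\<lambda>x. \<integral>y. (F (x(j := y)) - F (x(j := y, j := 0)))\<^sup>2 \<partial>\<nu>)"
      by (rule poly_growth_integral_component(1)[OF fin j D]) simp
    then show "integrable (P I) (\<lambda>x. \<integral>y. (F (x(j := y)) - F (x(j := 0)))\<^sup>2 \<partial>\<nu>)"
      by (auto intro!: integrable_poly_growth fin)
    show "(\<integral>y. (F (x(j := y)))\<^sup>2 \<partial>\<nu>) - (G x)\<^sup>2 \<le> (\<integral>y. (F (x(j := y)) - F (x(j := 0)))\<^sup>2 \<partial>\<nu>)"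
      if "x \<in> space (P I)" for x
      unfolding G_def by (rule variance_le_second_moment[OF prob_space_axioms int[OF that]])
  qed
  also have "\<dots> = (\<integral>x. (F x - F (x(j := 0)))\<^sup>2 \<partial>P (insert j I))"
    by (subst expectation_insert[OF fin j D]) auto
  also have "(\<integral>x. (G x)\<^sup>2 \<partial>P I) - (\<integral>x. G x \<partial>P I)\<^sup>2 \<le> (\<Sum>i\<in>I. \<integral>x. (G x - G (x(i := 0)))\<^sup>2 \<partial>P I)"
    by (rule insert.IH[OF G])
  \<comment> \<open>The influence of \<open>i\<close> on the partial mean is at most its influence
    on \<open>F\<close>, by Cauchy-Schwarz in the coordinate \<open>j\<close>.\<close>
  also have "\<dots> \<le> (\<Sum>i\<in>I. \<integral>x. (F x - F (x(i := 0)))\<^sup>2 \<partial>P (insert j I))"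
  proof (rule sum_mono)
    fix i assume i: "i \<in> I"
    have "(\<integral>x. (G x - G (x(i := 0)))\<^sup>2 \<partial>P I)
        \<le> (\<integral>x. (\<integral>y. (F (x(j := y)) - F (x(i := 0, j := y)))\<^sup>2 \<partial>\<nu>) \<partial>P I)"
    proof (rule integral_mono)
      show "integrable (P I) (\<lambda>x. (G x - G (x(i := 0)))\<^sup>2)"
        by (intro integrable_poly_growth poly_growth_power poly_growth_diff poly_growth_update[OF fin i G] G fin)
      have "poly_growth I (\<lambda>x. \<integral>y. (F (x(j := y)) - F (x(j := y, i := 0)))\<^sup>2 \<partial>\<nu>)"
        by (rule poly_growth_integral_component(1)[OF fin j D]) (simp add: i)
      then show "integrable (P I) (\<lambda>x. \<integral>y. (F (x(j := y)) - F (x(i := 0, j := y)))\<^sup>2 \<partial>\<nu>)"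
        using fin by (auto intro!: integrable_poly_growth simp: upd[OF i])
      fix x assume x: "x \<in> space (P I)"
      then have x0: "x(i := 0) \<in> space (P I)" using i by (auto simp: space_PiM extensional_def PiE_def)
      have intD: "integrable \<nu> (\<lambda>y. (F (x(j := y)) - F (x(i := 0, j := y)))\<^sup>2)"
        using poly_growth_integral_component(2)[OF fin j D x, of i] i by (simp add: upd[OF i])
      have "(G x - G (x(i := 0)))\<^sup>2 = (\<integral>y. F (x(j := y)) - F (x(i := 0, j := y)) \<partial>\<nu>)\<^sup>2"
        unfolding G_def by (subst Bochner_Integration.integral_diff[OF int(1)[OF x] int(1)[OF x0]]) simp
      also have "\<dots> \<le> (\<integral>y. (F (x(j := y)) - F (x(i := 0, j := y)))\<^sup>2 \<partial>\<nu>)"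
        using cauchy_schwarz_prob[OF Bochner_Integration.integrable_diff[OF int(1)[OF x] int(1)[OF x0]] intD] .
      finally show "(G x - G (x(i := 0)))\<^sup>2 \<le> (\<integral>y. (F (x(j := y)) - F (x(i := 0, j := y)))\<^sup>2 \<partial>\<nu>)" .
    qed
    also have "\<dots> = (\<integral>x. (F x - F (x(i := 0)))\<^sup>2 \<partial>P (insert j I))"
      using i by (subst expectation_insert[OF fin j D]) (auto simp: upd)
    finally show "(\<integral>x. (G x - G (x(i := 0)))\<^sup>2 \<partial>P I) \<le> (\<integral>x. (F x - F (x(i := 0)))\<^sup>2 \<partial>P (insert j I))" .
  qed
  finally show ?case by (simp only: sum.insert[OF fin j])
qed

end

subsection \<open>Linear forms in independent variables\<close>

lemma prod_add_expand:
  fixes f g :: "'a \<Rightarrow> 'b::comm_semiring_1"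
  assumes "finite A"
  shows "(\<Prod>s\<in>A. f s + g s) = (\<Sum>T\<in>Pow A. prod f T * prod g (A - T))"
  using assms
proof (induction A rule: finite_induct)
  case (insert a A)
  have inj: "inj_on (insert a) (Pow A)" using insert.hyps by (auto simp: inj_on_def)
  have disj: "Pow A \<inter> insert a ` Pow A = {}" using insert.hyps by auto
  have 1: "(\<Sum>T\<in>Pow A. prod f T * prod g (insert a A - T)) = (\<Sum>T\<in>Pow A. g a * (prod f T * prod g (A - T)))"
  proof (rule sum.cong[OF refl])
    fix T assume T: "T \<in> Pow A"
    then have "insert a A - T = insert a (A - T)" using insert.hyps by auto
    then show "prod f T * prod g (insert a A - T) = g a * (prod f T * prod g (A - T))"
      using insert.hyps by (simp add: mult_ac)
  qed
  have 2: "(\<Sum>T\<in>Pow A. prod f (insert a T) * prod g (A - T))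
      = (\<Sum>T\<in>Pow A. f a * (prod f T * prod g (A - T)))"
  proof (rule sum.cong[OF refl])
    fix T assume T: "T \<in> Pow A"
    then have "a \<notin> T" "finite T"
      using insert.hyps by (auto intro: finite_subset)
    then show "prod f (insert a T) * prod g (A - T) = f a * (prod f T * prod g (A - T))"
      by (simp add: mult_ac)
  qed
  have "(\<Sum>T\<in>Pow (insert a A). prod f T * prod g (insert a A - T))
      = (\<Sum>T\<in>Pow A. g a * (prod f T * prod g (A - T))) + (\<Sum>T\<in>Pow A. f a * (prod f T * prod g (A - T)))"
    using insert.hyps disj
    by (simp add: Pow_insert sum.union_disjoint sum.reindex[OF inj] 1 2)
  then show ?case
    using insert by (simp add: sum_distrib_left[symmetric] algebra_simps)
qed auto

definition linear_form :: "'i set \<Rightarrow> ('i \<Rightarrow> complex) \<Rightarrow> ('i \<Rightarrow> real) \<Rightarrow> complex" where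
  "linear_form I a x = (\<Sum>i\<in>I. a i * of_real (x i))"

lemma linear_form_split:
  assumes "finite I" "i \<in> I"
  shows "linear_form I a x = a i * of_real (x i) + linear_form I (a(i := 0)) x"
  using assms by (simp add: linear_form_def sum.remove)

lemma linear_form_update:
  assumes "finite I" "i \<in> I"
  shows "linear_form I a (x(i := 0)) = linear_form I a x - a i * of_real (x i)"
  using assms by (simp add: linear_form_def sum.remove)

lemma linear_form_indep: "linear_form I (a(i := 0)) (x(i := y)) = linear_form I (a(i := 0)) x"
  unfolding linear_form_def by (intro sum.cong) auto

lemma poly_growth_linear_form: "finite I \<Longrightarrow> poly_growth I (linear_form I a)"
  unfolding linear_form_def by (intro poly_growth_sum poly_growth_mult poly_growth_const
      poly_growth_of_real poly_growth_coord)

text \<open>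
  The scaling regime: about \<open>1 / h\<^sup>2\<close> coordinates, all with coefficients of order \<open>h\<close>.
\<close>

definition small_coeffs ::
    "real \<Rightarrow> real \<Rightarrow> 's set \<Rightarrow> 'i set \<Rightarrow> real \<Rightarrow> ('s \<Rightarrow> 'i \<Rightarrow> complex) \<Rightarrow> bool" where
  "small_coeffs K \<kappa> A I h a \<longleftrightarrow> finite I \<and> 0 < h \<and> h \<le> 1 \<and> real (card I) * h\<^sup>2 \<le> K \<and>
     (\<forall>s\<in>A. \<forall>i\<in>I. cmod (a s i) \<le> \<kappa> * h)"

lemma small_coeffs_subset: "small_coeffs K \<kappa> A I h a \<Longrightarrow> B \<subseteq> A \<Longrightarrow> small_coeffs K \<kappa> B I h a"
  by (auto simp: small_coeffs_def)

lemma small_coeffs_update: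
  "small_coeffs K \<kappa> A I h a \<Longrightarrow> \<kappa> \<ge> 0 \<Longrightarrow> small_coeffs K \<kappa> A I h (\<lambda>s. (a s)(i := 0))"
  by (auto simp: small_coeffs_def)

lemma small_coeffs_prod:
  assumes "small_coeffs K \<kappa> A I h a" "T \<subseteq> A" "i \<in> I" "\<kappa> \<ge> 1"
  shows "cmod (\<Prod>s\<in>T. a s i) \<le> (\<kappa> * h) ^ card T"
proof -
  have "cmod (\<Prod>s\<in>T. a s i) = (\<Prod>s\<in>T. cmod (a s i))" by (rule prod_norm[symmetric])
  also have "\<dots> \<le> (\<Prod>s\<in>T. \<kappa> * h)" using assms by (intro prod_mono) (auto simp: small_coeffs_def)
  finally show ?thesis by simp
qed

context iid_moments
begin

text \<open>Two applications of \<open>efron_stein\<close>. For \<open>Z\<close> it bounds the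
  second moment by the mean of \<open>V\<close>. For the square of \<open>Z\<close> it bounds E Z^4
  - (E Z^2)^2 by E Z^4 / 2 + 34 E V^2; moving the half to the left gives 2 * (34 + 1) = 70.\<close>

lemma fourth_moment_bound:
  fixes Z V :: "('i \<Rightarrow> real) \<Rightarrow> real"
  assumes I: "finite I" and Z: "poly_growth I Z" and V: "poly_growth I V"
    and Z0: "(\<integral>x. Z x \<partial>P I) = 0"
    and le: "\<And>x. (\<Sum>i\<in>I. (Z x - Z (x(i := 0)))\<^sup>2) \<le> V x"
  shows "(\<integral>x. (Z x) ^ 4 \<partial>P I) \<le> 70 * (\<integral>x. (V x)\<^sup>2 \<partial>P I)"
proof -
  interpret E: prob_space "P I" by (rule prob_space_P)
  note int = integrable_poly_growth[OF I]
  have V0: "V x \<ge> 0" for x using le[of x] sum_nonneg[of I "\<lambda>i. (Z x - Z (x(i := 0)))\<^sup>2"] by auto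
  note pg = poly_growth_power poly_growth_diff poly_growth_mult poly_growth_const poly_growth_sum
    poly_growth_add poly_growth_update[OF I _ Z] Z V poly_growth_update[OF I _ poly_growth_power[OF Z]]
  have EV: "E.expectation V \<ge> 0" using V0 by (intro integral_nonneg_AE AE_I2)
  have "(\<integral>x. (Z x)\<^sup>2 \<partial>P I) \<le> (\<Sum>i\<in>I. \<integral>x. (Z x - Z (x(i := 0)))\<^sup>2 \<partial>P I)"
    using efron_stein[OF I Z] Z0 by simp
  also have "\<dots> = (\<integral>x. (\<Sum>i\<in>I. (Z x - Z (x(i := 0)))\<^sup>2) \<partial>P I)"
    by (subst Bochner_Integration.integral_sum) (auto intro!: int pg)
  also have "\<dots> \<le> E.expectation V"
    by (intro integral_mono int pg) (auto intro: le)
  finally have "(\<integral>x. (Z x)\<^sup>2 \<partial>P I)\<^sup>2 \<le> (E.expectation V)\<^sup>2"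
    by (intro power_mono) auto
  also have "\<dots> \<le> (\<integral>x. (V x)\<^sup>2 \<partial>P I)"
    using E.variance_positive[of V] E.variance_eq[OF int[OF V] int[OF poly_growth_power[OF V, of 2]]] by linarith
  finally have 1: "(\<integral>x. (Z x)\<^sup>2 \<partial>P I)\<^sup>2 \<le> (\<integral>x. (V x)\<^sup>2 \<partial>P I)" .
  have "(\<integral>x. ((Z x)\<^sup>2)\<^sup>2 \<partial>P I) - (\<integral>x. (Z x)\<^sup>2 \<partial>P I)\<^sup>2
      \<le> (\<Sum>i\<in>I. \<integral>x. ((Z x)\<^sup>2 - (Z (x(i := 0)))\<^sup>2)\<^sup>2 \<partial>P I)"
    by (rule efron_stein[OF I poly_growth_power[OF Z]])
  also have "\<dots> = (\<integral>x. (\<Sum>i\<in>I. ((Z x)\<^sup>2 - (Z (x(i := 0)))\<^sup>2)\<^sup>2) \<partial>P I)"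
    by (subst Bochner_Integration.integral_sum) (auto intro!: int pg)
  also have "\<dots> \<le> (\<integral>x. (Z x) ^ 4 / 2 + 34 * (V x)\<^sup>2 \<partial>P I)"
  proof (intro integral_mono int pg poly_growth_divide)
    fix x
    define D where "D i = Z x - Z (x(i := 0))" for i
    have D: "(\<Sum>i\<in>I. (D i)\<^sup>2) \<le> V x" unfolding D_def by (rule le)
    have "((Z x)\<^sup>2 - (Z (x(i := 0)))\<^sup>2)\<^sup>2 \<le> (8 * (Z x)\<^sup>2 + 2 * V x) * (D i)\<^sup>2" if "i \<in> I" for i
    proof -
      have "(D i)\<^sup>2 \<le> V x" using D member_le_sum[OF that, of "\<lambda>i. (D i)\<^sup>2"] I by auto
      have "((Z x)\<^sup>2 - (Z (x(i := 0)))\<^sup>2)\<^sup>2 = (2 * Z x - D i)\<^sup>2 * (D i)\<^sup>2"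
        unfolding D_def by (simp add: power2_eq_square algebra_simps)
      also have "\<dots> \<le> (8 * (Z x)\<^sup>2 + 2 * (D i)\<^sup>2) * (D i)\<^sup>2"
        using zero_le_power2[of "2 * Z x + D i"]
        by (intro mult_right_mono) (auto simp: power2_eq_square algebra_simps)
      also have "\<dots> \<le> (8 * (Z x)\<^sup>2 + 2 * V x) * (D i)\<^sup>2"
        using \<open>(D i)\<^sup>2 \<le> V x\<close> by (intro mult_right_mono) auto
      finally show ?thesis .
    qed
    then have "(\<Sum>i\<in>I. ((Z x)\<^sup>2 - (Z (x(i := 0)))\<^sup>2)\<^sup>2) \<le> (8 * (Z x)\<^sup>2 + 2 * V x) * (\<Sum>i\<in>I. (D i)\<^sup>2)"
      unfolding sum_distrib_left by (intro sum_mono) auto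
    also have "\<dots> \<le> (8 * (Z x)\<^sup>2 + 2 * V x) * V x"
      using D V0[of x] by (intro mult_left_mono) auto
    \<comment> \<open>The left side is 8 Z^2 V + 2 V^2. Since Z^2 - 8 V has a nonnegative square, 8
      Z^2 V is at most Z^4 / 2 + 32 V^2, whence 34.\<close>
    also have "\<dots> \<le> (Z x) ^ 4 / 2 + 34 * (V x)\<^sup>2"
      using zero_le_power2[of "(Z x)\<^sup>2 - 8 * V x"]
      by (simp add: power2_eq_square power4_eq_xxxx algebra_simps)
    finally show "(\<Sum>i\<in>I. ((Z x)\<^sup>2 - (Z (x(i := 0)))\<^sup>2)\<^sup>2) \<le> (Z x) ^ 4 / 2 + 34 * (V x)\<^sup>2" .
  qed auto
  also have "\<dots> = (\<integral>x. (Z x) ^ 4 \<partial>P I) / 2 + 34 * (\<integral>x. (V x)\<^sup>2 \<partial>P I)"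
    using int[OF poly_growth_power[OF Z, of 4]] int[OF poly_growth_power[OF V, of 2]] by simp
  also have "(\<lambda>x. ((Z x)\<^sup>2)\<^sup>2) = (\<lambda>x. (Z x) ^ 4)"
    by (simp add: power_mult[symmetric])
  finally show ?thesis using 1 by linarith
qed

section \<open>Mixed moments of linear forms\<close>

definition \<mu> :: "nat \<Rightarrow> complex" where "\<mu> m = complex_of_real (\<integral>x. x ^ m \<partial>\<nu>)"

lemma \<mu>_simps: "\<mu> 0 = 1" "\<mu> (Suc 0) = 0" "\<mu> 2 = 1"
  using mean_0 second_moment_1 prob_space by (simp_all add: \<mu>_def)

text \<open>Each form is its term in \<open>x i\<close> plus a form that does not see
  \<open>x i\<close>. Expanding the product, \<open>T\<close> is the set of factors from which the
  term in \<open>x i\<close> is taken; independence then separates its power from the rest.\<close>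

lemma expectation_power_times_linear_forms:
  assumes I: "finite I" "i \<in> I" and A: "finite A"
  shows "(\<integral>x. of_real (x i) ^ p * (\<Prod>s\<in>A. linear_form I (a s) x) \<partial>P I) =
    (\<Sum>T\<in>Pow A. (\<Prod>s\<in>T. a s i) * \<mu> (p + card T) * (\<integral>x. (\<Prod>s\<in>A - T. linear_form I ((a s)(i := 0)) x) \<partial>P I))"
proof -
  note int = integrable_poly_growth[OF I(1)]
  note pg = poly_growth_power poly_growth_diff poly_growth_mult poly_growth_const poly_growth_sum
    poly_growth_add poly_growth_of_real poly_growth_coord[OF I] poly_growth_linear_form[OF I(1)] poly_growth_prod
  have *: "of_real (x i) ^ p * (\<Prod>s\<in>A. linear_form I (a s) x) = (\<Sum>T\<in>Pow A. (\<Prod>s\<in>T. a s i) *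
      (of_real (x i) ^ (p + card T) * (\<Prod>s\<in>A - T. linear_form I ((a s)(i := 0)) x)))" for x
    by (subst linear_form_split[OF I]) (simp add: prod_add_expand[OF A] sum_distrib_left prod.distrib power_add mult_ac)
  have **: "(\<integral>x. of_real (x i) ^ (p + card T) * (\<Prod>s\<in>A - T. linear_form I ((a s)(i := 0)) x) \<partial>P I) =
      \<mu> (p + card T) * (\<integral>x. (\<Prod>s\<in>A - T. linear_form I ((a s)(i := 0)) x) \<partial>P I)" for T
  proof -
    have "(\<integral>x. of_real (x i) ^ (p + card T) * (\<Prod>s\<in>A - T. linear_form I ((a s)(i := 0)) x) \<partial>P I) =
      (\<integral>y. complex_of_real y ^ (p + card T) \<partial>\<nu>) * (\<integral>x. (\<Prod>s\<in>A - T. linear_form I ((a s)(i := 0)) x) \<partial>P I)"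
      by (rule prod.integral_component_times[where g = "\<lambda>y. complex_of_real y ^ (p + card T)", OF I])
        (auto intro!: int pg simp: linear_form_indep)
    then show ?thesis by (simp add: \<mu>_def flip: of_real_power)
  qed
  show ?thesis
    unfolding * by (subst Bochner_Integration.integral_sum) (auto intro!: int pg simp: ** mult.assoc)
qed

end

text \<open>Of the \<open>t\<close> factors \<open>h\<close>, \<open>j\<close> are kept and the
  others are bounded by 1.\<close>

lemma small_power_bound:
  assumes "\<kappa> \<ge> (1::real)" "0 < h" "h \<le> 1" "j \<le> t" "t \<le> m"
  shows "(\<kappa> * h) ^ t \<le> \<kappa> ^ m * h ^ j"
proof -
  have "(\<kappa> * h) ^ t = \<kappa> ^ t * h ^ t" by (rule power_mult_distrib)
  also have "\<dots> \<le> \<kappa> ^ m * h ^ j"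
    using assms by (intro mult_mono power_increasing power_decreasing) auto
  finally show ?thesis .
qed

context iid_moments
begin

definition \<mu>_bound :: "nat \<Rightarrow> real" where "\<mu>_bound m = (\<Sum>j\<le>m. cmod (\<mu> j))"

lemma \<mu>_bound: "j \<le> m \<Longrightarrow> cmod (\<mu> j) \<le> \<mu>_bound m"
  unfolding \<mu>_bound_def by (rule member_le_sum[of j "{..m}" "\<lambda>j. cmod (\<mu> j)"]) auto

lemma \<mu>_bound_nonneg: "0 \<le> \<mu>_bound m"
  unfolding \<mu>_bound_def by (intro sum_nonneg) auto

text \<open>Bounds one term of \<open>expectation_power_times_linear_forms\<close>: a set
  \<open>T\<close> brings \<open>card T\<close> factors \<open>h\<close>, of which the applications
  keep one or two.\<close>

lemma expansion_term_bound:
  assumes a: "small_coeffs K \<kappa> A I h a" "\<kappa> \<ge> 1" "i \<in> I"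
    and T: "T \<subseteq> A" "j \<le> card T" "finite A" "card A \<le> m" "p + card T \<le> Suc m" and B: "cmod e \<le> B"
  shows "cmod ((\<Prod>s\<in>T. a s i) * \<mu> (p + card T) * e) \<le> \<kappa> ^ m * h ^ j * \<mu>_bound (Suc m) * B"
proof -
  have h: "0 < h" "h \<le> 1" using a(1) by (auto simp: small_coeffs_def)
  have cT: "card T \<le> m" using card_mono[OF T(3,1)] T(4) by simp
  have "cmod (\<Prod>s\<in>T. a s i) \<le> \<kappa> ^ m * h ^ j"
    using small_coeffs_prod[OF a(1) T(1) a(3,2)] small_power_bound[OF a(2) h T(2) cT] by linarith
  then show ?thesis
    unfolding norm_mult
    using \<mu>_bound[OF T(5)] B h a(2)
    by (intro mult_mono) (auto intro!: mult_nonneg_nonneg \<mu>_bound_nonneg)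
qed

lemma expectation_prod_linear_forms_insert:
  assumes I: "finite I" and A: "finite A" "a0 \<notin> A"
  shows "(\<integral>x. (\<Prod>s\<in>insert a0 A. linear_form I (a s) x) \<partial>P I) =
    (\<Sum>i\<in>I. a a0 i * (\<integral>x. of_real (x i) ^ 1 * (\<Prod>s\<in>A. linear_form I (a s) x) \<partial>P I))"
proof -
  note int = integrable_poly_growth[OF I(1)]
  note pg = poly_growth_power poly_growth_mult poly_growth_const poly_growth_of_real
    poly_growth_coord[OF I] poly_growth_linear_form[OF I] poly_growth_prod
  have *: "(\<Prod>s\<in>insert a0 A. linear_form I (a s) x) =
      (\<Sum>i\<in>I. a a0 i * (of_real (x i) ^ 1 * (\<Prod>s\<in>A. linear_form I (a s) x)))" for x
    using A by (simp add: linear_form_def[of I "a a0"] sum_distrib_right mult.assoc)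
  show ?thesis
    unfolding * by (subst Bochner_Integration.integral_sum) (auto intro!: int pg)
qed

text \<open>Induction on the number of forms. One form is written as a sum over the coordinates; the
  mean of \<open>x i\<close> times the remaining product is O(h), its coefficient is O(h), and there
  are about 1 / h^2 coordinates, so the sum stays bounded.\<close>

lemma moment_bound:
  assumes "K \<ge> 0" "\<kappa> \<ge> 1"
  shows "\<exists>B\<ge>1. \<forall>(A :: 's set) (I :: 'i set) h a. finite A \<and> card A \<le> m \<and> small_coeffs K \<kappa> A I h a \<longrightarrow>
    cmod (\<integral>x. (\<Prod>s\<in>A. linear_form I (a s) x) \<partial>P I) \<le> B"
proof (induction m)
  case 0
  have "cmod (\<integral>x. (\<Prod>s\<in>A. linear_form I (a s) x) \<partial>P I) \<le> 1"
    if "finite A" "card A \<le> 0" for A :: "'s set" and I :: "'i set" and a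
  proof -
    interpret E: prob_space "P I" by (rule prob_space_P)
    show ?thesis using that by (simp add: E.prob_space)
  qed
  then show ?case by (intro exI[of _ 1]) auto
next
  case (Suc m)
  then obtain B where B: "B \<ge> 1" and bound: "\<And>(A :: 's set) (I :: 'i set) h a. finite A \<Longrightarrow> card A \<le> m \<Longrightarrow>
      small_coeffs K \<kappa> A I h a \<Longrightarrow> cmod (\<integral>x. (\<Prod>s\<in>A. linear_form I (a s) x) \<partial>P I) \<le> B"
    by blast
  define C where "C = 2 ^ m * (\<kappa> ^ m * \<mu>_bound (Suc m) * B)"
  have C0: "C \<ge> 0" unfolding C_def using assms B \<mu>_bound_nonneg by auto
  have "cmod (\<integral>x. (\<Prod>s\<in>A. linear_form I (a s) x) \<partial>P I) \<le> B + \<kappa> * C * K"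
    if A: "finite A" "card A \<le> Suc m" and sc: "small_coeffs K \<kappa> A I h a" for A :: "'s set" and I :: "'i set" and h a
  proof (cases "card A \<le> m")
    case True
    then show ?thesis using bound[OF A(1) _ sc] assms C0 by (simp add: add_increasing2)
  next
    case False
    then have "A \<noteq> {}" using A by auto
    then obtain a0 where a0: "a0 \<in> A" by blast
    define A' where "A' = A - {a0}"
    have A': "finite A'" "a0 \<notin> A'" "A = insert a0 A'" "card A' = m" "A' \<subseteq> A"
      using a0 A False by (auto simp: A'_def)
    have h: "0 < h" "h \<le> 1" "finite I" "real (card I) * h\<^sup>2 \<le> K" using sc by (auto simp: small_coeffs_def)
    have inner: "cmod (\<integral>x. of_real (x i) ^ 1 * (\<Prod>s\<in>A'. linear_form I (a s) x) \<partial>P I) \<le> C * h" if i: "i \<in> I" for i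
    proof -
      have "cmod (\<integral>x. of_real (x i) ^ 1 * (\<Prod>s\<in>A'. linear_form I (a s) x) \<partial>P I)
          \<le> (\<Sum>T\<in>Pow A'. \<kappa> ^ m * h ^ 1 * \<mu>_bound (Suc m) * B)"
        unfolding expectation_power_times_linear_forms[OF h(3) i A'(1)]
      proof (rule sum_norm_le)
        fix T assume T: "T \<in> Pow A'"
        then have T': "finite T" "T \<subseteq> A'" "card T \<le> m" using A' by (auto intro: finite_subset card_mono)
        show "cmod ((\<Prod>s\<in>T. a s i) * \<mu> (1 + card T) *
            (\<integral>x. (\<Prod>s\<in>A' - T. linear_form I ((a s)(i := 0)) x) \<partial>P I)) \<le> \<kappa> ^ m * h ^ 1 * \<mu>_bound (Suc m) * B"
        \<comment> \<open>For empty \<open>T\<close> the term contains the first moment of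
          \<open>x i\<close>, which is 0. All other terms carry at least one factor
          \<open>h\<close>.\<close>
        proof (cases "T = {}")
          case True
          then show ?thesis using h assms B \<mu>_bound_nonneg by (simp add: \<mu>_simps)
        next
          case False
          have "small_coeffs K \<kappa> (A' - T) I h (\<lambda>s. (a s)(i := 0))"
            using small_coeffs_update[OF small_coeffs_subset[OF sc, of "A' - T"]] assms A' by auto
          moreover have "card (A' - T) \<le> m" using A' T' card_Diff_subset[of T A'] by linarith
          ultimately have "cmod (\<integral>x. (\<Prod>s\<in>A' - T. linear_form I ((a s)(i := 0)) x) \<partial>P I) \<le> B"
            using bound[of "A' - T" I h "\<lambda>s. (a s)(i := 0)"] A'(1) by auto
          then show ?thesis
            using False T' A' by (intro expansion_term_bound[OF small_coeffs_subset[OF sc A'(5)] assms(2) i])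
              (auto simp: Suc_le_eq card_gt_0_iff)
        qed
      qed
      also have "\<dots> = C * h" using A' by (simp add: C_def card_Pow mult_ac)
      finally show ?thesis .
    qed
    have "cmod (\<integral>x. (\<Prod>s\<in>A. linear_form I (a s) x) \<partial>P I) \<le> (\<Sum>i\<in>I. (\<kappa> * h) * (C * h))"
      unfolding A'(3) expectation_prod_linear_forms_insert[OF h(3) A'(1,2)]
    proof (rule sum_norm_le)
      fix i assume i: "i \<in> I"
      show "cmod (a a0 i * (\<integral>x. of_real (x i) ^ 1 * (\<Prod>s\<in>A'. linear_form I (a s) x) \<partial>P I)) \<le> \<kappa> * h * (C * h)"
        unfolding norm_mult using inner[OF i] sc i a0 h assms
        by (intro mult_mono) (auto simp: small_coeffs_def)
    qed
    also have "\<dots> = \<kappa> * C * (real (card I) * h\<^sup>2)" by (simp add: power2_eq_square mult_ac)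
    also have "\<dots> \<le> \<kappa> * C * K" using h assms C0 by (intro mult_left_mono) auto
    finally show ?thesis using B by linarith
  qed
  moreover have "B + \<kappa> * C * K \<ge> 1" using B assms C0 by (simp add: add_increasing2)
  ultimately show ?case by blast
qed

text \<open>Gaussian integration by parts up to an error. In the mean of \<open>x i\<close> times a
  product of forms, the sets \<open>T\<close> with one element give the main term and the others
  O(h^2). Summed over about 1 / h^2 coordinates with coefficients O(h), the error becomes
  O(h).\<close>

lemma wick_step:
  assumes K: "K \<ge> 0" "\<kappa> \<ge> 1"
  shows "\<exists>C\<ge>0. \<forall>(A :: 's set) (I :: 'i set) h a a0. finite A \<and> card A \<le> m \<and> a0 \<notin> A \<and>
      small_coeffs K \<kappa> (insert a0 A) I h a \<longrightarrow>
    cmod ((\<integral>x. (\<Prod>s\<in>insert a0 A. linear_form I (a s) x) \<partial>P I) -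
      (\<Sum>s\<in>A. (\<Sum>i\<in>I. a a0 i * a s i) * (\<integral>x. (\<Prod>s\<in>A - {s}. linear_form I (a s) x) \<partial>P I))) \<le> C * h"
proof -
  obtain B where B: "B \<ge> 1" and bound: "\<And>(A :: 's set) (I :: 'i set) h a. finite A \<Longrightarrow> card A \<le> m \<Longrightarrow>
      small_coeffs K \<kappa> A I h a \<Longrightarrow> cmod (\<integral>x. (\<Prod>s\<in>A. linear_form I (a s) x) \<partial>P I) \<le> B"
    using moment_bound[OF K, of m] by blast
  define D where "D = \<kappa> ^ m * \<mu>_bound (Suc m) * B"
  have D0: "D \<ge> 0" unfolding D_def using K B \<mu>_bound_nonneg by auto
  define C where "C = 2 ^ m * D + real m * \<kappa> * (2 ^ m * D)"
  have C0: "C \<ge> 0" unfolding C_def using K D0 by auto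
  have "cmod ((\<integral>x. (\<Prod>s\<in>insert a0 A. linear_form I (a s) x) \<partial>P I) -
      (\<Sum>s\<in>A. (\<Sum>i\<in>I. a a0 i * a s i) * (\<integral>x. (\<Prod>s\<in>A - {s}. linear_form I (a s) x) \<partial>P I))) \<le> K * \<kappa> * C * h"
    if A: "finite A" "card A \<le> m" "a0 \<notin> A" and sc': "small_coeffs K \<kappa> (insert a0 A) I h a"
    for A :: "'s set" and I :: "'i set" and h a a0
  proof -
    have sc: "small_coeffs K \<kappa> A I h a" using sc' small_coeffs_subset by blast
    have h: "0 < h" "h \<le> 1" "finite I" "real (card I) * h\<^sup>2 \<le> K" using sc by (auto simp: small_coeffs_def)
    define E where "E S = (\<integral>x. (\<Prod>s\<in>S. linear_form I (a s) x) \<partial>P I)" for S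
    have pow: "(\<Sum>T\<in>\<T>. D * h ^ j) \<le> 2 ^ m * D * h ^ j" if "\<T> \<subseteq> Pow A" for \<T> :: "'s set set" and j
    proof -
      have "card \<T> \<le> 2 ^ card A" using card_mono[OF _ that] A by (simp add: card_Pow)
      also have "\<dots> \<le> 2 ^ m" using A by (intro power_increasing) auto
      finally have "real (card \<T>) \<le> 2 ^ m" by (metis of_nat_le_iff of_nat_numeral of_nat_power)
      then have "real (card \<T>) * (D * h ^ j) \<le> 2 ^ m * (D * h ^ j)"
        using D0 h by (intro mult_right_mono) auto
      then show ?thesis by (simp add: mult.assoc)
    qed
    have inner: "cmod ((\<integral>x. of_real (x i) ^ 1 * (\<Prod>s\<in>A. linear_form I (a s) x) \<partial>P I)
        - (\<Sum>s\<in>A. a s i * E (A - {s}))) \<le> C * h\<^sup>2" if i: "i \<in> I" for i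
    proof -
      define e where "e S = (\<integral>x. (\<Prod>s\<in>S. linear_form I ((a s)(i := 0)) x) \<partial>P I)" for S
      have e_bound: "cmod (e S) \<le> B" if "S \<subseteq> A" for S
      proof -
        have "finite S" "card S \<le> m" using that A card_mono[OF A(1) that] by (auto intro: finite_subset)
        moreover have "small_coeffs K \<kappa> S I h (\<lambda>s. (a s)(i := 0))"
          using small_coeffs_update[OF small_coeffs_subset[OF sc that]] K by auto
        ultimately show ?thesis unfolding e_def using bound[of S I h "\<lambda>s. (a s)(i := 0)"] by auto
      qed
      define t where "t p S T = (\<Prod>s\<in>T. a s i) * \<mu> (p + card T) * e (S - T)" for p S T
      have t_bound: "cmod (t p S T) \<le> D * h ^ j" if "T \<subseteq> S" "S \<subseteq> A" "j \<le> card T" "p + card T \<le> Suc m" for p S T j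
      proof -
        have "S - T \<subseteq> A" using that by auto
        from expansion_term_bound[OF small_coeffs_subset[OF sc that(2)] K(2) i that(1,3) _ _ that(4) e_bound[OF this]]
        show ?thesis using that A card_mono[OF A(1) that(2)] finite_subset[OF that(2) A(1)]
          by (simp add: t_def D_def mult_ac)
      qed
      have card_T: "card T \<le> m" if "T \<subseteq> A" for T using card_mono[OF A(1) that] A by simp
      \<comment> \<open>Restoring the coordinate \<open>i\<close> in the remaining forms costs O(h),
        as each term of the expansion with nonempty \<open>T\<close> has a factor
        \<open>h\<close>.\<close>
      have single: "cmod (E (A - {s}) - e (A - {s})) \<le> 2 ^ m * D * h" if s: "s \<in> A" for s
      proof -
        have fin: "finite (A - {s})" using A by simp
        have "E (A - {s}) = (\<Sum>T\<in>Pow (A - {s}). t 0 (A - {s}) T)"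
          using expectation_power_times_linear_forms[OF h(3) i fin, of 0 a] by (simp add: E_def t_def e_def)
        also have "\<dots> = t 0 (A - {s}) {} + (\<Sum>T\<in>Pow (A - {s}) - {{}}. t 0 (A - {s}) T)"
          using fin by (intro sum.remove) auto
        finally have "E (A - {s}) - e (A - {s}) = (\<Sum>T\<in>Pow (A - {s}) - {{}}. t 0 (A - {s}) T)"
          by (simp add: t_def \<mu>_simps)
        also have "cmod \<dots> \<le> (\<Sum>T\<in>Pow (A - {s}) - {{}}. D * h ^ 1)"
        proof (rule sum_norm_le)
          fix T assume T: "T \<in> Pow (A - {s}) - {{}}"
          then have TA: "T \<subseteq> A" "finite T" "T \<noteq> {}" using A by (auto intro: finite_subset)
          then have "1 \<le> card T" by (simp add: Suc_le_eq card_gt_0_iff)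
          then show "cmod (t 0 (A - {s}) T) \<le> D * h ^ 1"
            using T card_T[OF TA(1)] by (intro t_bound) auto
        qed
        also have "\<dots> \<le> 2 ^ m * D * h ^ 1" by (rule pow) auto
        finally show ?thesis by simp
      qed
      \<comment> \<open>The singletons have weight \<open>\<mu> 2 = 1\<close>; the empty set has
        weight \<open>\<mu> 1 = 0\<close>.\<close>
      define Sg where "Sg = (\<lambda>s. {s}) ` A"
      have "(\<integral>x. of_real (x i) ^ 1 * (\<Prod>s\<in>A. linear_form I (a s) x) \<partial>P I) = (\<Sum>T\<in>Pow A. t 1 A T)"
        using expectation_power_times_linear_forms[OF h(3) i A(1), of 1 a] by (simp add: t_def e_def)
      also have "\<dots> = (\<Sum>T\<in>Pow A - Sg. t 1 A T) + (\<Sum>T\<in>Sg. t 1 A T)"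
        using A by (intro sum.subset_diff) (auto simp: Sg_def)
      also have "(\<Sum>T\<in>Sg. t 1 A T) = (\<Sum>s\<in>A. a s i * e (A - {s}))"
        unfolding Sg_def by (subst sum.reindex) (auto simp: t_def \<mu>_simps numeral_2_eq_2[symmetric])
      finally have eq: "(\<integral>x. of_real (x i) ^ 1 * (\<Prod>s\<in>A. linear_form I (a s) x) \<partial>P I) - (\<Sum>s\<in>A. a s i * E (A - {s}))
          = (\<Sum>T\<in>Pow A - Sg. t 1 A T) - (\<Sum>s\<in>A. a s i * (E (A - {s}) - e (A - {s})))"
        by (simp add: sum_subtractf algebra_simps)
      have b1: "cmod (\<Sum>T\<in>Pow A - Sg. t 1 A T) \<le> 2 ^ m * D * h\<^sup>2"
      proof -
        have "cmod (\<Sum>T\<in>Pow A - Sg. t 1 A T) \<le> (\<Sum>T\<in>Pow A - Sg. D * h\<^sup>2)"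
        proof (rule sum_norm_le)
          fix T assume T: "T \<in> Pow A - Sg"
          then have TA: "T \<subseteq> A" "finite T" using A by (auto intro: finite_subset)
          show "cmod (t 1 A T) \<le> D * h\<^sup>2"
          proof (cases "T = {}")
            case True
            then show ?thesis using D0 by (simp add: t_def \<mu>_simps)
          next
            case False
            have "card T \<noteq> 1" using T by (auto simp: Sg_def card_1_singleton_iff)
            then have "2 \<le> card T" using False TA by (cases "card T") (auto simp: card_eq_0_iff)
            then show ?thesis using TA card_T[OF TA(1)] by (intro t_bound) auto
          qed
        qed
        also have "\<dots> \<le> 2 ^ m * D * h\<^sup>2" by (rule pow) auto
        finally show ?thesis .
      qed
      have b2: "cmod (\<Sum>s\<in>A. a s i * (E (A - {s}) - e (A - {s}))) \<le> real m * \<kappa> * (2 ^ m * D) * h\<^sup>2"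
      proof -
        have "cmod (\<Sum>s\<in>A. a s i * (E (A - {s}) - e (A - {s}))) \<le> (\<Sum>s\<in>A. (\<kappa> * h) * (2 ^ m * D * h))"
        proof (rule sum_norm_le)
          fix s assume s: "s \<in> A"
          show "cmod (a s i * (E (A - {s}) - e (A - {s}))) \<le> \<kappa> * h * (2 ^ m * D * h)"
            unfolding norm_mult using single[OF s] sc s i K h
            by (intro mult_mono) (auto simp: small_coeffs_def)
        qed
        also have "\<dots> = real (card A) * (\<kappa> * (2 ^ m * D) * h\<^sup>2)" by (simp add: power2_eq_square mult_ac)
        also have "\<dots> \<le> real m * (\<kappa> * (2 ^ m * D) * h\<^sup>2)"
          using A K D0 by (intro mult_right_mono) auto
        finally show ?thesis by (simp add: mult_ac)
      qed
      show ?thesis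
        unfolding eq C_def distrib_right using b1 b2 by (intro order_trans[OF norm_triangle_ineq4] add_mono)
    qed
    have "(\<Sum>s\<in>A. (\<Sum>i\<in>I. a a0 i * a s i) * E (A - {s})) = (\<Sum>i\<in>I. a a0 i * (\<Sum>s\<in>A. a s i * E (A - {s})))"
      unfolding sum_distrib_left sum_distrib_right by (subst sum.swap) (simp add: mult_ac)
    then have "(\<integral>x. (\<Prod>s\<in>insert a0 A. linear_form I (a s) x) \<partial>P I) -
      (\<Sum>s\<in>A. (\<Sum>i\<in>I. a a0 i * a s i) * E (A - {s})) = (\<Sum>i\<in>I. a a0 i *
        ((\<integral>x. of_real (x i) ^ 1 * (\<Prod>s\<in>A. linear_form I (a s) x) \<partial>P I) - (\<Sum>s\<in>A. a s i * E (A - {s}))))"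
      unfolding expectation_prod_linear_forms_insert[OF h(3) A(1,3)]
      by (simp add: sum_subtractf algebra_simps)
    also have "cmod \<dots> \<le> (\<Sum>i\<in>I. (\<kappa> * h) * (C * h\<^sup>2))"
    proof (rule sum_norm_le)
      fix i assume i: "i \<in> I"
      show "cmod (a a0 i * ((\<integral>x. of_real (x i) ^ 1 * (\<Prod>s\<in>A. linear_form I (a s) x) \<partial>P I)
          - (\<Sum>s\<in>A. a s i * E (A - {s})))) \<le> \<kappa> * h * (C * h\<^sup>2)"
        unfolding norm_mult using inner[OF i] sc' i K h
        by (intro mult_mono) (auto simp: small_coeffs_def)
    qed
    also have "\<dots> = (real (card I) * h\<^sup>2) * (\<kappa> * C * h)" by (simp add: power2_eq_square mult_ac)
    also have "\<dots> \<le> K * (\<kappa> * C * h)" using h K C0 by (intro mult_right_mono) auto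
    finally show ?thesis by (simp add: E_def mult_ac)
  qed
  moreover have "K * \<kappa> * C \<ge> 0" using K C0 by auto
  ultimately show ?thesis by blast
qed

end

subsection \<open>Concentration\<close>

text \<open>The first-order bound, the second-order Taylor bound and the size bound go through one
  induction, because the second-order error for \<open>insert s A\<close> contains
  \<open>b s\<close> times the first-order error for \<open>A\<close>, and the latter contains
  \<open>b s\<close> times the product itself. The base \<open>2 * B * (1 + \<beta>)\<close> is
  chosen to dominate the factor B + 1 + \<beta> gained in each step.\<close>

lemma prod_perturbation:
  fixes y b :: "'a \<Rightarrow> complex"
  assumes "finite A" "\<beta> \<ge> 0" "B \<ge> 1" and "\<And>s. s \<in> A \<Longrightarrow> cmod (y s) \<le> B" "\<And>s. s \<in> A \<Longrightarrow> cmod (b s) \<le> \<beta>"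
  shows "cmod ((\<Prod>s\<in>A. y s - b s) - prod y A) \<le> \<beta> * (2 * B * (1 + \<beta>)) ^ card A \<and>
    cmod ((\<Prod>s\<in>A. y s - b s) - prod y A + (\<Sum>s\<in>A. b s * prod y (A - {s}))) \<le> \<beta>\<^sup>2 * (2 * B * (1 + \<beta>)) ^ card A \<and>
    cmod (prod y A) \<le> B ^ card A"
  using assms(1,4,5)
proof (induction A rule: finite_induct)
  case (insert s A)
  define G where "G = 2 * B * (1 + \<beta>)"
  define D where "D = (\<Prod>s\<in>A. y s - b s) - prod y A"
  define L where "L = (\<Sum>s\<in>A. b s * prod y (A - {s}))"
  define c where "c = card A"
  have IH: "cmod D \<le> \<beta> * G ^ c" "cmod (D + L) \<le> \<beta>\<^sup>2 * G ^ c" "cmod (prod y A) \<le> B ^ c"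
    using insert unfolding G_def D_def L_def c_def by auto
  have s: "cmod (y s) \<le> B" "cmod (b s) \<le> \<beta>" using insert.prems by auto
  have G: "G \<ge> B" "G \<ge> B + 1 + \<beta>" "G \<ge> 0"
  proof -
    have "0 \<le> B * \<beta>" "\<beta> \<le> B * \<beta>" using assms(2,3) mult_right_mono[of 1 B \<beta>] by auto
    then show "G \<ge> B" "G \<ge> B + 1 + \<beta>" "G \<ge> 0" using assms(2,3) by (auto simp: G_def algebra_simps)
  qed
  have BG: "B ^ c \<le> G ^ c" using G assms by (intro power_mono) auto
  have e1: "(\<Prod>r\<in>insert s A. y r - b r) - prod y (insert s A) = y s * D - b s * prod y A - b s * D"
    using insert.hyps by (simp add: D_def algebra_simps)
  have L': "(\<Sum>r\<in>insert s A. b r * prod y (insert s A - {r})) = b s * prod y A + y s * L"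
  proof -
    have "(\<Sum>r\<in>A. b r * prod y (insert s A - {r})) = (\<Sum>r\<in>A. y s * (b r * prod y (A - {r})))"
    proof (rule sum.cong[OF refl])
      fix r assume "r \<in> A"
      then have "insert s A - {r} = insert s (A - {r})" using insert.hyps by auto
      then show "b r * prod y (insert s A - {r}) = y s * (b r * prod y (A - {r}))"
        using insert.hyps by (simp add: mult_ac)
    qed
    moreover have "insert s A - {s} = A" using insert.hyps by auto
    ultimately show ?thesis using insert.hyps by (simp add: L_def sum_distrib_left)
  qed
  have e2: "(\<Prod>r\<in>insert s A. y r - b r) - prod y (insert s A) + (\<Sum>r\<in>insert s A. b r * prod y (insert s A - {r}))
      = y s * (D + L) - b s * D"
    unfolding e1 L' by (simp add: algebra_simps)
  have "cmod (y s * D - b s * prod y A - b s * D) \<le> cmod (y s * D) + cmod (b s * prod y A) + cmod (b s * D)"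
    by (intro order_trans[OF norm_triangle_ineq4] add_mono order_refl)
  also have "\<dots> \<le> B * (\<beta> * G ^ c) + \<beta> * G ^ c + \<beta> * (\<beta> * G ^ c)"
    unfolding norm_mult using IH s BG assms G by (intro add_mono mult_mono) auto
  also have "\<dots> = \<beta> * G ^ c * (B + 1 + \<beta>)" by (simp add: algebra_simps)
  also have "\<dots> \<le> \<beta> * G ^ c * G" using G assms by (intro mult_left_mono) auto
  finally have 1: "cmod (y s * D - b s * prod y A - b s * D) \<le> \<beta> * G ^ Suc c" by (simp add: mult_ac)
  have "cmod (y s * (D + L) - b s * D) \<le> cmod (y s * (D + L)) + cmod (b s * D)"
    by (rule norm_triangle_ineq4)
  also have "\<dots> \<le> B * (\<beta>\<^sup>2 * G ^ c) + \<beta> * (\<beta> * G ^ c)"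
    unfolding norm_mult using IH s BG assms G by (intro add_mono mult_mono) auto
  also have "\<dots> = \<beta>\<^sup>2 * G ^ c * (B + 1)" by (simp add: power2_eq_square algebra_simps)
  also have "\<dots> \<le> \<beta>\<^sup>2 * G ^ c * G" using G assms by (intro mult_left_mono) auto
  finally have 2: "cmod (y s * (D + L) - b s * D) \<le> \<beta>\<^sup>2 * G ^ Suc c" by (simp add: mult_ac)
  have 3: "cmod (prod y (insert s A)) \<le> B ^ Suc c"
    using insert.hyps IH(3) s assms by (simp add: norm_mult mult_mono)
  have "card (insert s A) = Suc c" using insert.hyps by (simp add: c_def)
  then show ?case unfolding e2 unfolding e1 using 1 2 3 by (simp only: G_def simp_thms)
qed (use assms in auto)

lemma norm_sum_squared_le: "(cmod (\<Sum>s\<in>A. z s))\<^sup>2 \<le> real (card A) * (\<Sum>s\<in>A. (cmod (z s))\<^sup>2)"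
proof -
  have "(cmod (\<Sum>s\<in>A. z s))\<^sup>2 \<le> (\<Sum>s\<in>A. cmod (z s))\<^sup>2"
    by (intro power_mono norm_sum) auto
  also have "\<dots> \<le> (\<Sum>s\<in>A. (cmod (z s))\<^sup>2) * real (card A)"
    by (rule sum_squared_le_sum_of_squares)
  finally show ?thesis by (simp add: mult.commute)
qed

lemma mean_squared_le: "((\<Sum>\<theta><n. b \<theta>) / real n)\<^sup>2 \<le> (\<Sum>\<theta><n. (b \<theta> :: real)\<^sup>2) / real n"
proof (cases "n = 0")
  case False
  have "(\<Sum>\<theta><n. b \<theta>)\<^sup>2 \<le> (\<Sum>\<theta><n. (b \<theta>)\<^sup>2) * real n"
    using sum_squared_le_sum_of_squares[of b "{..<n}"] by simp
  then show ?thesis using False by (simp add: power_divide power2_eq_square field_simps)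
qed auto

lemma sum_fourth_power_le:
  "(\<Sum>i\<in>I. g i :: real) ^ 4 \<le> real (card I) ^ 3 * (\<Sum>i\<in>I. g i ^ 4)"
proof -
  have "(\<Sum>i\<in>I. g i) ^ 4 = ((\<Sum>i\<in>I. g i)\<^sup>2)\<^sup>2" by (simp add: power_mult[symmetric])
  also have "\<dots> \<le> ((\<Sum>i\<in>I. (g i)\<^sup>2) * real (card I))\<^sup>2"
    by (intro power_mono sum_squared_le_sum_of_squares) auto
  also have "\<dots> \<le> ((\<Sum>i\<in>I. ((g i)\<^sup>2)\<^sup>2) * real (card I)) * (real (card I))\<^sup>2"
    unfolding power_mult_distrib by (intro mult_right_mono sum_squared_le_sum_of_squares) auto
  finally show ?thesis by (simp add: power_mult[symmetric] eval_nat_numeral mult_ac)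
qed

lemma sum_power_le_card_power:
  assumes "finite J" "\<And>j. j \<in> J \<Longrightarrow> b j \<ge> (0::real)" "J \<noteq> {}"
  shows "(\<Sum>j\<in>J. b j) ^ p \<le> real (card J) ^ p * (\<Sum>j\<in>J. b j ^ p)"
proof -
  define M where "M = Max (b ` J)"
  have "M \<in> b ` J" unfolding M_def using assms by (intro Max_in) auto
  then obtain m where m: "m \<in> J" "M = b m" by blast
  have "(\<Sum>j\<in>J. b j) \<le> (\<Sum>j\<in>J. M)" using assms by (intro sum_mono) (auto simp: M_def)
  then have "(\<Sum>j\<in>J. b j) ^ p \<le> (real (card J) * M) ^ p"
    using assms by (intro power_mono sum_nonneg) auto
  also have "\<dots> = real (card J) ^ p * b m ^ p" by (simp add: power_mult_distrib m)
  also have "\<dots> \<le> real (card J) ^ p * (\<Sum>j\<in>J. b j ^ p)"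
    using assms m by (intro mult_left_mono member_le_sum[of m J "\<lambda>j. b j ^ p"]) auto
  finally show ?thesis .
qed

text \<open>
  The last condition is a Bessel inequality for the vectors \<open>(a s \<theta> i)\<^sub>i\<close> indexed by the frequency \<open>\<theta>\<close>.
\<close>

definition bessel_coeffs ::
    "real \<Rightarrow> real \<Rightarrow> real \<Rightarrow> 's set \<Rightarrow> 'i set \<Rightarrow> nat \<Rightarrow> ('s \<Rightarrow> nat \<Rightarrow> 'i \<Rightarrow> complex) \<Rightarrow> bool" where
  "bessel_coeffs K \<kappa> L A I n a \<longleftrightarrow> 0 < n \<and> (\<forall>\<theta><n. small_coeffs K \<kappa> A I (1 / sqrt n) (\<lambda>s. a s \<theta>)) \<and>
     (\<forall>s\<in>A. \<forall>Q. (\<Sum>i\<in>I. (cmod (\<Sum>\<theta><n. a s \<theta> i * Q \<theta>))\<^sup>2) \<le> L * (\<Sum>\<theta><n. (cmod (Q \<theta>))\<^sup>2))"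

text \<open>With \<open>A\<close> the steps of a closed walk, this is the contribution of that walk
  to the normalised trace, up to a power of sqrt \<open>k\<close>; see
  \<open>power_trace_class_entries\<close>.\<close>

definition mean_product :: "'s set \<Rightarrow> 'i set \<Rightarrow> nat \<Rightarrow> ('s \<Rightarrow> nat \<Rightarrow> 'i \<Rightarrow> complex) \<Rightarrow> ('i \<Rightarrow> real) \<Rightarrow> complex" where
  "mean_product A I n a x = (\<Sum>\<theta><n. \<Prod>s\<in>A. linear_form I (a s \<theta>) x) / of_nat n"

text \<open>One bound for all the forms at a frequency; the summand 1 makes its powers increase with
  the exponent.\<close>

definition form_bound :: "'s set \<Rightarrow> 'i set \<Rightarrow> ('s \<Rightarrow> nat \<Rightarrow> 'i \<Rightarrow> complex) \<Rightarrow> ('i \<Rightarrow> real) \<Rightarrow> nat \<Rightarrow> real" where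
  "form_bound A I a x \<theta> = 1 + (\<Sum>s\<in>A. cmod (linear_form I (a s \<theta>) x))"

lemma form_bound_ge_1: "1 \<le> form_bound A I a x \<theta>"
  unfolding form_bound_def by (simp add: sum_nonneg)

lemma form_bound_ge: "finite A \<Longrightarrow> s \<in> A \<Longrightarrow> cmod (linear_form I (a s \<theta>) x) \<le> form_bound A I a x \<theta>"
  unfolding form_bound_def
  using member_le_sum[of s A "\<lambda>s. cmod (linear_form I (a s \<theta>) x)"] by simp

lemma poly_growth_mean_product: "finite I \<Longrightarrow> poly_growth I (mean_product A I n a)"
  unfolding mean_product_def by (intro poly_growth_divide poly_growth_sum poly_growth_prod poly_growth_linear_form)

lemma poly_growth_form_bound: "finite I \<Longrightarrow> poly_growth I (\<lambda>x. form_bound A I a x \<theta>)"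
  unfolding form_bound_def
  by (intro poly_growth_add poly_growth_const poly_growth_sum poly_growth_norm poly_growth_linear_form)

text \<open>Resetting \<open>x i\<close> changes the mean product by a term linear in
  \<open>x i\<close> and a remainder. The linear terms are summed over \<open>i\<close> with the
  Bessel inequality; estimating each of them by the size of its coefficients would lose a factor n.
  The remainder contains two coefficients and is O(1 / n) for each \<open>i\<close>, which is small
  enough.\<close>

lemma mean_product_gradient_bound:
  fixes x :: "'i \<Rightarrow> real"
  assumes a: "bessel_coeffs K \<kappa> L A I n a" and A: "finite A" and \<kappa>: "\<kappa> \<ge> 1" and L: "L \<ge> 0"
    and M0': "M \<ge> 0" and M: "\<And>i. i \<in> I \<Longrightarrow> (x i)\<^sup>2 \<le> M"
  defines "g \<equiv> \<lambda>y. \<kappa> ^ 4 * y ^ 4 * (2 * (1 + \<kappa> * \<bar>y\<bar>)) ^ (2 * card A)"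
  defines "S \<equiv> (\<Sum>\<theta><n. form_bound A I a x \<theta> ^ (2 * card A)) / n"
  shows "(\<Sum>i\<in>I. (cmod (mean_product A I n a x - mean_product A I n a (x(i := 0))))\<^sup>2)
    \<le> 2 * ((real (card A))\<^sup>2 * L * M + (\<Sum>i\<in>I. g (x i)) / n) * S / n"
proof -
  define c where "c = card A"
  define h where "h = 1 / sqrt (real n)"
  define B where "B = form_bound A I a x"
  define Y where "Y \<theta> s = linear_form I (a s \<theta>) x" for \<theta> s
  \<comment> \<open>\<open>Q s\<close> is the derivative of the product in its factor
    \<open>s\<close>, and \<open>R\<close> is the remainder of the first-order expansion.\<close>
  define Q where "Q s \<theta> = prod (Y \<theta>) (A - {s})" for s \<theta>
  define R where "R \<theta> i = (\<Prod>s\<in>A. Y \<theta> s - a s \<theta> i * x i) - prod (Y \<theta>) A + (\<Sum>s\<in>A. a s \<theta> i * x i * Q s \<theta>)" for \<theta> i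
  have n: "n > 0" using a by (simp add: bessel_coeffs_def)
  then have h: "0 < h" "h \<le> 1" "h\<^sup>2 = 1 / n" by (auto simp: h_def power_divide)
  have sc: "small_coeffs K \<kappa> A I h (\<lambda>s. a s \<theta>)" if "\<theta> < n" for \<theta> using a that by (simp add: bessel_coeffs_def h_def)
  have I: "finite I" using sc[OF n] by (simp add: small_coeffs_def)
  have B1: "B \<theta> \<ge> 1" for \<theta> unfolding B_def by (rule form_bound_ge_1)
  have YB: "cmod (Y \<theta> s) \<le> B \<theta>" if "s \<in> A" for \<theta> s unfolding Y_def B_def using form_bound_ge[OF A that] .
  have QB: "(cmod (Q s \<theta>))\<^sup>2 \<le> B \<theta> ^ (2 * c)" if "s \<in> A" for s \<theta>
  proof -
    have "cmod (Q s \<theta>) \<le> B \<theta> ^ card (A - {s})"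
      unfolding Q_def using prod_perturbation[of "A - {s}" 0 "B \<theta>" "Y \<theta>" "\<lambda>_. 0"] A B1 YB by auto
    also have "\<dots> \<le> B \<theta> ^ c" unfolding c_def using A B1 by (intro power_increasing card_mono) auto
    finally have "(cmod (Q s \<theta>))\<^sup>2 \<le> (B \<theta> ^ c)\<^sup>2" by (intro power_mono) auto
    then show ?thesis by (simp add: power_mult[symmetric] mult.commute)
  qed
  define S1 where "S1 = (\<Sum>\<theta><n. B \<theta> ^ (2 * c))"
  have S1: "S1 = n * S" using n by (simp add: S1_def S_def B_def c_def)
  have S0: "S \<ge> 0" unfolding S_def using form_bound_ge_1[of A I a x] by (intro divide_nonneg_nonneg sum_nonneg zero_le_power) (auto intro: order_trans[OF zero_le_one])
  have M0: "(x i)\<^sup>2 * z \<le> M * z" if "i \<in> I" "z \<ge> 0" for i z using M[OF that(1)] that(2) by (rule mult_right_mono)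
  have Rb: "cmod (R \<theta> i) \<le> (\<kappa>\<^sup>2 * (x i)\<^sup>2 / n) * (2 * (1 + \<kappa> * \<bar>x i\<bar>)) ^ c * B \<theta> ^ c" if "\<theta> < n" "i \<in> I" for \<theta> i
  proof -
    define \<beta> where "\<beta> = \<kappa> * h * \<bar>x i\<bar>"
    have \<beta>: "\<beta> \<ge> 0" "\<beta> \<le> \<kappa> * \<bar>x i\<bar>" using \<kappa> h
      by (auto simp: \<beta>_def mult_left_le_one_le intro!: mult_right_mono)
    have "cmod (a s \<theta> i * x i) \<le> \<beta>" if "s \<in> A" for s
      using sc[OF \<open>\<theta> < n\<close>] \<open>i \<in> I\<close> that unfolding \<beta>_def norm_mult small_coeffs_def
      by (intro mult_mono) (auto intro: order_trans[OF norm_ge_zero])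
    then have "cmod (R \<theta> i) \<le> \<beta>\<^sup>2 * (2 * B \<theta> * (1 + \<beta>)) ^ c"
      unfolding R_def Q_def c_def using prod_perturbation[of A \<beta> "B \<theta>" "Y \<theta>" "\<lambda>s. a s \<theta> i * x i"] A B1 YB \<beta> by auto
    also have "\<dots> \<le> \<beta>\<^sup>2 * (2 * B \<theta> * (1 + \<kappa> * \<bar>x i\<bar>)) ^ c"
      using \<beta> B1[of \<theta>] by (intro mult_left_mono power_mono) auto
    also have "\<beta>\<^sup>2 = \<kappa>\<^sup>2 * (x i)\<^sup>2 / n" by (simp add: \<beta>_def power_mult_distrib h)
    also have "(2 * B \<theta> * (1 + \<kappa> * \<bar>x i\<bar>)) ^ c = (2 * (1 + \<kappa> * \<bar>x i\<bar>)) ^ c * B \<theta> ^ c"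
      by (simp add: power_mult_distrib mult_ac)
    finally show ?thesis by (simp add: mult.assoc)
  qed
  have mid: "(cmod (mean_product A I n a x - mean_product A I n a (x(i := 0))))\<^sup>2
      \<le> 2 * (M * (cmod (\<Sum>s\<in>A. \<Sum>\<theta><n. a s \<theta> i * Q s \<theta>))\<^sup>2 / (real n)\<^sup>2) + 2 * (g (x i) * S / (real n)\<^sup>2)" if i: "i \<in> I" for i
  proof -
    define F where "F = (\<Sum>s\<in>A. \<Sum>\<theta><n. a s \<theta> i * Q s \<theta>)"
    define RR where "RR = (\<Sum>\<theta><n. R \<theta> i) / of_nat n"
    have "mean_product A I n a x - mean_product A I n a (x(i := 0)) =
        (\<Sum>\<theta><n. (\<Sum>s\<in>A. a s \<theta> i * x i * Q s \<theta>) - R \<theta> i) / of_nat n"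
      unfolding mean_product_def linear_form_update[OF I i] R_def Y_def
      by (simp add: diff_divide_distrib sum_subtractf sum.distrib)
    also have "\<dots> = x i * F / of_nat n - RR"
      unfolding sum_subtractf diff_divide_distrib RR_def F_def sum_distrib_left
      by (subst (2) sum.swap) (simp add: mult_ac)
    finally have eq: "mean_product A I n a x - mean_product A I n a (x(i := 0)) = x i * F / of_nat n - RR" .
    have "(cmod (x i * F / of_nat n - RR))\<^sup>2 \<le> (cmod (x i * F / of_nat n) + cmod RR)\<^sup>2"
      by (intro power_mono norm_triangle_ineq4) auto
    also have "\<dots> \<le> 2 * (cmod (x i * F / of_nat n))\<^sup>2 + 2 * (cmod RR)\<^sup>2"
      using zero_le_power2[of "cmod (x i * F / of_nat n) - cmod RR"] by (simp add: power2_eq_square algebra_simps)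
    also have "(cmod (x i * F / of_nat n))\<^sup>2 = (x i)\<^sup>2 * (cmod F)\<^sup>2 / (real n)\<^sup>2"
      by (simp add: norm_mult norm_divide power_mult_distrib power_divide)
    also have "\<dots> \<le> M * (cmod F)\<^sup>2 / (real n)\<^sup>2"
      by (intro divide_right_mono M0 i) auto
    also have "(cmod RR)\<^sup>2 \<le> g (x i) * S / (real n)\<^sup>2"
    proof -
      define w where "w = \<kappa>\<^sup>2 * (x i)\<^sup>2 * (2 * (1 + \<kappa> * \<bar>x i\<bar>)) ^ c"
      have w0: "w \<ge> 0" unfolding w_def using \<kappa> by auto
      have "cmod (\<Sum>\<theta><n. R \<theta> i) \<le> (\<Sum>\<theta><n. (w / n) * B \<theta> ^ c)"
        using Rb[OF _ i] by (intro sum_norm_le) (auto simp: w_def mult_ac)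
      then have "cmod RR \<le> (\<Sum>\<theta><n. (w / n) * B \<theta> ^ c) / n"
        by (simp add: RR_def norm_divide divide_right_mono)
      also have "\<dots> = (w / n) * ((\<Sum>\<theta><n. B \<theta> ^ c) / n)" by (simp add: sum_distrib_left)
      finally have "(cmod RR)\<^sup>2 \<le> ((w / n) * ((\<Sum>\<theta><n. B \<theta> ^ c) / n))\<^sup>2"
        by (intro power_mono) auto
      also have "\<dots> = (w / n)\<^sup>2 * ((\<Sum>\<theta><n. B \<theta> ^ c) / n)\<^sup>2" by (rule power_mult_distrib)
      also have "\<dots> \<le> (w / n)\<^sup>2 * ((\<Sum>\<theta><n. (B \<theta> ^ c)\<^sup>2) / n)"
        by (intro mult_left_mono mean_squared_le) auto
      also have "(\<Sum>\<theta><n. (B \<theta> ^ c)\<^sup>2) / n = S"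
        unfolding S_def B_def c_def by (simp add: power_mult[symmetric] mult.commute)
      also have "(w / n)\<^sup>2 = g (x i) / (real n)\<^sup>2"
        by (simp add: w_def g_def power_divide power_mult_distrib c_def mult.commute[of 2] flip: power_mult)
      finally show ?thesis by simp
    qed
    finally show ?thesis unfolding eq F_def by simp
  qed
  have "(\<Sum>i\<in>I. (cmod (\<Sum>s\<in>A. \<Sum>\<theta><n. a s \<theta> i * Q s \<theta>))\<^sup>2)
      \<le> (\<Sum>i\<in>I. real c * (\<Sum>s\<in>A. (cmod (\<Sum>\<theta><n. a s \<theta> i * Q s \<theta>))\<^sup>2))"
    unfolding c_def by (intro sum_mono norm_sum_squared_le)
  also have "\<dots> = real c * (\<Sum>s\<in>A. \<Sum>i\<in>I. (cmod (\<Sum>\<theta><n. a s \<theta> i * Q s \<theta>))\<^sup>2)"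
    by (subst sum.swap) (simp add: sum_distrib_left)
  also have "\<dots> \<le> real c * (\<Sum>s\<in>A. L * S1)"
  proof (intro mult_left_mono sum_mono)
    fix s assume s: "s \<in> A"
    have "(\<Sum>i\<in>I. (cmod (\<Sum>\<theta><n. a s \<theta> i * Q s \<theta>))\<^sup>2) \<le> L * (\<Sum>\<theta><n. (cmod (Q s \<theta>))\<^sup>2)"
      using a s by (simp add: bessel_coeffs_def)
    also have "\<dots> \<le> L * S1" unfolding S1_def using QB[OF s] L by (intro mult_left_mono sum_mono) auto
    finally show "(\<Sum>i\<in>I. (cmod (\<Sum>\<theta><n. a s \<theta> i * Q s \<theta>))\<^sup>2) \<le> L * S1" .
  qed auto
  also have "\<dots> = (real c)\<^sup>2 * L * (n * S)" by (simp add: c_def S1 power2_eq_square)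
  finally have first: "(\<Sum>i\<in>I. (cmod (\<Sum>s\<in>A. \<Sum>\<theta><n. a s \<theta> i * Q s \<theta>))\<^sup>2) \<le> (real c)\<^sup>2 * L * (n * S)" .
  have "(\<Sum>i\<in>I. (cmod (mean_product A I n a x - mean_product A I n a (x(i := 0))))\<^sup>2)
    \<le> (\<Sum>i\<in>I. 2 * (M * (cmod (\<Sum>s\<in>A. \<Sum>\<theta><n. a s \<theta> i * Q s \<theta>))\<^sup>2 / (real n)\<^sup>2) + 2 * (g (x i) * S / (real n)\<^sup>2))"
    by (intro sum_mono mid)
  also have "\<dots> = 2 * M / (real n)\<^sup>2 * (\<Sum>i\<in>I. (cmod (\<Sum>s\<in>A. \<Sum>\<theta><n. a s \<theta> i * Q s \<theta>))\<^sup>2)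
      + 2 * (\<Sum>i\<in>I. g (x i)) * S / (real n)\<^sup>2"
    by (simp add: sum.distrib sum_distrib_left sum_distrib_right sum_divide_distrib mult_ac)
  also have "\<dots> \<le> 2 * M / (real n)\<^sup>2 * ((real c)\<^sup>2 * L * (n * S)) + 2 * (\<Sum>i\<in>I. g (x i)) * S / (real n)\<^sup>2"
    using M0' by (intro add_right_mono mult_left_mono first) auto
  also have "\<dots> = 2 * ((real c)\<^sup>2 * L * M + (\<Sum>i\<in>I. g (x i)) / n) * S / n"
    using n by (simp add: field_simps power2_eq_square)
  finally show ?thesis by (simp add: c_def)
qed


context iid_moments
begin

text \<open>The power of the absolute value is a product of \<open>r\<close> copies of the form and
  \<open>r\<close> copies of the form with conjugate coefficients, so \<open>moment_bound\<close>
  applies with index set \<open>{..<2 * r}\<close>.\<close>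

lemma even_moment_bound:
  assumes "K \<ge> 0" "\<kappa> \<ge> 1"
  shows "\<exists>B\<ge>0. \<forall>(A :: 's set) (I :: 'i set) h a. small_coeffs K \<kappa> A I h a \<longrightarrow>
    (\<forall>s\<in>A. (\<integral>x. cmod (linear_form I (a s) x) ^ (2 * r) \<partial>P I) \<le> B)"
proof -
  obtain B where B: "B \<ge> 1" and bound: "\<And>(A :: nat set) (I :: 'i set) h a. finite A \<Longrightarrow> card A \<le> 2 * r \<Longrightarrow>
      small_coeffs K \<kappa> A I h a \<Longrightarrow> cmod (\<integral>x. (\<Prod>s\<in>A. linear_form I (a s) x) \<partial>P I) \<le> B"
    using moment_bound[OF assms, of "2 * r"] by blast
  have "(\<integral>x. cmod (linear_form I (a s) x) ^ (2 * r) \<partial>P I) \<le> B"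
    if sc: "small_coeffs K \<kappa> A I h a" and s: "s \<in> A" for A :: "'s set" and I :: "'i set" and h a s
  proof -
    define b where "b j = (if j < r then a s else (\<lambda>i. cnj (a s i)))" for j
    have cnj: "linear_form I (\<lambda>i. cnj (a s i)) x = cnj (linear_form I (a s) x)" for x
      by (simp add: linear_form_def)
    have prod: "(\<Prod>j<2 * r. linear_form I (b j) x) = of_real (cmod (linear_form I (a s) x) ^ (2 * r))" for x
    proof -
      have "(\<Prod>j<2 * r. linear_form I (b j) x) = (\<Prod>j<r. linear_form I (b j) x) * (\<Prod>j\<in>{r..<2 * r}. linear_form I (b j) x)"
        by (subst prod.union_disjoint[symmetric]) (auto intro!: prod.cong)
      also have "\<dots> = linear_form I (a s) x ^ r * cnj (linear_form I (a s) x) ^ r"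
        by (simp add: b_def cnj)
      also have "\<dots> = of_real (cmod (linear_form I (a s) x) ^ (2 * r))"
        by (simp add: power_mult complex_norm_square[unfolded of_real_power] flip: power_mult_distrib)
      finally show ?thesis .
    qed
    have "small_coeffs K \<kappa> {..<2 * r} I h b" using sc s by (auto simp: small_coeffs_def b_def)
    then have "cmod (\<integral>x. (\<Prod>j<2 * r. linear_form I (b j) x) \<partial>P I) \<le> B"
      using bound by auto
    then show ?thesis unfolding prod integral_complex_of_real norm_of_real by linarith
  qed
  then show ?thesis using B by (intro exI[of _ B]) auto
qed

text \<open>By \<open>mean_product_gradient_bound\<close> the square of \<open>V\<close> is O(n^-2)
  times S^2 (M + G)^2. The mean of S^4 is bounded and that of (M + G)^4 is O(n); the
  arithmetic-geometric mean inequality with weight sqrt n balances the two and leaves n^(-3/2). The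
  exponent \<open>8 * c\<close> in \<open>T\<close> comes from the fourth power of
  \<open>S\<close>.\<close>

lemma concentration:
  assumes K: "K \<ge> 0" "\<kappa> \<ge> 1" "L \<ge> 0" and A: "finite (A :: 's set)"
  shows "\<exists>C. \<forall>(I :: 'i set) n a. bessel_coeffs K \<kappa> L A I n a \<longrightarrow>
    (\<integral>x. cmod (mean_product A I n a x - (\<integral>y. mean_product A I n a y \<partial>P I)) ^ 4 \<partial>P I)
      \<le> C / (real n * sqrt (real n))"
proof -
  define c where "c = card A"
  define g where "g y = \<kappa> ^ 4 * y ^ 4 * (2 * (1 + \<kappa> * \<bar>y\<bar>)) ^ (2 * c)" for y
  obtain B where B: "B \<ge> 0" and Bb: "\<And>(A :: 's set) (I :: 'i set) h a s. small_coeffs K \<kappa> A I h a \<Longrightarrow>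
    s \<in> A \<Longrightarrow> (\<integral>x. cmod (linear_form I (a s) x) ^ (2 * (4 * c)) \<partial>P I) \<le> B"
    using even_moment_bound[OF K(1,2), of "4 * c"] by blast
  define mg where "mg = (\<integral>y. y ^ 8 \<partial>\<nu>) + K ^ 3 * (\<integral>y. g y ^ 4 \<partial>\<nu>)"
  define C1 where "C1 = real (c + 1) ^ (8 * c) * (1 + real c * B)"
  define C2 where "C2 = 2 * ((real c)\<^sup>2 * L + 1)"
  define C where "C = C2\<^sup>2 / 2 * (C1 + 8 * K * mg)"
  have "(\<integral>x. cmod (mean_product A I n a x - (\<integral>y. mean_product A I n a y \<partial>P I)) ^ 4 \<partial>P I)
      \<le> 4 * 70 * C / (real n * sqrt (real n))"
    if a: "bessel_coeffs K \<kappa> L A I n a" for I :: "'i set" and n a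
  proof -
    interpret E: prob_space "P I" by (rule prob_space_P)
    have n: "n > 0" using a by (simp add: bessel_coeffs_def)
    have sc: "small_coeffs K \<kappa> A I (1 / sqrt n) (\<lambda>s. a s \<theta>)" if "\<theta> < n" for \<theta>
      using a that by (simp add: bessel_coeffs_def)
    have I: "finite I" using sc[OF n] by (simp add: small_coeffs_def)
    have cardI: "real (card I) \<le> K * n" using sc[OF n] n by (simp add: small_coeffs_def power_divide field_simps)
    note int = integrable_poly_growth[OF I]
    define \<Phi> where "\<Phi> = mean_product A I n a"
    have \<Phi>: "poly_growth I \<Phi>" unfolding \<Phi>_def by (rule poly_growth_mean_product[OF I])
    define V where "V x = (\<Sum>i\<in>I. (cmod (\<Phi> x - \<Phi> (x(i := 0))))\<^sup>2)" for x
    define T where "T x = (\<Sum>\<theta><n. form_bound A I a x \<theta> ^ (8 * c)) / n" for x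
    define W where "W x = (\<Sum>i\<in>I. x i ^ 8 + K ^ 3 * g (x i) ^ 4)" for x
    define U where "U x = (C2 / n)\<^sup>2 / 2 * (sqrt n * T x + 8 * W x / sqrt n)" for x
    have g: "poly_growth I (\<lambda>x. g (x i))" if "i \<in> I" for i
      unfolding g_def using I that
      by (intro poly_growth_mult poly_growth_power poly_growth_const poly_growth_add
          poly_growth_norm[where f = "\<lambda>x. x i", unfolded real_norm_def] poly_growth_coord)
    have T: "poly_growth I T" unfolding T_def
      by (intro poly_growth_divide poly_growth_sum poly_growth_power poly_growth_form_bound I)
    have W: "poly_growth I W" unfolding W_def
      by (intro poly_growth_sum poly_growth_add poly_growth_mult poly_growth_const poly_growth_power g poly_growth_coord I)
    have U: "poly_growth I U" unfolding U_def
      by (intro poly_growth_mult poly_growth_const poly_growth_add poly_growth_divide T W)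
    have V: "poly_growth I V" unfolding V_def
      by (intro poly_growth_sum poly_growth_power poly_growth_norm poly_growth_diff \<Phi> poly_growth_update[OF I _ \<Phi>])
    have VU: "(V x)\<^sup>2 \<le> U x" for x
    proof -
      define w where "w = (\<Sum>i\<in>I. x i ^ 8)"
      have w0: "w \<ge> 0" unfolding w_def by (intro sum_nonneg) auto
      \<comment> \<open>A majorant of all squared coordinates whose fourth power is a sum over the
        coordinates, so that its mean is explicit.\<close>
      define M where "M = root 4 w"
      have M: "M \<ge> 0" "M ^ 4 = w" using w0 by (auto simp: M_def real_root_ge_zero real_root_pow_pos2)
      have xM: "(x i)\<^sup>2 \<le> M" if "i \<in> I" for i
      proof -
        have "((x i)\<^sup>2) ^ 4 \<le> M ^ 4"
          unfolding M w_def using member_le_sum[OF that, of "\<lambda>i. x i ^ 8"] I by (simp flip: power_mult)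
        then show ?thesis using M by (metis power_mono_iff zero_le_power2 zero_less_numeral)
      qed
      define S where "S = (\<Sum>\<theta><n. form_bound A I a x \<theta> ^ (2 * c)) / n"
      define G where "G = (\<Sum>i\<in>I. g (x i)) / n"
      have S0: "S \<ge> 0" unfolding S_def
        using form_bound_ge_1[of A I a x] by (intro divide_nonneg_nonneg sum_nonneg zero_le_power) (auto intro: order_trans[OF zero_le_one])
      have g0: "g y \<ge> 0" for y unfolding g_def using K by (intro mult_nonneg_nonneg) auto
      have G0: "G \<ge> 0" unfolding G_def using g0 by (intro divide_nonneg_nonneg sum_nonneg) auto
      have V0: "V x \<ge> 0" unfolding V_def by (intro sum_nonneg) auto
      have "V x \<le> 2 * ((real c)\<^sup>2 * L * M + G) * S / n"
        unfolding V_def \<Phi>_def S_def G_def g_def c_def by (rule mean_product_gradient_bound[OF a A K(2,3) M(1) xM])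
      also have "\<dots> \<le> C2 * (M + G) * S / n"
      proof -
        have "0 \<le> (real c)\<^sup>2 * L * G" "0 \<le> M" using G0 K M by auto
        then have "2 * ((real c)\<^sup>2 * L * M + G) \<le> C2 * (M + G)" by (simp add: C2_def algebra_simps)
        then show ?thesis using S0 by (intro divide_right_mono mult_right_mono) auto
      qed
      finally have "(V x)\<^sup>2 \<le> (C2 * (M + G) * S / n)\<^sup>2" using V0 by (intro power_mono) auto
      also have "\<dots> = (C2 / n)\<^sup>2 * (S\<^sup>2 * (M + G)\<^sup>2)" by (simp add: power_mult_distrib power_divide mult_ac)
      also have "S\<^sup>2 * (M + G)\<^sup>2 \<le> (sqrt n * S ^ 4 + (M + G) ^ 4 / sqrt n) / 2"
      proof -
        define q where "q = sqrt n"
        have q: "q > 0" using n by (simp add: q_def)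
        have "0 \<le> (q * S\<^sup>2 - (M + G)\<^sup>2)\<^sup>2 / q" using q by auto
        also have "\<dots> = q * S ^ 4 + (M + G) ^ 4 / q - 2 * (S\<^sup>2 * (M + G)\<^sup>2)"
          using q by (simp add: power2_diff field_simps power2_eq_square eval_nat_numeral)
        finally show ?thesis by (simp add: q_def)
      qed
      also have "S ^ 4 \<le> T x"
      proof -
        have "S ^ 4 = (S\<^sup>2)\<^sup>2" by (simp flip: power_mult)
        also have "\<dots> \<le> ((\<Sum>\<theta><n. (form_bound A I a x \<theta> ^ (2 * c))\<^sup>2) / n)\<^sup>2"
          unfolding S_def by (intro power_mono mean_squared_le) auto
        also have "\<dots> \<le> (\<Sum>\<theta><n. ((form_bound A I a x \<theta> ^ (2 * c))\<^sup>2)\<^sup>2) / n"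
          by (rule mean_squared_le)
        finally show ?thesis unfolding T_def by (simp add: mult_ac flip: power_mult)
      qed
      also have "(M + G) ^ 4 \<le> 8 * W x"
      proof -
        \<comment> \<open>The fourth power of a sum of two terms, as an instance of
          \<open>sum_fourth_power_le\<close>; the factor 8 is the cube of the number of
          terms.\<close>
        have "(\<Sum>i\<in>{0, 1::nat}. if i = 0 then M else G) ^ 4 \<le> real (card {0, 1::nat}) ^ 3 * (\<Sum>i\<in>{0, 1::nat}. (if i = 0 then M else G) ^ 4)"
          by (rule sum_fourth_power_le)
        then have "(M + G) ^ 4 \<le> 8 * (w + G ^ 4)" by (simp add: M)
        moreover have "G ^ 4 \<le> K ^ 3 * (\<Sum>i\<in>I. g (x i) ^ 4)"
        proof -
          have "G ^ 4 = (\<Sum>i\<in>I. g (x i)) ^ 4 / real n ^ 4" by (simp add: G_def power_divide)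
          also have "\<dots> \<le> (real (card I) ^ 3 * (\<Sum>i\<in>I. g (x i) ^ 4)) / real n ^ 4"
            by (intro divide_right_mono sum_fourth_power_le) auto
          also have "\<dots> \<le> ((K * n) ^ 3 * (\<Sum>i\<in>I. g (x i) ^ 4)) / real n ^ 4"
            using cardI g0 by (intro divide_right_mono mult_right_mono power_mono sum_nonneg) auto
          also have "\<dots> = (K ^ 3 * (\<Sum>i\<in>I. g (x i) ^ 4)) / real n"
            using n by (simp add: power_mult_distrib field_simps eval_nat_numeral)
          also have "\<dots> \<le> K ^ 3 * (\<Sum>i\<in>I. g (x i) ^ 4)"
            using n K g0 by (intro divide_left_mono[of 1 "real n" "K ^ 3 * (\<Sum>i\<in>I. g (x i) ^ 4)", simplified] mult_nonneg_nonneg sum_nonneg) auto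
          finally show ?thesis .
        qed
        ultimately have "(M + G) ^ 4 \<le> 8 * (w + K ^ 3 * (\<Sum>i\<in>I. g (x i) ^ 4))"
          by (meson add_left_mono mult_left_mono order_trans zero_le_numeral)
        then show ?thesis unfolding W_def w_def sum.distrib sum_distrib_left by simp
      qed
      finally show ?thesis
        unfolding U_def by (simp add: mult_left_mono divide_right_mono)
    qed
    have ET: "(\<integral>x. T x \<partial>P I) \<le> C1"
    proof -
      have "(\<integral>x. form_bound A I a x \<theta> ^ (8 * c) \<partial>P I) \<le> C1" if \<theta>: "\<theta> < n" for \<theta>
      proof -
        \<comment> \<open>\<open>None\<close> stands for the summand 1 of \<open>form_bound\<close>,
          which then becomes a sum over \<open>c + 1\<close> indices.\<close>
        define J where "J = insert None (Some ` A)"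
        define b where "b x j = (case j of None \<Rightarrow> 1 | Some s \<Rightarrow> cmod (linear_form I (a s \<theta>) x))" for x j
        have J: "finite J" "J \<noteq> {}" "card J = c + 1" using A by (auto simp: J_def c_def card_image)
        have sumJ: "(\<Sum>j\<in>J. F j) = F None + (\<Sum>s\<in>A. F (Some s))" for F :: "'s option \<Rightarrow> real"
          unfolding J_def using A by (simp add: sum.reindex image_iff)
        have "form_bound A I a x \<theta> ^ (8 * c) \<le> real (c + 1) ^ (8 * c) * (1 + (\<Sum>s\<in>A. cmod (linear_form I (a s \<theta>) x) ^ (2 * (4 * c))))" for x
          using sum_power_le_card_power[OF J(1) _ J(2), of "b x" "8 * c"]
          unfolding sumJ J(3) by (simp add: b_def form_bound_def split: option.split)
        then have "(\<integral>x. form_bound A I a x \<theta> ^ (8 * c) \<partial>P I) \<le>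
            (\<integral>x. real (c + 1) ^ (8 * c) * (1 + (\<Sum>s\<in>A. cmod (linear_form I (a s \<theta>) x) ^ (2 * (4 * c)))) \<partial>P I)"
          by (intro integral_mono int poly_growth_mult poly_growth_const poly_growth_power poly_growth_add
              poly_growth_sum poly_growth_norm poly_growth_linear_form poly_growth_form_bound I)
        also have "\<dots> = real (c + 1) ^ (8 * c) * (1 + (\<Sum>s\<in>A. \<integral>x. cmod (linear_form I (a s \<theta>) x) ^ (2 * (4 * c)) \<partial>P I))"
        proof -
          have i1: "integrable (P I) (\<lambda>x. cmod (linear_form I (a s \<theta>) x) ^ (2 * (4 * c)))" for s
            by (intro int poly_growth_power poly_growth_norm poly_growth_linear_form I)
          show ?thesis using i1 by (simp add: E.prob_space)
        qed
        also have "\<dots> \<le> real (c + 1) ^ (8 * c) * (1 + (\<Sum>s\<in>A. B))"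
          by (intro mult_left_mono add_left_mono sum_mono Bb[OF sc[OF \<theta>]]) auto
        finally show ?thesis by (simp add: C1_def c_def)
      qed
      then have "(\<Sum>\<theta><n. \<integral>x. form_bound A I a x \<theta> ^ (8 * c) \<partial>P I) / n \<le> (\<Sum>\<theta><n. C1) / n"
        by (intro divide_right_mono sum_mono) auto
      also have "\<dots> = C1" using n by simp
      also have "(\<Sum>\<theta><n. \<integral>x. form_bound A I a x \<theta> ^ (8 * c) \<partial>P I) / n = (\<integral>x. T x \<partial>P I)"
        unfolding T_def by (simp add: Bochner_Integration.integral_sum int poly_growth_power poly_growth_form_bound I)
      finally show ?thesis .
    qed
    have EW: "(\<integral>x. W x \<partial>P I) \<le> K * n * mg"
    proof -
      \<comment> \<open>Integrability of a function of one real variable is obtained from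
        \<open>integrable_poly_growth\<close> over an index set with one element, whose marginal is
        the given law.\<close>
      have g1: "poly_growth {()} (\<lambda>x. g (x ()))"
        unfolding g_def
        by (intro poly_growth_mult poly_growth_power poly_growth_const poly_growth_add
            poly_growth_norm[where f = "\<lambda>x. x ()", unfolded real_norm_def] poly_growth_coord) auto
      have marg: "distr (P J) \<nu> (\<lambda>x. x j) = \<nu>" if "j \<in> J" for j :: 'j and J
        by (rule distr_PiM_component) (use that prob_space_axioms in auto)
      have gm: "g \<in> borel_measurable borel" unfolding g_def by measurable
      have ig: "integrable \<nu> (\<lambda>y. g y ^ 4)"
        using integrable_poly_growth[OF _ poly_growth_power[OF g1, of 4]] gm
        by (subst marg[of "()" "{()}", symmetric]) (auto simp: integrable_distr_eq)
      have ig8: "integrable \<nu> (\<lambda>y. y ^ 8 + K ^ 3 * g y ^ 4)" using ig integrable_power by simp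
      have "(\<integral>x. x i ^ 8 + K ^ 3 * g (x i) ^ 4 \<partial>P I) = mg" if i: "i \<in> I" for i
      proof -
        have "(\<integral>x. x i ^ 8 + K ^ 3 * g (x i) ^ 4 \<partial>P I) = (\<integral>y. y ^ 8 + K ^ 3 * g y ^ 4 \<partial>distr (P I) \<nu> (\<lambda>x. x i))"
          using i ig8 by (subst integral_distr) auto
        also have "distr (P I) \<nu> (\<lambda>x. x i) = \<nu>"
          by (rule distr_PiM_component) (use i prob_space_axioms in auto)
        finally show ?thesis using ig integrable_power[of 8] by (simp add: mg_def)
      qed
      then have "(\<integral>x. W x \<partial>P I) = real (card I) * mg"
        unfolding W_def by (subst Bochner_Integration.integral_sum)
          (auto intro!: int poly_growth_add poly_growth_mult poly_growth_power poly_growth_const g poly_growth_coord I)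
      moreover have "mg \<ge> 0" unfolding mg_def using K by (intro add_nonneg_nonneg mult_nonneg_nonneg integral_nonneg_AE) auto
      ultimately show ?thesis using cardI by (simp add: mult_right_mono)
    qed
    have "(\<integral>x. (V x)\<^sup>2 \<partial>P I) \<le> (\<integral>x. U x \<partial>P I)"
      by (intro integral_mono int poly_growth_power V U VU)
    also have "\<dots> = (C2 / n)\<^sup>2 / 2 * (sqrt n * (\<integral>x. T x \<partial>P I) + 8 * (\<integral>x. W x \<partial>P I) / sqrt n)"
      unfolding U_def using int[OF T] int[OF W] by simp
    also have "\<dots> \<le> (C2 / n)\<^sup>2 / 2 * (sqrt n * C1 + 8 * (K * n * mg) / sqrt n)"
      using ET EW by (intro mult_left_mono add_mono divide_right_mono) auto
    also have "\<dots> = C / (real n * sqrt (real n))"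
    proof -
      define q where "q = sqrt n"
      have q: "q > 0" "real n = q\<^sup>2" using n by (auto simp: q_def)
      show ?thesis unfolding q_def[symmetric] q(2) C_def using q(1) by (simp add: field_simps power2_eq_square)
    qed
    finally have EV: "(\<integral>x. (V x)\<^sup>2 \<partial>P I) \<le> C / (real n * sqrt (real n))" .
    \<comment> \<open>Used for the real and the imaginary part: both are 1-Lipschitz functions of
      \<open>\<Phi>\<close>, so \<open>V\<close> dominates their influences.\<close>
    have part: "(\<integral>x. (Z x) ^ 4 \<partial>P I) \<le> 70 * (C / (real n * sqrt (real n)))"
      if Z: "poly_growth I Z" "(\<integral>x. Z x \<partial>P I) = 0" and le: "\<And>x y. \<bar>Z x - Z y\<bar> \<le> cmod (\<Phi> x - \<Phi> y)" for Z
    proof -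
      have "(\<Sum>i\<in>I. (Z x - Z (x(i := 0)))\<^sup>2) \<le> V x" for x
        unfolding V_def using le by (intro sum_mono) (metis abs_le_square_iff abs_norm_cancel)
      from fourth_moment_bound[OF I Z(1) V Z(2) this] EV show ?thesis by linarith
    qed
    define m where "m = (\<integral>y. \<Phi> y \<partial>P I)"
    have R: "(\<integral>x. (Re (\<Phi> x) - Re m) ^ 4 \<partial>P I) \<le> 70 * (C / (real n * sqrt (real n)))"
    proof (rule part)
      show "poly_growth I (\<lambda>x. Re (\<Phi> x) - Re m)" using \<Phi> by auto
      show "(\<integral>x. Re (\<Phi> x) - Re m \<partial>P I) = 0"
        using int[OF \<Phi>] by (simp add: m_def E.prob_space)
    qed (metis abs_Re_le_cmod diff_diff_eq2 add_diff_cancel_right' diff_add_cancel minus_complex.simps(1))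
    have J: "(\<integral>x. (Im (\<Phi> x) - Im m) ^ 4 \<partial>P I) \<le> 70 * (C / (real n * sqrt (real n)))"
    proof (rule part)
      show "poly_growth I (\<lambda>x. Im (\<Phi> x) - Im m)" using \<Phi> by auto
      show "(\<integral>x. Im (\<Phi> x) - Im m \<partial>P I) = 0"
        using int[OF \<Phi>] by (simp add: m_def E.prob_space)
    qed (metis abs_Im_le_cmod diff_diff_eq2 add_diff_cancel_right' diff_add_cancel minus_complex.simps(2))
    have "(\<integral>x. cmod (\<Phi> x - m) ^ 4 \<partial>P I) \<le> (\<integral>x. 2 * ((Re (\<Phi> x) - Re m) ^ 4 + (Im (\<Phi> x) - Im m) ^ 4) \<partial>P I)"
    proof (intro integral_mono int)
      fix x
      define u where "u = Re (\<Phi> x) - Re m" define v where "v = Im (\<Phi> x) - Im m"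
      have "cmod (\<Phi> x - m) ^ 4 = ((cmod (\<Phi> x - m))\<^sup>2)\<^sup>2" by (simp flip: power_mult)
      also have "\<dots> = (u\<^sup>2 + v\<^sup>2)\<^sup>2" by (simp add: cmod_power2 u_def v_def)
      also have "\<dots> \<le> 2 * (u ^ 4 + v ^ 4)"
        using zero_le_power2[of "u\<^sup>2 - v\<^sup>2"] by (simp add: power2_eq_square eval_nat_numeral algebra_simps)
      finally show "cmod (\<Phi> x - m) ^ 4 \<le> 2 * ((Re (\<Phi> x) - Re m) ^ 4 + (Im (\<Phi> x) - Im m) ^ 4)"
        by (simp add: u_def v_def)
    qed (intro poly_growth_mult poly_growth_add poly_growth_power poly_growth_diff poly_growth_norm
        poly_growth_Re poly_growth_Im poly_growth_const \<Phi>)+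
    also have "\<dots> = 2 * ((\<integral>x. (Re (\<Phi> x) - Re m) ^ 4 \<partial>P I) + (\<integral>x. (Im (\<Phi> x) - Im m) ^ 4 \<partial>P I))"
      by (subst Bochner_Integration.integral_mult_right_zero, subst Bochner_Integration.integral_add)
        (intro int poly_growth_power poly_growth_diff poly_growth_Re poly_growth_Im poly_growth_const \<Phi> refl)+
    also have "\<dots> \<le> 2 * (70 * (C / (real n * sqrt (real n))) + 70 * (C / (real n * sqrt (real n))))"
      by (intro mult_left_mono add_mono R J) auto
    also have "\<dots> = 4 * 70 * C / (real n * sqrt (real n))" by simp
    finally show ?thesis unfolding \<Phi>_def m_def .
  qed
  then show ?thesis by blast
qed

end

subsection \<open>The equivalence relations\<close>

definition residues :: "nat \<Rightarrow> nat \<times> nat \<Rightarrow> nat \<times> nat" where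
  "residues k p = (fst p mod k, snd p mod k)"

lemma residues_swap: "residues k (prod.swap p) = prod.swap (residues k p)"
  by (simp add: residues_def prod.swap_def)

lemma residues_in_indices: "k > 0 \<Longrightarrow> residues k p \<in> indices k"
  by (simp add: residues_def)

lemma link_eval_residues: "link_eval k f (residues k p) = link_eval k f p"
  by (simp add: link_eval_def residues_def split: prod.split)

lemma same_diagonal_refl: "same_diagonal N p p"
  by (simp add: same_diagonal_def)

lemma same_diagonal_sym: "same_diagonal N p q \<Longrightarrow> same_diagonal N q p"
  by (simp add: same_diagonal_def cong_sym)

lemma same_diagonal_trans: "same_diagonal N p q \<Longrightarrow> same_diagonal N q r \<Longrightarrow> same_diagonal N p r"
  unfolding same_diagonal_def by (rule cong_trans)

lemma same_diagonal_swap: "same_diagonal N (prod.swap p) (prod.swap q) \<longleftrightarrow> same_diagonal N p q"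
  unfolding same_diagonal_def cong_iff_dvd_diff fst_swap snd_swap
  by (subst dvd_minus_iff[symmetric]) (simp add: algebra_simps)

lemma same_diagonal_residues_iff:
  "same_diagonal k (residues k p) (residues k q) \<longleftrightarrow> same_diagonal k p q"
proof -
  have "[int (i mod k) - int (j mod k) = int i - int j] (mod int k)" for i j
    unfolding zmod_int by (intro cong_diff) (simp_all add: cong_def)
  then show ?thesis unfolding same_diagonal_def residues_def by (auto simp: cong_def)
qed

lemma same_diagonal_dvd: "k dvd N \<Longrightarrow> same_diagonal N p q \<Longrightarrow> same_diagonal k p q"
  unfolding same_diagonal_def by (erule cong_dvd_modulus) simp

lemma companion_equiv_refl: "companion_equiv k f p p"
  by (simp add: companion_equiv_def)

lemma companion_equiv_sym: "companion_equiv k f p q \<Longrightarrow> companion_equiv k f q p"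
  unfolding companion_equiv_def by (rule equivclp_sym)

lemma companion_equiv_trans: "companion_equiv k f p q \<Longrightarrow> companion_equiv k f q r \<Longrightarrow> companion_equiv k f p r"
  unfolding companion_equiv_def by (rule equivclp_trans)

lemma companion_equiv_gen:
  assumes "p \<in> indices k" "q \<in> indices k" "same_diagonal k p q"
    "link_eval k f p = link_eval k f q \<or> link_eval k f (prod.swap p) = link_eval k f (prod.swap q)"
  shows "companion_equiv k f p q"
  unfolding companion_equiv_def using assms by (intro r_into_equivclp) blast

text \<open>The generating relation is symmetric, so every step of the closure can be read
  forwards.\<close>

lemma companion_equiv_induct [consumes 1, case_names base step]:
  assumes "companion_equiv k f p q" "P p"
    "\<And>y z. P y \<Longrightarrow> y \<in> indices k \<Longrightarrow> z \<in> indices k \<Longrightarrow> same_diagonal k y z \<Longrightarrow>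
      link_eval k f y = link_eval k f z \<or> link_eval k f (prod.swap y) = link_eval k f (prod.swap z) \<Longrightarrow> P z"
  shows "P q"
  using assms(1) unfolding companion_equiv_def
proof (induction rule: equivclp_induct)
  case base
  show ?case by fact
next
  case (step y z)
  then show ?case
    by (intro assms(3)[of y z]) (auto intro: same_diagonal_sym)
qed

lemma companion_equiv_same_diagonal: "companion_equiv k f p q \<Longrightarrow> same_diagonal k p q"
  by (induction rule: companion_equiv_induct) (auto intro: same_diagonal_refl same_diagonal_trans)

text \<open>The generating condition treats the link values at a pair and at the swapped pair
  alike.\<close>

lemma companion_equiv_swap: "companion_equiv k f p q \<Longrightarrow> companion_equiv k f (prod.swap p) (prod.swap q)"
proof (induction rule: companion_equiv_induct)
  case base
  show ?case by (rule companion_equiv_refl)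
next
  case (step y z)
  have "companion_equiv k f (prod.swap y) (prod.swap z)"
    using step by (intro companion_equiv_gen) (auto simp: same_diagonal_swap)
  then show ?case using step companion_equiv_trans by blast
qed

lemma entry_equiv_refl: "entry_equiv k f N p p"
  by (simp add: entry_equiv_def)

lemma entry_equiv_sym: "entry_equiv k f N p q \<Longrightarrow> entry_equiv k f N q p"
  unfolding entry_equiv_def by (rule equivclp_sym)

lemma entry_equiv_trans: "entry_equiv k f N p q \<Longrightarrow> entry_equiv k f N q r \<Longrightarrow> entry_equiv k f N p r"
  unfolding entry_equiv_def by (rule equivclp_trans)

lemma entry_equiv_swap: "p \<in> indices N \<Longrightarrow> entry_equiv k f N p (prod.swap p)"
  unfolding entry_equiv_def by (rule r_into_equivclp) auto

lemma entry_equiv_gen: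
  "p \<in> indices N \<Longrightarrow> q \<in> indices N \<Longrightarrow> same_diagonal N p q \<Longrightarrow> link_eval k f p = link_eval k f q \<Longrightarrow>
    entry_equiv k f N p q"
  unfolding entry_equiv_def by (rule r_into_equivclp) auto

lemma entry_equiv_induct [consumes 1, case_names base swap diagonal]:
  assumes "entry_equiv k f N p q" "P p"
    "\<And>y. P y \<Longrightarrow> y \<in> indices N \<Longrightarrow> P (prod.swap y)"
    "\<And>y z. P y \<Longrightarrow> y \<in> indices N \<Longrightarrow> z \<in> indices N \<Longrightarrow> same_diagonal N y z \<Longrightarrow>
      link_eval k f y = link_eval k f z \<Longrightarrow> P z"
  shows "P q"
  using assms(1) unfolding entry_equiv_def
proof (induction rule: equivclp_induct)
  case base
  show ?case by fact
next
  case (step y z)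
  from step(2) have yz: "y \<in> indices N" "z \<in> indices N"
    "z = prod.swap y \<or> same_diagonal N y z \<and> link_eval k f y = link_eval k f z"
    by (auto intro: same_diagonal_sym)
  from yz(3) show ?case
  proof
    assume "z = prod.swap y"
    then show ?thesis using assms(3)[OF step(3) yz(1)] by simp
  next
    assume "same_diagonal N y z \<and> link_eval k f y = link_eval k f z"
    then show ?thesis using assms(4)[OF step(3) yz(1,2)] by simp
  qed
qed

lemma equiv_class_entry_eq_iff:
  "equiv_class (entry_equiv k f N) p = equiv_class (entry_equiv k f N) q \<longleftrightarrow> entry_equiv k f N p q"
  unfolding equiv_class_def using entry_equiv_refl entry_equiv_sym entry_equiv_trans
  by (metis mem_Collect_eq Collect_cong)

lemma int_mod_less: "N > 0 \<Longrightarrow> nat (d mod int N) < N"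
  by (metis nat_less_iff of_nat_0_less_iff pos_mod_bound pos_mod_sign)

text \<open>
  A path for the entry equivalence becomes, after undoing the swaps met on the way, a path along
  one diagonal; its residues modulo \<open>k\<close> form a path for the companion equivalence.
\<close>

lemma entry_equiv_imp:
  assumes k: "k > 0" "k dvd N" and e: "entry_equiv k f N p q" and p: "p \<in> indices N"
  shows "same_diagonal N p q \<and> companion_equiv k f (residues k p) (residues k q) \<or>
    same_diagonal N p (prod.swap q) \<and> companion_equiv k f (residues k p) (residues k (prod.swap q))"
  using e
proof (induction rule: entry_equiv_induct)
  case base
  show ?case by (simp add: same_diagonal_refl companion_equiv_refl)
next
  case (swap y)
  then show ?case by auto
next
  case (diagonal y z)
  have sd: "same_diagonal k (residues k y) (residues k z)"
    using same_diagonal_dvd[OF k(2) diagonal(4)] by (simp add: same_diagonal_residues_iff)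
  have c: "companion_equiv k f (residues k y) (residues k z)"
    using sd diagonal(5) k by (intro companion_equiv_gen) (auto simp: link_eval_residues residues_in_indices)
  have c': "companion_equiv k f (residues k (prod.swap y)) (residues k (prod.swap z))"
    unfolding residues_swap by (rule companion_equiv_swap[OF c])
  have s': "same_diagonal N (prod.swap y) (prod.swap z)" using diagonal(4) by (simp add: same_diagonal_swap)
  show ?case
    using diagonal(1,4) c c' s' same_diagonal_trans companion_equiv_trans by blast
qed

text \<open>A path of residue pairs is lifted to the diagonal of \<open>p0\<close>; as
  \<open>k dvd N\<close>, each pair on the path has a lift there. The induction is over the path and
  quantifies over all lifts of its two ends, so that an intermediate lift can be chosen in the
  step.\<close>

lemma entry_equivI:
  assumes k: "k > 0" "k dvd N" "N > 0" and c: "companion_equiv k f (residues k p0) (residues k q0)"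
    and pq0: "p0 \<in> indices N" "q0 \<in> indices N" "same_diagonal N p0 q0"
  shows "entry_equiv k f N p0 q0"
proof -
  define u v where "u = residues k p0" and "v = residues k q0"
  have "same_diagonal k u v \<and> (\<forall>p q. p \<in> indices N \<longrightarrow> q \<in> indices N \<longrightarrow> residues k p = u \<longrightarrow> residues k q = v \<longrightarrow>
    same_diagonal N p q \<longrightarrow> entry_equiv k f N p q)"
    using c[folded u_def v_def]
  proof (induction rule: companion_equiv_induct)
    case base
    have "entry_equiv k f N p q" if "p \<in> indices N" "q \<in> indices N" "residues k p = residues k q" "same_diagonal N p q" for p q
      using that link_eval_residues[of k f p] link_eval_residues[of k f q] by (intro entry_equiv_gen) auto
    then show ?case by (auto intro: same_diagonal_refl)
  next
    case (step v w)
    have "entry_equiv k f N p q" if p: "p \<in> indices N" and q: "q \<in> indices N" and r: "residues k p = u" "residues k q = w"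
      and pq: "same_diagonal N p q" for p q
    proof -
      define d where "d = int (fst p) - int (snd p)"
      \<comment> \<open>The lift of \<open>v\<close> in row \<open>fst v\<close>. The diagonal
        \<open>d\<close> forces its column, and the congruences that follow show that this column
        has residue \<open>snd v\<close>.\<close>
      define q' where "q' = (fst v, nat ((int (fst v) - d) mod int N))"
      have vk: "fst v < k" "snd v < k" using step.hyps by auto
      have "k \<le> N" using k by (auto intro: dvd_imp_le)
      then have q': "q' \<in> indices N" using vk int_mod_less[OF k(3)] by (auto simp: q'_def)
      have sq: "int (snd q') = (int (fst v) - d) mod int N" using k by (simp add: q'_def)
      have "[int (fst q') - int (snd q') = d] (mod int N)"
        unfolding sq by (simp add: q'_def cong_def mod_simps)
      then have pq': "same_diagonal N p q'" unfolding same_diagonal_def d_def by (rule cong_sym)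
      have "same_diagonal k (residues k p) v" using step.IH r by auto
      then have "[int (fst v) - int (snd v) = int (fst (residues k p)) - int (snd (residues k p))] (mod int k)"
        by (simp add: same_diagonal_def cong_sym)
      also have "[int (fst (residues k p)) - int (snd (residues k p)) = d] (mod int k)"
        unfolding residues_def d_def fst_conv snd_conv zmod_int by (intro cong_diff) (simp_all add: cong_def)
      finally have "[int (fst v) - d = int (snd v)] (mod int k)"
        by (simp add: cong_iff_dvd_diff algebra_simps)
      moreover have "[int (snd q') = int (fst v) - d] (mod int k)"
        unfolding sq by (rule cong_dvd_modulus[of _ _ "int N"]) (use k in \<open>auto simp: cong_def\<close>)
      ultimately have "[int (snd q') = int (snd v)] (mod int k)" by (rule cong_trans[rotated])
      then have "snd q' mod k = snd v"
        using vk by (metis cong_def cong_int_iff mod_less)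
      then have rq': "residues k q' = v" using vk by (simp add: residues_def q'_def prod_eq_iff)
      have e1: "entry_equiv k f N p q'" using step.IH p q' r rq' pq' by blast
      have q'q: "same_diagonal N q' q" using pq pq' same_diagonal_trans same_diagonal_sym by blast
      from step.hyps(4) have "entry_equiv k f N q' q"
      proof
        assume "link_eval k f v = link_eval k f w"
        then show ?thesis using q' q q'q link_eval_residues[of k f q'] link_eval_residues[of k f q] rq' r
          by (intro entry_equiv_gen) auto
      next
        \<comment> \<open>Only the transposed positions are linked directly; two transpositions
          connect them with \<open>q'\<close> and \<open>q\<close>.\<close>
        assume *: "link_eval k f (prod.swap v) = link_eval k f (prod.swap w)"
        have "entry_equiv k f N (prod.swap q') (prod.swap q)"
          using q' q q'q * link_eval_residues[of k f "prod.swap q'"] link_eval_residues[of k f "prod.swap q"] rq' r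
          by (intro entry_equiv_gen) (auto simp: same_diagonal_swap residues_swap)
        then show ?thesis
          using entry_equiv_swap[OF q'] entry_equiv_swap[OF q] entry_equiv_trans entry_equiv_sym by metis
      qed
      then show ?thesis using e1 entry_equiv_trans by blast
    qed
    then show ?case using step same_diagonal_trans by blast
  qed
  then show ?thesis using pq0 unfolding u_def v_def by blast
qed

lemma entry_equiv_iff:
  assumes k: "k > 0" "k dvd N" and p: "p \<in> indices N" and q: "q \<in> indices N"
  shows "entry_equiv k f N p q \<longleftrightarrow>
    same_diagonal N p q \<and> companion_equiv k f (residues k p) (residues k q) \<or>
    same_diagonal N p (prod.swap q) \<and> companion_equiv k f (residues k p) (residues k (prod.swap q))"
proof
  assume "entry_equiv k f N p q"
  then show "same_diagonal N p q \<and> companion_equiv k f (residues k p) (residues k q) \<or>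
    same_diagonal N p (prod.swap q) \<and> companion_equiv k f (residues k p) (residues k (prod.swap q))"
    by (rule entry_equiv_imp[OF k _ p])
next
  have N: "N > 0" using p by auto
  assume "same_diagonal N p q \<and> companion_equiv k f (residues k p) (residues k q) \<or>
    same_diagonal N p (prod.swap q) \<and> companion_equiv k f (residues k p) (residues k (prod.swap q))"
  then show "entry_equiv k f N p q"
  proof
    assume "same_diagonal N p q \<and> companion_equiv k f (residues k p) (residues k q)"
    then show ?thesis using entry_equivI[OF k N _ p q] by simp
  next
    assume *: "same_diagonal N p (prod.swap q) \<and> companion_equiv k f (residues k p) (residues k (prod.swap q))"
    have q': "prod.swap q \<in> indices N" using q by auto
    have "entry_equiv k f N p (prod.swap q)" 
      using entry_equivI[OF k N conjunct2[OF *] p q' conjunct1[OF *]] .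
    from entry_equiv_trans[OF this entry_equiv_sym[OF entry_equiv_swap[OF q]]] show ?thesis .
  qed
qed

section \<open>Characters of cyclic groups and their orthogonality\<close>

definition phase :: "nat \<Rightarrow> nat \<Rightarrow> int \<Rightarrow> complex" where
  "phase N \<theta> d = cis (2 * pi * real \<theta> * real_of_int d / real N)"

lemma phase_add: "phase N \<theta> (d + e) = phase N \<theta> d * phase N \<theta> e"
  by (simp add: phase_def cis_mult ring_distribs add_divide_distrib)

lemma norm_phase [simp]: "cmod (phase N \<theta> d) = 1"
  by (simp add: phase_def)

lemma phase_0 [simp]: "phase N \<theta> 0 = 1"
  by (simp add: phase_def)

lemma phase_cong:
  assumes "[d = e] (mod int N)" "N > 0"
  shows "phase N \<theta> d = phase N \<theta> e"
proof -
  obtain m where m: "d = e + int N * m" using assms(1) by (metis cong_iff_lin cong_sym)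
  have "phase N \<theta> (int N * m) = 1"
    using assms(2) cis_multiple_2pi[of "of_int (int \<theta> * m)"] by (simp add: phase_def mult_ac)
  then show ?thesis by (simp add: m phase_add)
qed

lemma sum_cis_multiples:
  assumes n: "n > 0"
  shows "(\<Sum>m<n. cis (2 * pi * real_of_int t * real m / real n)) = (if int n dvd t then of_nat n else 0)"
proof (cases "int n dvd t")
  case True
  then obtain r where r: "t = int n * r" by blast
  have "cis (2 * pi * real_of_int t * real m / real n) = 1" for m
    using n cis_multiple_2pi[of "of_int (r * int m)"] by (simp add: r mult_ac)
  then show ?thesis using True by simp
next
  case False
  define z where "z = cis (2 * pi * real_of_int t / real n)"
  have "z \<noteq> 1"
  proof
    assume "z = 1"
    then obtain r :: int where "2 * pi * real_of_int t / real n = of_int (2 * r) * pi"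
      unfolding z_def by (metis Re_complex_of_real cis.simps(1) cos_one_2pi_int of_real_1 complex.sel(1) one_complex.sel(1) mult.commute mult.left_commute of_int_mult of_int_numeral)
    then have "real_of_int t = of_int (r * int n)" using n by (simp add: field_simps)
    then have "t = r * int n" by linarith
    then show False using False by simp
  qed
  moreover have "z ^ n = 1"
  proof -
    have "z ^ n = cis (real n * (2 * pi * real_of_int t / real n))" unfolding z_def by (rule Complex.DeMoivre)
    also have "real n * (2 * pi * real_of_int t / real n) = 2 * pi * real_of_int t" using n by simp
    finally show ?thesis using cis_multiple_2pi[of "of_int t"] by simp
  qed
  moreover have "cis (2 * pi * real_of_int t * real m / real n) = z ^ m" for m
    by (simp add: z_def Complex.DeMoivre mult_ac)
  ultimately show ?thesis using False by (simp add: geometric_sum)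
qed

subsection \<open>Fourier coefficients of the classes\<close>

locale periodic_link =
  fixes k n :: nat and f :: "nat \<Rightarrow> nat \<Rightarrow> nat"
  assumes k: "k > 0" and n: "n > 0"
begin

definition N :: nat where "N = k * n"

text \<open>Used for rows \<open>l < k\<close> only: every class meets the first block row, as the
  proof of \<open>card_classes\<close> shows.\<close>

definition cls :: "nat \<Rightarrow> nat \<Rightarrow> (nat \<times> nat) set" where
  "cls l c = equiv_class (entry_equiv k f N) (l, c)"

definition entry_classes :: "(nat \<times> nat) set set" where
  "entry_classes = equiv_class (entry_equiv k f N) ` indices N"

definition columns :: "nat \<Rightarrow> nat set" where
  "columns j = {c. c < N \<and> c mod k = j}"

definition fibre :: "nat \<times> nat \<Rightarrow> (nat \<times> nat) set \<Rightarrow> nat set" where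
  "fibre e C = {c \<in> columns (snd e). cls (fst e) c = C}"

text \<open>The coefficient of the variable of class \<open>C\<close> in entry \<open>e\<close> of
  the Fourier block at frequency \<theta>, divided by sqrt n; see
  \<open>dft_class_entries\<close>.\<close>

definition coeff :: "nat \<times> nat \<Rightarrow> nat \<Rightarrow> (nat \<times> nat) set \<Rightarrow> complex" where
  "coeff e \<theta> C = of_real (1 / sqrt n) * (\<Sum>c\<in>fibre e C. phase N \<theta> (int c - int (fst e)))"

lemma N: "N > 0" "k dvd N" "k \<le> N"
  using k n by (auto simp: N_def)

lemma finite_columns: "finite (columns j)" and columns_less: "c \<in> columns j \<Longrightarrow> c < N"
  by (auto simp: columns_def)

lemma finite_classes: "finite entry_classes"
  by (simp add: entry_classes_def)

lemma cls_in_classes: "l < k \<Longrightarrow> c < N \<Longrightarrow> cls l c \<in> entry_classes"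
  unfolding cls_def entry_classes_def using N by (intro imageI) auto

lemma cls_eq_iff:
  assumes "l < k" "l' < k" "c < N" "c' < N"
  shows "cls l c = cls l' c' \<longleftrightarrow>
    [int c - int l = int c' - int l'] (mod int N) \<and> companion_equiv k f (l, c mod k) (l', c' mod k) \<or>
    [int c - int l = - (int c' - int l')] (mod int N) \<and> companion_equiv k f (l, c mod k) (c' mod k, l')"
proof -
  have i: "(l, c) \<in> indices N" "(l', c') \<in> indices N" using assms N by auto
  have "[int l - int c = int l' - int c'] (mod int N) \<longleftrightarrow> [int c - int l = int c' - int l'] (mod int N)"
    unfolding cong_iff_dvd_diff by (subst dvd_minus_iff[symmetric]) (simp add: algebra_simps)
  moreover have "[int l - int c = int c' - int l'] (mod int N) \<longleftrightarrow> [int c - int l = - (int c' - int l')] (mod int N)"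
    unfolding cong_iff_dvd_diff by (subst dvd_minus_iff[symmetric]) (simp add: algebra_simps)
  ultimately show ?thesis
    unfolding cls_def equiv_class_entry_eq_iff entry_equiv_iff[OF k N(2) i] using assms
    by (simp add: same_diagonal_def residues_def)
qed

text \<open>Any position can be moved along its diagonal to row \<open>i mod k\<close> without
  changing its residues, hence within its class. So the k * N positions of the first block row
  represent all classes, and k * N = k^2 * n.\<close>

lemma card_classes: "real (card entry_classes) * (1 / sqrt n)\<^sup>2 \<le> (real k)\<^sup>2"
proof -
  have "entry_classes \<subseteq> (\<lambda>(l, c). cls l c) ` ({..<k} \<times> {..<N})"
  proof
    fix C assume "C \<in> entry_classes"
    then obtain i j where ij: "i < N" "j < N" "C = equiv_class (entry_equiv k f N) (i, j)" by (auto simp: entry_classes_def)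
    define l where "l = i mod k"
    define c where "c = nat ((int l - (int i - int j)) mod int N)"
    have l: "l < k" using k by (simp add: l_def)
    have c: "c < N" using N int_mod_less by (simp add: c_def)
    have ic: "int c = (int l - (int i - int j)) mod int N" using N by (simp add: c_def)
    have sd: "[int l - int c = int i - int j] (mod int N)" unfolding ic by (simp add: cong_def mod_simps)
    have "[int c = int l - (int i - int j)] (mod int N)" unfolding ic by simp
    then have "[int c = int l - (int i - int j)] (mod int k)" by (rule cong_dvd_modulus) (use N in simp)
    moreover have "[int l = int i] (mod int k)" unfolding l_def zmod_int by simp
    ultimately have "[int c = int i - (int i - int j)] (mod int k)" using cong_trans cong_diff cong_refl by blast
    then have "c mod k = j mod k" by (simp add: cong_def flip: zmod_int)
    then have "entry_equiv k f N (i, j) (l, c)"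
      using ij l c N sd by (intro entry_equiv_gen) (auto simp: same_diagonal_def link_eval_def l_def cong_sym)
    then have "C = cls l c" unfolding ij(3) cls_def equiv_class_entry_eq_iff .
    then show "C \<in> (\<lambda>(l, c). cls l c) ` ({..<k} \<times> {..<N})" using l c by auto
  qed
  from card_mono[OF _ this] have "card entry_classes \<le> card ((\<lambda>(l, c). cls l c) ` ({..<k} \<times> {..<N}))" by simp
  also have "\<dots> \<le> k * N" using card_image_le[of "{..<k} \<times> {..<N}" "\<lambda>(l, c). cls l c"] by simp
  finally have "real (card entry_classes) \<le> real (k * N)" by (rule of_nat_mono)
  also have "\<dots> = (real k)\<^sup>2 * n" by (simp add: N_def power2_eq_square)
  finally show ?thesis using n by (simp add: power_divide field_simps)
qed

text \<open>Two positions in the same row and class have equal or opposite offsets from the diagonal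
  modulo \<open>N\<close>, which leaves at most two columns.\<close>

lemma card_fibre: "fst e < k \<Longrightarrow> card (fibre e C) \<le> 2"
proof (cases "fibre e C = {}")
  case False
  assume e: "fst e < k"
  define l where "l = fst e"
  obtain c0 where c0: "c0 \<in> fibre e C" using False by blast
  have "fibre e C \<subseteq> {c0, nat ((2 * int l - int c0) mod int N)}"
  proof
    fix c assume c: "c \<in> fibre e C"
    have lt: "c < N" "c0 < N" using c c0 by (auto simp: fibre_def columns_def)
    have "cls l c = cls l c0" using c c0 by (simp add: fibre_def l_def)
    then have "[int c - int l = int c0 - int l] (mod int N) \<or> [int c - int l = - (int c0 - int l)] (mod int N)"
      using cls_eq_iff[of l l c c0] e lt by (auto simp: l_def)
    then have "[int c = int c0] (mod int N) \<or> [int c = 2 * int l - int c0] (mod int N)"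
      by (simp add: cong_iff_dvd_diff algebra_simps)
    then have "int c = int c0 \<or> int c = (2 * int l - int c0) mod int N"
      using lt by (auto simp: cong_def)
    then show "c \<in> {c0, nat ((2 * int l - int c0) mod int N)}"
      by (metis insertCI nat_int of_nat_eq_iff)
  qed
  then have "card (fibre e C) \<le> card {c0, nat ((2 * int l - int c0) mod int N)}" by (intro card_mono) auto
  also have "\<dots> \<le> 2" by (simp add: card_insert_if)
  finally show ?thesis .
qed auto

lemma norm_coeff: "fst e < k \<Longrightarrow> cmod (coeff e \<theta> C) \<le> 2 * (1 / sqrt n)"
proof -
  assume e: "fst e < k"
  have "cmod (coeff e \<theta> C) \<le> 1 / sqrt n * (\<Sum>c\<in>fibre e C. 1)"
    unfolding coeff_def norm_mult using n
    by (intro mult_mono sum_norm_le) (auto intro: sum_nonneg simp: norm_divide)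
  also have "\<dots> \<le> 1 / sqrt n * 2" using card_fibre[OF e, of C] by (intro mult_left_mono) auto
  finally show ?thesis by simp
qed

lemma sum_columns:
  assumes "j < k"
  shows "(\<Sum>c\<in>columns j. F c) = (\<Sum>m<n. F (j + k * m))"
proof -
  have "bij_betw (\<lambda>m. j + k * m) {..<n} (columns j)"
  proof (rule bij_betwI[where g = "\<lambda>c. c div k"])
    show "(\<lambda>m. j + k * m) \<in> {..<n} \<rightarrow> columns j"
    proof
      fix m assume "m \<in> {..<n}"
      then have "k * (m + 1) \<le> k * n" by (intro mult_left_mono) auto
      then show "j + k * m \<in> columns j" using assms by (auto simp: columns_def N_def)
    qed
    show "(\<lambda>c. c div k) \<in> columns j \<rightarrow> {..<n}"
      using k by (auto simp: columns_def N_def less_mult_imp_div_less mult.commute)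
  qed (use assms k in \<open>auto simp: columns_def\<close>)
  then show ?thesis by (rule sum.reindex_bij_betw[symmetric])
qed

lemma phase_column:
  "phase N \<theta> (int (j + k * m) - int l) = phase N \<theta> (int j - int l) * cis (2 * pi * real \<theta> * real m / real n)"
proof -
  have "phase N \<theta> (int (j + k * m) - int l) = phase N \<theta> ((int j - int l) + int (k * m))" by (simp add: algebra_simps)
  also have "\<dots> = phase N \<theta> (int j - int l) * phase N \<theta> (int (k * m))" by (rule phase_add)
  also have "phase N \<theta> (int (k * m)) = cis (2 * pi * real \<theta> * real m / real n)"
    using k by (simp add: phase_def N_def mult_ac)
  finally show ?thesis .
qed

lemma parseval:
  "(\<Sum>m<n. (cmod (\<Sum>\<theta><n. cis (2 * pi * real \<theta> * real m / real n) * R \<theta>))\<^sup>2) = n * (\<Sum>\<theta><n. (cmod (R \<theta>))\<^sup>2)"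
proof -
  have "of_real (\<Sum>m<n. (cmod (\<Sum>\<theta><n. cis (2 * pi * real \<theta> * real m / real n) * R \<theta>))\<^sup>2) =
    (\<Sum>m<n. (\<Sum>\<theta><n. cis (2 * pi * real \<theta> * real m / real n) * R \<theta>) * (\<Sum>\<theta><n. cis (- (2 * pi * real \<theta> * real m / real n)) * cnj (R \<theta>)))"
    unfolding of_real_sum complex_norm_square by (simp add: cis_cnj)
  also have "\<dots> = (\<Sum>m<n. \<Sum>\<theta><n. \<Sum>\<theta>'<n. cis (2 * pi * real_of_int (int \<theta> - int \<theta>') * real m / real n) * (R \<theta> * cnj (R \<theta>')))"
    unfolding sum_product
  proof (intro sum.cong refl)
    fix m \<theta> \<theta>'
    have "cis (2 * pi * real \<theta> * real m / real n) * cis (- (2 * pi * real \<theta>' * real m / real n))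
      = cis (2 * pi * real_of_int (int \<theta> - int \<theta>') * real m / real n)"
      by (simp add: cis_mult ring_distribs diff_divide_distrib)
    then show "cis (2 * pi * real \<theta> * real m / real n) * R \<theta> * (cis (- (2 * pi * real \<theta>' * real m / real n)) * cnj (R \<theta>'))
      = cis (2 * pi * real_of_int (int \<theta> - int \<theta>') * real m / real n) * (R \<theta> * cnj (R \<theta>'))"
      using mult.commute[of "R \<theta>" "cis (- (2 * pi * real \<theta>' * real m / real n))"]
      by (simp only: mult.assoc mult.left_commute[of "R \<theta>"]) (simp only: mult.assoc[symmetric])
  qed
  also have "\<dots> = (\<Sum>\<theta><n. \<Sum>\<theta>'<n. (\<Sum>m<n. cis (2 * pi * real_of_int (int \<theta> - int \<theta>') * real m / real n)) * (R \<theta> * cnj (R \<theta>')))"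
    unfolding sum_distrib_right by (subst sum.swap, rule sum.cong[OF refl], rule sum.swap)
  also have "\<dots> = (\<Sum>\<theta><n. \<Sum>\<theta>'<n. if \<theta>' = \<theta> then of_nat n * (R \<theta> * cnj (R \<theta>')) else 0)"
  proof (intro sum.cong refl)
    fix \<theta> \<theta>' assume "\<theta> \<in> {..<n}" "\<theta>' \<in> {..<n}"
    then have "int n dvd int \<theta> - int \<theta>' \<longleftrightarrow> \<theta>' = \<theta>"
      by (auto simp: mod_eq_dvd_iff[symmetric])
    then show "(\<Sum>m<n. cis (2 * pi * real_of_int (int \<theta> - int \<theta>') * real m / real n)) * (R \<theta> * cnj (R \<theta>'))
      = (if \<theta>' = \<theta> then of_nat n * (R \<theta> * cnj (R \<theta>')) else 0)"
      unfolding sum_cis_multiples[OF n] by simp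
  qed
  also have "\<dots> = of_real (n * (\<Sum>\<theta><n. (cmod (R \<theta>))\<^sup>2))"
    by (simp add: complex_norm_square[unfolded of_real_power] sum_distrib_left)
  finally show ?thesis by (simp only: of_real_eq_iff)
qed

text \<open>The fibres partition the columns into sets with at most two elements, so Cauchy-Schwarz
  on each fibre costs the factor 2. Parseval then gives a factor n, which cancels the square of the
  normalisation 1 / sqrt n.\<close>

lemma bessel_coeff:
  assumes e: "e \<in> indices k"
  shows "(\<Sum>C\<in>entry_classes. (cmod (\<Sum>\<theta><n. coeff e \<theta> C * Q \<theta>))\<^sup>2) \<le> 2 * (\<Sum>\<theta><n. (cmod (Q \<theta>))\<^sup>2)"
proof -
  define l j where "l = fst e" and "j = snd e"
  have lj: "l < k" "j < k" using e by (auto simp: l_def j_def)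
  define G where "G c = (\<Sum>\<theta><n. phase N \<theta> (int c - int l) * Q \<theta>)" for c
  have "(cmod (\<Sum>\<theta><n. coeff e \<theta> C * Q \<theta>))\<^sup>2 \<le> 2 / n * (\<Sum>c\<in>fibre e C. (cmod (G c))\<^sup>2)" for C
  proof -
    have "(\<Sum>\<theta><n. coeff e \<theta> C * Q \<theta>) = of_real (1 / sqrt n) * (\<Sum>c\<in>fibre e C. G c)"
      unfolding coeff_def G_def sum_distrib_left sum_distrib_right l_def by (subst sum.swap) (simp add: mult_ac)
    then have "(cmod (\<Sum>\<theta><n. coeff e \<theta> C * Q \<theta>))\<^sup>2 = 1 / n * (cmod (\<Sum>c\<in>fibre e C. G c))\<^sup>2"
      using n by (simp add: norm_mult norm_divide power_divide power_mult_distrib)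
    also have "\<dots> \<le> 1 / n * (real (card (fibre e C)) * (\<Sum>c\<in>fibre e C. (cmod (G c))\<^sup>2))"
      by (intro mult_left_mono norm_sum_squared_le) auto
    also have "\<dots> \<le> 1 / n * (2 * (\<Sum>c\<in>fibre e C. (cmod (G c))\<^sup>2))"
      using card_fibre[of e C] lj by (intro mult_left_mono mult_right_mono sum_nonneg) (auto simp: l_def)
    finally show ?thesis by simp
  qed
  then have "(\<Sum>C\<in>entry_classes. (cmod (\<Sum>\<theta><n. coeff e \<theta> C * Q \<theta>))\<^sup>2) \<le> (\<Sum>C\<in>entry_classes. 2 / n * (\<Sum>c\<in>fibre e C. (cmod (G c))\<^sup>2))"
    by (intro sum_mono)
  also have "\<dots> = 2 / n * (\<Sum>C\<in>entry_classes. (\<Sum>c\<in>fibre e C. (cmod (G c))\<^sup>2))" by (simp add: sum_distrib_left)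
  also have "(\<Sum>C\<in>entry_classes. (\<Sum>c\<in>fibre e C. (cmod (G c))\<^sup>2)) = (\<Sum>c\<in>columns j. (cmod (G c))\<^sup>2)"
    unfolding fibre_def l_def[symmetric] j_def[symmetric]
    by (rule sum.group) (use lj finite_columns finite_classes cls_in_classes columns_less in auto)
  also have "\<dots> = (\<Sum>m<n. (cmod (\<Sum>\<theta><n. cis (2 * pi * real \<theta> * real m / real n) * (phase N \<theta> (int j - int l) * Q \<theta>)))\<^sup>2)"
    unfolding sum_columns[OF lj(2)] G_def phase_column by (simp add: mult_ac)
  also have "\<dots> = n * (\<Sum>\<theta><n. (cmod (Q \<theta>))\<^sup>2)" unfolding parseval by (simp add: norm_mult)
  finally show ?thesis using n by simp
qed

lemma bessel_coeffs:
  assumes "\<And>s. s \<in> A \<Longrightarrow> e s \<in> indices k"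
  shows "bessel_coeffs ((real k)\<^sup>2) 2 2 A entry_classes n (\<lambda>s. coeff (e s))"
  unfolding bessel_coeffs_def small_coeffs_def
proof (intro conjI allI impI ballI)
  fix s C \<theta> assume "s \<in> A"
  from assms[OF this] show "cmod (coeff (e s) \<theta> C) \<le> 2 * (1 / sqrt n)" by (intro norm_coeff) auto
qed (use n finite_classes card_classes bessel_coeff assms in auto)

lemma card_exceptional: "card {\<theta>. \<theta> < n \<and> n dvd 2 * \<theta>} \<le> 2"
proof -
  have "{\<theta>. \<theta> < n \<and> n dvd 2 * \<theta>} \<subseteq> {0, n div 2}"
  proof
    fix \<theta> assume "\<theta> \<in> {\<theta>. \<theta> < n \<and> n dvd 2 * \<theta>}"
    then obtain r where r: "\<theta> < n" "2 * \<theta> = n * r" by auto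
    then have "r < 2" using n by (metis mult.commute mult_less_cancel1 zero_less_numeral)
    then show "\<theta> \<in> {0, n div 2}" using r by (cases r) auto
  qed
  from card_mono[OF _ this] show ?thesis by (auto simp: card_insert_if split: if_splits)
qed

text \<open>The sum runs over pairs of columns that carry the same variable. Pairs with opposite
  offsets have total phase 1 and give the main term, n equal summands divided by n. Pairs with equal
  offsets give a character sum of frequency 2 \<theta>, which vanishes since n does not divide 2
  \<theta>. The error comes from the at most three columns in which both kinds coincide.\<close>

lemma covariance:
  assumes e: "e \<in> indices k" and e': "e' \<in> indices k" and \<theta>: "\<not> n dvd 2 * \<theta>"
  shows "cmod ((\<Sum>C\<in>entry_classes. coeff e \<theta> C * coeff e' \<theta> C) - of_bool (companion_equiv k f e (prod.swap e'))) \<le> 3 / n"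
proof -
  define l j l' j' where "l = fst e" "j = snd e" "l' = fst e'" "j' = snd e'"
  have lt: "l < k" "j < k" "l' < k" "j' < k" using e e' by (auto simp: l_j_l'_j'_def)
  have ee: "e = (l, j)" "e' = (l', j')" by (auto simp: l_j_l'_j'_def)
  define u where "u c = phase N \<theta> (int c - int l)" for c
  define u' where "u' c = phase N \<theta> (int c - int l')" for c
  define \<alpha> where "\<alpha> \<longleftrightarrow> companion_equiv k f (l, j) (l', j')"
  define \<beta> where "\<beta> \<longleftrightarrow> companion_equiv k f (l, j) (j', l')"
  \<comment> \<open>The only columns of row \<open>l'\<close> that can share the variable of column
    \<open>c\<close> in row \<open>l\<close>: \<open>a c\<close> has the same offset and
    \<open>b c\<close> the opposite one.\<close>
  define a where "a c = nat ((int l' + (int c - int l)) mod int N)" for c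
  define b where "b c = nat ((int l' - (int c - int l)) mod int N)" for c
  define S where "S c = {c' \<in> columns j'. cls l c = cls l' c'}" for c
  have fin: "finite (S c)" for c using finite_columns by (simp add: S_def)
  have "(\<Sum>C\<in>entry_classes. coeff e \<theta> C * coeff e' \<theta> C) =
      1 / n * (\<Sum>C\<in>entry_classes. \<Sum>c\<in>fibre e C. u c * (\<Sum>c'\<in>S c. u' c'))"
  proof -
    have "coeff e \<theta> C * coeff e' \<theta> C = 1 / n * (\<Sum>c\<in>fibre e C. u c * (\<Sum>c'\<in>S c. u' c'))" for C
    proof -
      have "complex_of_real (1 / sqrt n) * complex_of_real (1 / sqrt n) = 1 / n"
        using n by (simp flip: of_real_mult)
      moreover have "(\<Sum>c\<in>fibre e C. u c) * (\<Sum>c'\<in>fibre e' C. u' c') = (\<Sum>c\<in>fibre e C. u c * (\<Sum>c'\<in>S c. u' c'))"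
        unfolding sum_distrib_right
      proof (intro sum.cong refl)
        fix c assume "c \<in> fibre e C"
        then have "fibre e' C = S c" by (auto simp: fibre_def S_def ee)
        then show "u c * (\<Sum>c'\<in>fibre e' C. u' c') = u c * (\<Sum>c'\<in>S c. u' c')" by simp
      qed
      ultimately show ?thesis
        unfolding coeff_def u_def u'_def by (simp add: ee mult_ac)
    qed
    then show ?thesis by (simp add: sum_distrib_left)
  qed
  also have "(\<Sum>C\<in>entry_classes. \<Sum>c\<in>fibre e C. u c * (\<Sum>c'\<in>S c. u' c')) = (\<Sum>c\<in>columns j. u c * (\<Sum>c'\<in>S c. u' c'))"
    unfolding fibre_def ee fst_conv snd_conv
    by (rule sum.group) (use lt finite_columns finite_classes cls_in_classes columns_less in auto)
  finally have main: "(\<Sum>C\<in>entry_classes. coeff e \<theta> C * coeff e' \<theta> C) = 1 / n * (\<Sum>c\<in>columns j. u c * (\<Sum>c'\<in>S c. u' c'))" .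
  have cong_col: "c' < N \<and> [int c' = d] (mod int N) \<longleftrightarrow> c' = nat (d mod int N)" for c' d
    using N int_mod_less[OF N(1), of d] by (auto simp: cong_def)
  have S_eq: "S c = (if \<alpha> then {a c} else {}) \<union> (if \<beta> then {b c} else {})" if c: "c \<in> columns j" for c
  proof -
    have c': "c < N" "c mod k = j" using c by (auto simp: columns_def)
    have cj: "[int c = int j] (mod int k)" using c' lt by (auto simp: cong_def simp flip: zmod_int)
    have A: "a c \<in> columns j'" if \<alpha>
    proof -
      have "[int (a c) = int l' + (int c - int l)] (mod int k)"
        by (rule cong_dvd_modulus[of _ _ "int N"]) (use N in \<open>auto simp: a_def cong_def\<close>)
      also have "[int l' + (int c - int l) = int l' + (int j - int l)] (mod int k)"
        by (intro cong_add cong_diff cj cong_refl)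
      also have "[int l' + (int j - int l) = int j'] (mod int k)"
        using companion_equiv_same_diagonal[OF that[unfolded \<alpha>_def]]
        by (simp add: same_diagonal_def cong_iff_dvd_diff) (metis (no_types, opaque_lifting) dvd_minus_iff minus_diff_eq diff_diff_eq2 add.commute diff_add_eq)
      finally have "a c mod k = j'" using lt by (simp add: cong_def flip: zmod_int)
      then show ?thesis using int_mod_less[OF N(1)] by (simp add: columns_def a_def)
    qed
    have B: "b c \<in> columns j'" if \<beta>
    proof -
      have "[int (b c) = int l' - (int c - int l)] (mod int k)"
        by (rule cong_dvd_modulus[of _ _ "int N"]) (use N in \<open>auto simp: b_def cong_def\<close>)
      also have "[int l' - (int c - int l) = int l' - (int j - int l)] (mod int k)"
        by (intro cong_diff cj cong_refl)
      also have "[int l' - (int j - int l) = int j'] (mod int k)"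
        using companion_equiv_same_diagonal[OF that[unfolded \<beta>_def]]
        by (simp add: same_diagonal_def cong_iff_dvd_diff algebra_simps)
      finally have "b c mod k = j'" using lt by (simp add: cong_def flip: zmod_int)
      then show ?thesis using int_mod_less[OF N(1)] by (simp add: columns_def b_def)
    qed
    have "c' \<in> S c \<longleftrightarrow> \<alpha> \<and> c' = a c \<or> \<beta> \<and> c' = b c" for c'
    proof (cases "c' \<in> columns j'")
      case True
      then have *: "c' < N" "c' mod k = j'" by (auto simp: columns_def)
      have "[int c - int l = int c' - int l'] (mod int N) \<longleftrightarrow> [int c' = int l' + (int c - int l)] (mod int N)"
        unfolding cong_iff_dvd_diff by (subst dvd_minus_iff[symmetric]) (simp add: algebra_simps)
      moreover have "[int c - int l = - (int c' - int l')] (mod int N) \<longleftrightarrow> [int c' = int l' - (int c - int l)] (mod int N)"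
        unfolding cong_iff_dvd_diff by (simp add: algebra_simps)
      ultimately show ?thesis
        using True * c' cong_col[of c'] unfolding S_def mem_Collect_eq cls_eq_iff[OF lt(1,3) c'(1) *(1)] a_def b_def \<alpha>_def \<beta>_def
        by auto
    next
      case False
      then show ?thesis using A B by (auto simp: S_def)
    qed
    then show ?thesis by auto
  qed
  have ua: "u c * u' (a c) = phase N (2 * \<theta>) (int c - int l)" for c
  proof -
    have "u' (a c) = phase N \<theta> ((int l' + (int c - int l)) - int l')"
      unfolding u'_def by (intro phase_cong N cong_diff) (use N in \<open>auto simp: a_def cong_def\<close>)
    then have "u c * u' (a c) = phase N \<theta> ((int c - int l) + (int c - int l))"
      unfolding phase_add by (simp add: u_def)
    also have "\<dots> = phase N (2 * \<theta>) (int c - int l)" by (simp add: phase_def mult_ac)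
    finally show ?thesis .
  qed
  have ub: "u c * u' (b c) = 1" for c
  proof -
    have "u' (b c) = phase N \<theta> ((int l' - (int c - int l)) - int l')"
      unfolding u'_def by (intro phase_cong N cong_diff) (use N in \<open>auto simp: b_def cong_def\<close>)
    then have "u c * u' (b c) = phase N \<theta> ((int c - int l) + (- (int c - int l)))"
      unfolding phase_add by (simp add: u_def)
    then show ?thesis by simp
  qed
  \<comment> \<open>For these columns \<open>N\<close> divides 2 (c - l). Since c - l lies strictly
    between -N and N, it is 0 or plus or minus N / 2.\<close>
  define Z where "Z = {c \<in> columns j. a c = b c}"
  have card_Z: "card Z \<le> 3"
  proof -
    have "int ` Z \<subseteq> {int l, int l + int (N div 2), int l - int (N div 2)}"
    proof (rule image_subsetI)
      fix c assume "c \<in> Z"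
      then have c: "c < N" "a c = b c" by (auto simp: Z_def columns_def)
      from c(2) have "(int l' + (int c - int l)) mod int N = (int l' - (int c - int l)) mod int N"
        using N unfolding a_def b_def by (metis eq_nat_nat_iff of_nat_0_less_iff pos_mod_sign)
      then have "int N dvd 2 * (int c - int l)"
        unfolding mod_eq_dvd_iff by (simp add: algebra_simps)
      then obtain r where r: "2 * (int c - int l) = int N * r" by blast
      have bnd: "2 * (int c - int l) < 2 * int N" "- (2 * int N) < 2 * (int c - int l)" using c lt N by auto
      have "r < 2"
      proof (rule ccontr)
        assume "\<not> r < 2"
        then have "int N * 2 \<le> int N * r" by (intro mult_left_mono) auto
        then show False using r bnd by linarith
      qed
      moreover have "- 2 < r"
      proof (rule ccontr)
        assume "\<not> - 2 < r"
        then have "int N * r \<le> int N * (- 2)" by (intro mult_left_mono) auto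
        then show False using r bnd by linarith
      qed
      ultimately have "r = -1 \<or> r = 0 \<or> r = 1" by linarith
      then show "int c \<in> {int l, int l + int (N div 2), int l - int (N div 2)}" using r by auto
    qed
    from card_mono[OF _ this] have "card (int ` Z) \<le> card {int l, int l + int (N div 2), int l - int (N div 2)}" by simp
    also have "\<dots> \<le> 3" by (simp add: card_insert_if)
    finally show ?thesis by (simp add: card_image)
  qed
  \<comment> \<open>If both columns occur and coincide, the sum over \<open>S c\<close> has one term
    where the formula in \<open>trm\<close> counts two.\<close>
  define err where "err c = (if \<alpha> \<and> \<beta> \<and> a c = b c then u c * u' (a c) else 0)" for c
  have trm: "u c * (\<Sum>c'\<in>S c. u' c') = of_bool \<alpha> * phase N (2 * \<theta>) (int c - int l) + of_bool \<beta> - err c" if "c \<in> columns j" for c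
  proof -
    have "u c * (\<Sum>c'\<in>S c. u' c') = of_bool \<alpha> * (u c * u' (a c)) + of_bool \<beta> * (u c * u' (b c)) - err c"
      unfolding S_eq[OF that] err_def by (auto simp: algebra_simps)
    then show ?thesis by (simp add: ua ub)
  qed
  have "(\<Sum>c\<in>columns j. u c * (\<Sum>c'\<in>S c. u' c')) =
      of_bool \<alpha> * (\<Sum>c\<in>columns j. phase N (2 * \<theta>) (int c - int l)) + of_nat n * of_bool \<beta> - (\<Sum>c\<in>columns j. err c)"
  proof -
    have "(\<Sum>c\<in>columns j. u c * (\<Sum>c'\<in>S c. u' c')) =
        (\<Sum>c\<in>columns j. of_bool \<alpha> * phase N (2 * \<theta>) (int c - int l) + of_bool \<beta> - err c)"
      by (rule sum.cong[OF refl trm])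
    also have "(\<Sum>c\<in>columns j. of_bool \<beta>) = (of_nat n * of_bool \<beta> :: complex)"
      unfolding sum_columns[OF lt(2)] by simp
    then have "(\<Sum>c\<in>columns j. of_bool \<alpha> * phase N (2 * \<theta>) (int c - int l) + of_bool \<beta> - err c) =
        of_bool \<alpha> * (\<Sum>c\<in>columns j. phase N (2 * \<theta>) (int c - int l)) + of_nat n * of_bool \<beta> - (\<Sum>c\<in>columns j. err c)"
      by (simp only: sum_subtractf sum.distrib sum_distrib_left)
    finally show ?thesis .
  qed
  also have "(\<Sum>c\<in>columns j. phase N (2 * \<theta>) (int c - int l)) = 0"
  proof -
    have "\<not> int n dvd int (2 * \<theta>)" using \<theta> by (subst int_dvd_int_iff)
    then have "(\<Sum>m<n. cis (2 * pi * real (2 * \<theta>) * real m / real n)) = 0"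
      using sum_cis_multiples[OF n, of "int (2 * \<theta>)"] by simp
    then show ?thesis unfolding sum_columns[OF lt(2)] phase_column sum_distrib_left[symmetric] by simp
  qed
  finally have "(\<Sum>c\<in>columns j. u c * (\<Sum>c'\<in>S c. u' c')) = of_nat n * of_bool \<beta> - (\<Sum>c\<in>columns j. err c)"
    by simp
  then have "(\<Sum>C\<in>entry_classes. coeff e \<theta> C * coeff e' \<theta> C) - of_bool \<beta> = - (1 / n * (\<Sum>c\<in>columns j. err c))"
    unfolding main using n by (simp add: right_diff_distrib)
  moreover have "cmod (\<Sum>c\<in>columns j. err c) \<le> 3"
  proof -
    have "(\<Sum>c\<in>columns j. err c) = (\<Sum>c\<in>Z. err c)"
      unfolding Z_def by (rule sum.mono_neutral_right) (auto simp: finite_columns err_def)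
    also have "cmod \<dots> \<le> (\<Sum>c\<in>Z. 1)"
      by (rule sum_norm_le) (auto simp: err_def norm_mult u_def u'_def)
    also have "\<dots> \<le> 3" using card_Z by simp
    finally show ?thesis .
  qed
  ultimately show ?thesis
    using n by (simp add: \<beta>_def ee norm_mult norm_divide divide_right_mono)
qed

end

subsection \<open>Spectral moments\<close>

text \<open>Matrix powers on entry functions, free of dimension side conditions and visibly
  polynomial in the entries. They serve the large matrices and their Fourier blocks alike.\<close>

primrec entry_power :: "nat \<Rightarrow> (nat \<times> nat \<Rightarrow> 'a::comm_ring_1) \<Rightarrow> nat \<Rightarrow> nat \<Rightarrow> nat \<Rightarrow> 'a" where
  "entry_power n c 0 i j = (if i = j then 1 else 0)"
| "entry_power n c (Suc m) i j = (\<Sum>p<n. entry_power n c m i p * c (p, j))"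

definition power_trace :: "nat \<Rightarrow> (nat \<times> nat \<Rightarrow> 'a::comm_ring_1) \<Rightarrow> nat \<Rightarrow> 'a" where
  "power_trace n c m = (\<Sum>i<n. entry_power n c m i i)"

lemma index_pow_mat:
  "i < n \<Longrightarrow> j < n \<Longrightarrow> (Matrix.mat n n c ^\<^sub>m m) $$ (i, j) = entry_power n c m i j"
proof (induction m arbitrary: j)
  case (Suc m)
  have "(Matrix.mat n n c ^\<^sub>m Suc m) $$ (i, j) = (\<Sum>p = 0..<n. (Matrix.mat n n c ^\<^sub>m m) $$ (i, p) * Matrix.mat n n c $$ (p, j))"
    using Suc.prems by (simp add: scalar_prod_def)
  also have "\<dots> = (\<Sum>p<n. entry_power n c m i p * c (p, j))"
    unfolding atLeast0LessThan by (intro sum.cong refl) (use Suc in auto)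
  finally show ?case by simp
qed auto

lemma upper_triangular_power:
  fixes B :: "'a :: comm_ring_1 mat"
  assumes B: "B \<in> carrier_mat n n" and ut: "upper_triangular B"
  shows "upper_triangular (B ^\<^sub>m m) \<and> (\<forall>i<n. (B ^\<^sub>m m) $$ (i, i) = (B $$ (i, i)) ^ m)"
proof (induction m)
  case 0
  show ?case using B by auto
next
  case (Suc m)
  have Bm: "B ^\<^sub>m m \<in> carrier_mat n n" using B by simp
  have idx: "(B ^\<^sub>m Suc m) $$ (i, j) = (\<Sum>p<n. (B ^\<^sub>m m) $$ (i, p) * B $$ (p, j))" if "i < n" "j < n" for i j
    using that B Bm by (simp add: scalar_prod_def atLeast0LessThan)
  have z: "(B ^\<^sub>m m) $$ (i, p) * B $$ (p, j) = 0" if "i < n" "p < n" "p < i \<or> j < p" for i p j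
    using that Suc B Bm ut upper_triangularD[of B j p] upper_triangularD[of "B ^\<^sub>m m" p i] by auto
  have "(B ^\<^sub>m Suc m) $$ (i, j) = 0" if "j < i" "i < n" for i j
    unfolding idx[OF that(2) less_trans[OF that]] using that by (intro sum.neutral ballI z) auto
  moreover have "(B ^\<^sub>m Suc m) $$ (i, i) = (B $$ (i, i)) ^ Suc m" if i: "i < n" for i
  proof -
    have "(\<Sum>p<n. (B ^\<^sub>m m) $$ (i, p) * B $$ (p, i)) = (\<Sum>p\<in>{i}. (B ^\<^sub>m m) $$ (i, p) * B $$ (p, i))"
      using i z by (intro sum.mono_neutral_right) (auto, metis linorder_neqE_nat)
    then show ?thesis unfolding idx[OF i i] using Suc i by simp
  qed
  ultimately show ?case using B Bm by auto
qed

lemma trace_mult_commute: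
  fixes A B :: "'a :: comm_ring_1 mat"
  assumes "A \<in> carrier_mat n n" "B \<in> carrier_mat n n"
  shows "(\<Sum>i<n. (A * B) $$ (i, i)) = (\<Sum>i<n. (B * A) $$ (i, i))"
proof -
  have "(\<Sum>i<n. (A * B) $$ (i, i)) = (\<Sum>i<n. \<Sum>j<n. A $$ (i, j) * B $$ (j, i))"
    using assms by (intro sum.cong refl) (simp add: scalar_prod_def atLeast0LessThan)
  also have "\<dots> = (\<Sum>j<n. \<Sum>i<n. B $$ (j, i) * A $$ (i, j))"
    by (subst sum.swap) (simp add: mult.commute)
  also have "\<dots> = (\<Sum>i<n. (B * A) $$ (i, i))"
    using assms by (intro sum.cong refl) (simp add: scalar_prod_def atLeast0LessThan)
  finally show ?thesis .
qed

lemma proots_prod_linear: "proots (\<Prod>a\<leftarrow>as. [:- a, 1:] :: complex poly) = mset as"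
proof (induction as)
  case (Cons a as)
  have "(\<Prod>a\<leftarrow>as. [:- a, 1:] :: complex poly) \<noteq> 0" by (auto simp: prod_list_zero_iff)
  then have "proots ([:- a, 1:] * (\<Prod>a\<leftarrow>as. [:- a, 1:])) = proots [:- a, 1:] + proots (\<Prod>a\<leftarrow>as. [:- a, 1:])"
    by (intro proots_mult) auto
  then show ?case using Cons by (simp del: mult_pCons_left)
qed auto

text \<open>Schur triangularisation: the triangular factor has the eigenvalues on its diagonal, its
  powers have their powers there, and the trace is invariant under similarity by
  \<open>trace_mult_commute\<close>.\<close>

lemma sum_eigenvalue_powers:
  fixes c :: "nat \<times> nat \<Rightarrow> complex"
  shows "(\<Sum>z\<in>#proots (char_poly (Matrix.mat n n c)). z ^ m) = power_trace n c m"
proof -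
  define A where "A = Matrix.mat n n c"
  have A: "A \<in> carrier_mat n n" by (simp add: A_def)
  obtain es where es: "char_poly A = (\<Prod>a\<leftarrow>es. [:- a, 1:])" "length es = n"
    using char_poly_factorized[OF A] by blast
  obtain B P Q where sd: "schur_decomposition A es = (B, P, Q)" by (cases "schur_decomposition A es")
  from schur_decomposition[OF A es(1) sd]
  have sim: "similar_mat_wit A B P Q" and ut: "upper_triangular B" and diag: "diag_mat B = es" by auto
  note B = similar_mat_witD2[OF A sim]
  have Bm: "B ^\<^sub>m m \<in> carrier_mat n n" using B by simp
  have "power_trace n c m = (\<Sum>i<n. (A ^\<^sub>m m) $$ (i, i))"
    unfolding power_trace_def A_def by (intro sum.cong refl) (simp add: index_pow_mat)
  also have "A ^\<^sub>m m = P * (B ^\<^sub>m m) * Q" by (rule similar_mat_wit_pow_id[OF sim])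
  also have "(\<Sum>i<n. (P * (B ^\<^sub>m m) * Q) $$ (i, i)) = (\<Sum>i<n. (Q * (P * (B ^\<^sub>m m))) $$ (i, i))"
    using B Bm by (intro trace_mult_commute) auto
  also have "Q * (P * (B ^\<^sub>m m)) = (Q * P) * (B ^\<^sub>m m)"
    using B Bm by (intro assoc_mult_mat[symmetric]) auto
  also have "\<dots> = B ^\<^sub>m m" using B Bm by simp
  also have "(\<Sum>i<n. (B ^\<^sub>m m) $$ (i, i)) = (\<Sum>i<n. (B $$ (i, i)) ^ m)"
    using upper_triangular_power[OF _ ut, of n m] B by simp
  also have "\<dots> = (\<Sum>i<length es. es ! i ^ m)"
    unfolding diag[symmetric] using B by (intro sum.cong) (auto simp: diag_mat_def)
  also have "\<dots> = (\<Sum>z\<leftarrow>es. z ^ m)"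
    by (simp add: sum_list_sum_nth atLeast0LessThan)
  also have "\<dots> = (\<Sum>z\<in>#proots (char_poly A). z ^ m)"
    unfolding es(1) proots_prod_linear by (simp add: sum_mset_sum_list flip: mset_map)
  finally show ?thesis by (simp add: A_def)
qed

section \<open>Spectral measures of Hermitian matrices\<close>

definition hermitian_entries :: "nat \<Rightarrow> (nat \<times> nat \<Rightarrow> complex) \<Rightarrow> bool" where
  "hermitian_entries n c \<longleftrightarrow> (\<forall>p\<in>indices n. c (prod.swap p) = cnj (c p))"

lemma hermitian_eigenvalue_real:
  assumes herm: "hermitian_entries n c" and z: "z \<in># proots (char_poly (Matrix.mat n n c))"
  shows "z \<in> \<real>"
proof -
  define A where "A = Matrix.mat n n c"
  have A: "A \<in> carrier_mat n n" by (simp add: A_def)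
  have "poly (char_poly A) z = 0" using z by (cases "char_poly A = 0") (auto simp: A_def)
  then have "eigenvalue A z" using eigenvalue_root_char_poly[OF A] by simp
  then obtain v where v: "v \<in> carrier_vec n" "v \<noteq> 0\<^sub>v n" "A *\<^sub>v v = z \<cdot>\<^sub>v v"
    unfolding eigenvalue_def eigenvector_def using A by auto
  have eq: "(\<Sum>j<n. c (i, j) * v $ j) = z * v $ i" if "i < n" for i
  proof -
    have "(A *\<^sub>v v) $ i = (z \<cdot>\<^sub>v v) $ i" using v by simp
    then show ?thesis using that v(1) A by (simp add: A_def scalar_prod_def atLeast0LessThan)
  qed
  \<comment> \<open>The Hermitian form at the eigenvector: it equals its conjugate, and it is
    \<open>z\<close> times the squared norm \<open>r\<close>.\<close>
  define s where "s = (\<Sum>i<n. cnj (v $ i) * (\<Sum>j<n. c (i, j) * v $ j))"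
  have "cnj s = (\<Sum>i<n. \<Sum>j<n. cnj (v $ j) * (c (j, i) * v $ i))"
    unfolding s_def cnj_sum complex_cnj_mult complex_cnj_cnj sum_distrib_left
  proof (intro sum.cong refl)
    fix i j assume "i \<in> {..<n}" "j \<in> {..<n}"
    then have "cnj (c (i, j)) = c (j, i)" using herm unfolding hermitian_entries_def by (metis SigmaI prod.swap_def fst_conv snd_conv)
    then show "v $ i * (cnj (c (i, j)) * cnj (v $ j)) = cnj (v $ j) * (c (j, i) * v $ i)" by simp
  qed
  also have "\<dots> = s" unfolding s_def sum_distrib_left by (rule sum.swap)
  finally have s: "s \<in> \<real>" by (simp add: Reals_cnj_iff)
  define r where "r = (\<Sum>i<n. (cmod (v $ i))\<^sup>2)"
  have "s = (\<Sum>i<n. cnj (v $ i) * (z * v $ i))" unfolding s_def by (intro sum.cong refl) (simp add: eq)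
  also have "\<dots> = z * of_real r"
    unfolding r_def of_real_sum complex_norm_square sum_distrib_left by (simp add: mult_ac)
  finally have sr: "s = z * of_real r" .
  have "r \<noteq> 0"
  proof
    assume "r = 0"
    then have "\<forall>i<n. v $ i = 0" unfolding r_def by (subst (asm) sum_nonneg_eq_0_iff) auto
    then have "v = 0\<^sub>v n" using v(1) by (intro eq_vecI) auto
    then show False using v(2) by simp
  qed
  then have "z = s / of_real r" using sr by simp
  then show ?thesis using s by (auto intro: Reals_divide)
qed

lemma size_eigenvalues: "size (eigenvalues n c) = n"
proof -
  have "degree (char_poly (Matrix.mat n n c)) = n"
    using degree_monic_char_poly[of "Matrix.mat n n c" n] by auto
  then show ?thesis by (simp add: eigenvalues_def size_proots_complex)
qed

lemma sum_mset_conv_count: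
  "finite B \<Longrightarrow> set_mset A \<subseteq> B \<Longrightarrow> (\<Sum>x\<in>#A. f x :: real) = (\<Sum>x\<in>B. f x * real (count A x))"
proof (induction A)
  case (add y A)
  have "(\<Sum>x\<in>B. f x * real (count (add_mset y A) x)) = (\<Sum>x\<in>B. f x * real (count A x) + (if x = y then f x else 0))"
    by (intro sum.cong refl) (auto simp: algebra_simps)
  also have "\<dots> = (\<Sum>x\<in>B. f x * real (count A x)) + f y"
    using add.prems by (simp add: sum.distrib)
  finally show ?case using add by simp
qed auto

lemma real_distribution_spectral_measure: "real_distribution (spectral_measure n c)"
  unfolding spectral_measure_def by (rule prob_space.real_distribution_distr[OF prob_space_measure_pmf]) simp

lemma sets_spectral_measure [simp, measurable_cong]: "sets (spectral_measure n c) = sets borel"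
  by (simp add: spectral_measure_def)

lemma space_spectral_measure [simp]: "space (spectral_measure n c) = UNIV"
  by (simp add: spectral_measure_def)

lemma integral_spectral_measure:
  fixes g :: "real \<Rightarrow> real"
  assumes n: "n > 0" and g: "g \<in> borel_measurable borel"
  shows "integrable (spectral_measure n c) g"
    and "(\<integral>x. g x \<partial>spectral_measure n c) = (\<Sum>t\<in>#eigenvalues n c. g (t / sqrt n)) / n"
proof -
  define E where "E = eigenvalues n c"
  have E: "E \<noteq> {#}" "size E = n" using n size_eigenvalues[of n c] by (auto simp: E_def)
  have "integrable (measure_pmf (pmf_of_multiset E)) (\<lambda>t. g (t / sqrt n))"
    using E by (intro integrable_measure_pmf_finite) simp
  then show "integrable (spectral_measure n c) g"
    unfolding spectral_measure_def E_def[symmetric] using g by (subst integrable_distr_eq) auto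
  have "(\<integral>x. g x \<partial>spectral_measure n c) = (\<integral>t. g (t / sqrt n) \<partial>measure_pmf (pmf_of_multiset E))"
    unfolding spectral_measure_def E_def[symmetric] using g by (subst integral_distr) auto
  also have "\<dots> = (\<Sum>t\<in>set_mset E. g (t / sqrt n) * pmf (pmf_of_multiset E) t)"
    using E by (intro integral_measure_pmf_real) auto
  also have "\<dots> = (\<Sum>t\<in>#E. g (t / sqrt n)) / n"
    using E by (simp add: sum_mset_conv_count[OF _ order_refl] sum_divide_distrib)
  finally show "(\<integral>x. g x \<partial>spectral_measure n c) = (\<Sum>t\<in>#eigenvalues n c. g (t / sqrt n)) / n"
    by (simp add: E_def)
qed

lemma spectral_moment:
  assumes n: "n > 0" and herm: "hermitian_entries n c"
  shows "of_real (\<integral>x. x ^ m \<partial>spectral_measure n c) = power_trace n c m / (of_nat n * of_real (sqrt n ^ m))"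
proof -
  have "(\<Sum>t\<in>#eigenvalues n c. (t / sqrt n) ^ m) = (\<Sum>t\<in>#eigenvalues n c. t ^ m) / sqrt n ^ m"
    by (simp add: power_divide sum_mset_distrib_right divide_inverse power_mult_distrib power_inverse)
  moreover have "of_real (\<Sum>t\<in>#eigenvalues n c. t ^ m) = (\<Sum>z\<in>#proots (char_poly (Matrix.mat n n c)). z ^ m)"
  proof -
    have *: "of_real (\<Sum>t\<in>#M. t ^ m) = (\<Sum>t\<in>#M. complex_of_real t ^ m)" for M :: "real multiset"
      by (induction M) auto
    show ?thesis unfolding * unfolding eigenvalues_def multiset.map_comp
      by (intro arg_cong[where f = sum_mset] image_mset_cong)
        (use hermitian_eigenvalue_real[OF herm] in auto)
  qed
  ultimately show ?thesis
    unfolding sum_eigenvalue_powers by (simp add: integral_spectral_measure(2)[OF n] mult.commute)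
qed

section \<open>Measurability of the spectral measure\<close>

lemma measurable_entry_power:
  assumes "\<And>p. p \<in> indices n \<Longrightarrow> (\<lambda>x. c x p) \<in> borel_measurable M" "j < n"
  shows "(\<lambda>x. entry_power n (c x) m i j :: complex) \<in> borel_measurable M"
  using assms(2)
proof (induction m arbitrary: j)
  case (Suc m)
  then show ?case using assms(1) by (auto intro!: borel_measurable_sum borel_measurable_times)
qed auto

text \<open>For \<open>r > 0\<close> the ramp \<open>g r\<close> falls from 1 at \<open>a\<close> to
  0 at a + 1 / r, so the ramps converge to the indicator. Weierstrass approximation within 1 / (r +
  1) on the growing interval from -r to r preserves the pointwise limit.\<close>

lemma polynomials_tendsto_indicator:
  fixes a :: real
  shows "\<exists>(b :: nat \<Rightarrow> nat \<Rightarrow> real) d. \<forall>x. (\<lambda>r. \<Sum>i\<le>d r. b r i * x ^ i) \<longlonglongrightarrow> indicator {..a} x"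
proof -
  define g where "g r x = max 0 (min 1 (1 - real r * (x - a)))" for r :: nat and x :: real
  have "\<exists>p. real_polynomial_function p \<and> (\<forall>x\<in>{- real r..real r}. \<bar>g r x - p x\<bar> < 1 / real (Suc r))" for r
  proof -
    have "continuous_on {- real r..real r} (g r)" unfolding g_def by (intro continuous_intros)
    from Stone_Weierstrass_real_polynomial_function[OF compact_Icc this, of "1 / real (Suc r)"]
    obtain q where "real_polynomial_function q" "\<And>x. x \<in> {- real r..real r} \<Longrightarrow> \<bar>g r x - q x\<bar> < 1 / real (Suc r)"
      by auto
    then show ?thesis by blast
  qed
  then obtain p where p: "\<And>r. real_polynomial_function (p r)"
    "\<And>r x. x \<in> {- real r..real r} \<Longrightarrow> \<bar>g r x - p r x\<bar> < 1 / real (Suc r)" by metis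
  have "\<forall>r. \<exists>b d. p r = (\<lambda>x. \<Sum>i\<le>d. b i * x ^ i)"
    using p(1) unfolding real_polynomial_function_iff_sum by blast
  then obtain b d where bd: "\<And>r. p r = (\<lambda>x. \<Sum>i\<le>d r. b r i * x ^ i)" by metis
  have "(\<lambda>r. p r x) \<longlonglongrightarrow> indicator {..a} x" for x
  proof -
    have g: "(\<lambda>r. g r x) \<longlonglongrightarrow> indicator {..a} x"
    proof (cases "x \<le> a")
      case True
      then have "g r x = 1" for r by (simp add: g_def mult_nonneg_nonpos)
      then show ?thesis using True by simp
    next
      case False
      obtain R :: nat where R: "real R > 1 / (x - a)" using reals_Archimedean2 by blast
      have "g r x = 0" if "r \<ge> R" for r
      proof -
        have "1 / (x - a) < real r" using R that by linarith
        then have "1 < real r * (x - a)" using False by (simp add: field_simps)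
        then show ?thesis by (simp add: g_def)
      qed
      then have "eventually (\<lambda>r. g r x = 0) sequentially" unfolding eventually_sequentially by blast
      then show ?thesis using False by (simp add: tendsto_eventually)
    qed
    have "(\<lambda>r. g r x - p r x) \<longlonglongrightarrow> 0"
    proof (rule tendsto_rabs_zero_cancel, rule tendsto_sandwich[where f = "\<lambda>_. 0" and h = "\<lambda>r. 1 / real (Suc r)"])
      obtain R :: nat where R: "real R \<ge> \<bar>x\<bar>" using real_arch_simple by blast
      show "eventually (\<lambda>r. \<bar>g r x - p r x\<bar> \<le> 1 / real (Suc r)) sequentially"
        unfolding eventually_sequentially
      proof (intro exI[of _ R] allI impI)
        fix r assume "R \<le> r"
        then have "x \<in> {- real r..real r}" using R by auto
        from p(2)[OF this] show "\<bar>g r x - p r x\<bar> \<le> 1 / real (Suc r)" by simp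
      qed
      show "(\<lambda>r. 1 / real (Suc r)) \<longlonglongrightarrow> 0"
        using LIMSEQ_inverse_real_of_nat by (simp add: inverse_eq_divide)
    qed auto
    from tendsto_diff[OF g this] show ?thesis by simp
  qed
  then show ?thesis unfolding bd by blast
qed

text \<open>The measure of a half line is a pointwise limit of linear combinations of moments, and
  on Hermitian matrices these are normalised traces of powers, hence polynomials in the entries. In
  this way no measurable choice of eigenvalues has to be made.\<close>

lemma measurable_spectral_measure:
  assumes n: "n > 0"
  shows "spectral_measure n \<in> measurable (hermitian_matrices n) (prob_algebra borel)"
proof (rule measurable_prob_algebra_generated[where G = "range (\<lambda>a. {..a})" and \<Omega> = UNIV])
  show "sets (borel :: real measure) = sigma_sets UNIV (range (\<lambda>a. {..a}))"
    by (subst borel_eq_atMost) simp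
  show "Int_stable (range (\<lambda>a :: real. {..a}))"
    by (auto simp: Int_stable_def)
  fix c show "prob_space (spectral_measure n c)"
    using real_distribution_spectral_measure real_distribution_def by blast
next
  fix A :: "real set" assume "A \<in> range (\<lambda>a. {..a})"
  then obtain a where A: "A = {..a}" by blast
  obtain b d where bd: "\<And>x. (\<lambda>r. \<Sum>i\<le>d r. b r i * x ^ i) \<longlonglongrightarrow> indicator {..a} x"
    using polynomials_tendsto_indicator[of a] by blast
  define F where "F r c = (\<Sum>i\<le>d r. b r i * Re (power_trace n c i / (of_nat n * of_real (sqrt n ^ i))))" for r c
  have herm: "hermitian_entries n c" if "c \<in> space (hermitian_matrices n)" for c
    using that unfolding hermitian_matrices_def hermitian_entries_def space_restrict_space by blast
  have "measure (spectral_measure n c) A = lim (\<lambda>r. F r c)" if c: "c \<in> space (hermitian_matrices n)" for c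
  proof -
    have F: "F r c = (\<Sum>t\<in>#eigenvalues n c. \<Sum>i\<le>d r. b r i * (t / sqrt n) ^ i) / n" for r
    proof -
      have "F r c = (\<Sum>i\<le>d r. b r i * (\<integral>x. x ^ i \<partial>spectral_measure n c))"
        unfolding F_def spectral_moment[OF n herm[OF c], symmetric] by simp
      also have "\<dots> = (\<integral>x. (\<Sum>i\<le>d r. b r i * x ^ i) \<partial>spectral_measure n c)"
        by (subst Bochner_Integration.integral_sum) (auto intro!: integral_spectral_measure(1)[OF n])
      also have "\<dots> = (\<Sum>t\<in>#eigenvalues n c. \<Sum>i\<le>d r. b r i * (t / sqrt n) ^ i) / n"
        by (rule integral_spectral_measure(2)[OF n]) simp
      finally show ?thesis .
    qed
    have lim: "(\<lambda>r. \<Sum>t\<in>#E. \<Sum>i\<le>d r. b r i * (t / sqrt n) ^ i) \<longlonglongrightarrow> (\<Sum>t\<in>#E. indicator {..a} (t / sqrt n))" for E :: "real multiset"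
      by (induction E) (auto intro!: tendsto_add bd)
    have "(\<lambda>r. F r c) \<longlonglongrightarrow> (\<Sum>t\<in>#eigenvalues n c. indicator {..a} (t / sqrt n)) / n"
      unfolding F using n by (intro tendsto_divide lim tendsto_const) auto
    also have "(\<Sum>t\<in>#eigenvalues n c. indicator {..a} (t / sqrt n)) / n = (\<integral>x. indicator {..a} x \<partial>spectral_measure n c)"
      by (rule integral_spectral_measure(2)[OF n, symmetric]) simp
    also have "\<dots> = measure (spectral_measure n c) A" by (simp add: A)
    finally show ?thesis by (rule limI[symmetric])
  qed
  moreover have "(\<lambda>c. lim (\<lambda>r. F r c)) \<in> borel_measurable (hermitian_matrices n)"
  proof (rule borel_measurable_lim_metric)
    fix r
    have comp: "(\<lambda>c. c p) \<in> borel_measurable (hermitian_matrices n)" if "p \<in> indices n" for p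
      unfolding hermitian_matrices_def using that by (intro measurable_restrict_space1 measurable_component_singleton)
    show "F r \<in> borel_measurable (hermitian_matrices n)"
      unfolding F_def power_trace_def
      by (intro borel_measurable_sum borel_measurable_times borel_measurable_const
          measurable_compose[OF _ borel_measurable_Re] borel_measurable_divide measurable_entry_power comp) auto
  qed
  ultimately have "(\<lambda>c. measure (spectral_measure n c) A) \<in> borel_measurable (hermitian_matrices n)"
    by (subst measurable_cong) auto
  moreover have "emeasure (spectral_measure n c) A = ennreal (measure (spectral_measure n c) A)" for c
    using real_distribution_spectral_measure[of n c]
    by (intro finite_measure.emeasure_eq_measure prob_space.finite_measure) (simp add: real_distribution_def)
  ultimately show "(\<lambda>c. emeasure (spectral_measure n c) A) \<in> borel_measurable (hermitian_matrices n)" by simp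
qed auto

subsection \<open>Gaussian moments\<close>

lemma prob_space_real_gaussian: "prob_space real_gaussian"
  unfolding real_gaussian_def by (rule prob_space_normal_density) simp

lemma sets_real_gaussian [simp, measurable_cong]: "sets real_gaussian = sets borel"
  by (simp add: real_gaussian_def)

lemma space_real_gaussian [simp]: "space real_gaussian = UNIV"
  by (simp add: real_gaussian_def)

lemma integrable_real_gaussian_power: "integrable real_gaussian (\<lambda>x. x ^ m)"
  unfolding real_gaussian_def
  by (subst integrable_density) (auto simp: integrable_std_normal_moment)

text \<open>Integration by parts for monomials, read off from the closed formulas for even and odd
  moments. The truncated exponent \<open>m - 1\<close> at \<open>m = 0\<close> is multiplied by
  0.\<close>

lemma real_gaussian_moment:
  "(\<integral>x. x ^ Suc m \<partial>real_gaussian) = m * (\<integral>x. x ^ (m - 1) \<partial>real_gaussian)"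
proof -
  have eq: "(\<integral>x. x ^ m \<partial>real_gaussian) = (\<integral>x. std_normal_density x * x ^ m \<partial>lborel)" for m
    unfolding real_gaussian_def by (subst integral_density) auto
  show ?thesis
  proof (cases "even m")
    case True
    then obtain r where r: "m = 2 * r" by blast
    have 1: "(\<integral>x. x ^ Suc m \<partial>real_gaussian) = 0"
      unfolding eq r using integral_std_normal_moment_odd[of r] by simp
    show ?thesis
    proof (cases r)
      case (Suc s)
      then have "m - 1 = 2 * s + 1" using r by simp
      then have "(\<integral>x. x ^ (m - 1) \<partial>real_gaussian) = 0"
        unfolding eq using integral_std_normal_moment_odd[of s] by simp
      then show ?thesis using 1 by simp
    qed (use 1 r in simp)
  next
    case False
    then obtain r where r: "m = 2 * r + 1" using oddE by blast
    have "(\<integral>x. x ^ Suc m \<partial>real_gaussian) = fact (2 * Suc r) / (2 ^ Suc r * fact (Suc r))"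
      unfolding eq using integral_std_normal_moment_even[of "Suc r"] by (simp add: r)
    also have "\<dots> = m * (fact (2 * r) / (2 ^ r * fact r))"
    proof -
      have "fact (2 * Suc r) = 2 * (real r + 1) * (m * fact (2 * r))" by (simp add: r algebra_simps)
      moreover have "2 ^ Suc r * fact (Suc r) = 2 * (real r + 1) * (2 ^ r * fact r)" by simp
      ultimately show ?thesis by (simp only: mult_divide_mult_cancel_left_if times_divide_eq_right) simp
    qed
    also have "fact (2 * r) / (2 ^ r * fact r) = (\<integral>x. x ^ (m - 1) \<partial>real_gaussian)"
      unfolding eq using integral_std_normal_moment_even[of r] by (simp add: r)
    finally show ?thesis by simp
  qed
qed

lemma integrable_real_gaussian_of_real_power: "integrable real_gaussian (\<lambda>x. complex_of_real x ^ m)"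
  using integrable_of_real[OF integrable_real_gaussian_power[of m], where 'a = complex] by simp

text \<open>Gaussian integration by parts, by linearity from the monomials. Complex coefficients are
  allowed because z and its conjugate are complex affine functions of each real coordinate.\<close>

lemma stein_poly:
  "(\<integral>x. of_real x * poly Q (complex_of_real x) \<partial>real_gaussian) = (\<integral>x. poly (pderiv Q) (of_real x) \<partial>real_gaussian)"
proof -
  define \<gamma> where "\<gamma> m = (\<integral>x. complex_of_real x ^ m \<partial>real_gaussian)" for m
  have \<gamma>: "\<gamma> (Suc m) = of_nat m * \<gamma> (m - 1)" for m
    using real_gaussian_moment[of m] unfolding \<gamma>_def of_real_power[symmetric] integral_complex_of_real by simp
  have Q: "Q = (\<Sum>i\<le>degree Q. monom (coeff Q i) i)" by (rule poly_as_sum_of_monoms[symmetric])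
  have "(\<integral>x. of_real x * poly Q (complex_of_real x) \<partial>real_gaussian) =
      (\<integral>x. (\<Sum>i\<le>degree Q. coeff Q i * of_real x ^ Suc i) \<partial>real_gaussian)"
    by (simp add: poly_altdef sum_distrib_left mult_ac)
  also have "\<dots> = (\<Sum>i\<le>degree Q. coeff Q i * \<gamma> (Suc i))"
    unfolding \<gamma>_def
    by (subst Bochner_Integration.integral_sum) (intro integrable_mult_right
        integrable_real_gaussian_of_real_power, simp del: power_Suc)
  also have "\<dots> = (\<Sum>i\<le>degree Q. of_nat i * coeff Q i * \<gamma> (i - 1))" by (simp add: \<gamma> mult_ac)
  also have "\<dots> = (\<integral>x. (\<Sum>i\<le>degree Q. of_nat i * coeff Q i * of_real x ^ (i - 1)) \<partial>real_gaussian)"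
    unfolding \<gamma>_def
    by (subst Bochner_Integration.integral_sum) (simp_all add: integrable_real_gaussian_of_real_power)
  also have "\<dots> = (\<integral>x. poly (pderiv Q) (of_real x) \<partial>real_gaussian)"
    by (subst Q) (simp add: pderiv_sum pderiv_monom poly_sum poly_monom)
  finally show ?thesis .
qed

abbreviation gaussian_pair :: "real \<Rightarrow> real \<Rightarrow> complex" where
  "gaussian_pair a b \<equiv> Complex a b / of_real (sqrt 2)"

lemma integrable_gaussian_pair:
  assumes F[measurable]: "F \<in> borel_measurable (borel \<Otimes>\<^sub>M borel)"
    and le: "\<And>a b. cmod (F (a, b)) \<le> (1 + \<bar>a\<bar>) ^ m * (1 + \<bar>b\<bar>) ^ m"
  shows "integrable (real_gaussian \<Otimes>\<^sub>M real_gaussian) F"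
proof -
  interpret G: prob_space real_gaussian by (rule prob_space_real_gaussian)
  interpret GG: pair_prob_space real_gaussian real_gaussian ..
  have int1: "integrable real_gaussian (\<lambda>x. (1 + \<bar>x\<bar>) ^ m)"
  proof -
    have "integrable real_gaussian (\<lambda>x. \<Sum>j\<le>m. of_nat (m choose j) * \<bar>x\<bar> ^ j)"
      using integrable_abs[OF integrable_real_gaussian_power]
      by (intro Bochner_Integration.integrable_sum integrable_mult_right) (simp add: power_abs)
    then show ?thesis by (subst add.commute) (simp add: binomial_ring)
  qed
  have "integrable (real_gaussian \<Otimes>\<^sub>M real_gaussian) (\<lambda>x. (1 + \<bar>fst x\<bar>) ^ m * (1 + \<bar>snd x\<bar>) ^ m)"
    by (rule GG.Fubini_integrable) (auto simp: abs_mult intro!: int1 integrable_mult_left)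
  then show ?thesis
  proof (rule Bochner_Integration.integrable_bound)
    show "F \<in> borel_measurable (real_gaussian \<Otimes>\<^sub>M real_gaussian)" by measurable
    show "AE x in real_gaussian \<Otimes>\<^sub>M real_gaussian. cmod (F x) \<le> norm ((1 + \<bar>fst x\<bar>) ^ m * (1 + \<bar>snd x\<bar>) ^ m)"
      using le by (intro AE_I2) (auto simp: abs_mult)
  qed
qed

lemma norm_gaussian_pair: "cmod (gaussian_pair a b) \<le> (1 + \<bar>a\<bar>) * (1 + \<bar>b\<bar>)"
proof -
  have "cmod (gaussian_pair a b) = cmod (Complex a b) / sqrt 2" by (simp add: norm_divide)
  also have "\<dots> \<le> cmod (Complex a b)" using divide_left_mono[of 1 "sqrt 2" "cmod (Complex a b)"] by simp
  also have "\<dots> \<le> \<bar>a\<bar> + \<bar>b\<bar>" using cmod_le[of "Complex a b"] by simp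
  also have "\<dots> \<le> (1 + \<bar>a\<bar>) * (1 + \<bar>b\<bar>)" by (simp add: algebra_simps)
  finally show ?thesis .
qed

lemma gaussian_pair_measurable [measurable]: "(\<lambda>x. gaussian_pair (fst x) (snd x)) \<in> borel_measurable (borel \<Otimes>\<^sub>M borel)"
proof -
  have "(\<lambda>x. (of_real (fst x) + \<i> * of_real (snd x)) / of_real (sqrt 2) :: complex) \<in> borel_measurable (borel \<Otimes>\<^sub>M borel)"
    by measurable
  then show ?thesis by (simp add: Complex_eq)
qed

lemma complex_gaussian_alt:
  "complex_gaussian = distr (real_gaussian \<Otimes>\<^sub>M real_gaussian) borel (\<lambda>x. gaussian_pair (fst x) (snd x))"
  unfolding complex_gaussian_def by (simp add: case_prod_beta')

lemma sets_complex_gaussian [simp, measurable_cong]: "sets complex_gaussian = sets borel"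
  by (simp add: complex_gaussian_def)

lemma measurable_gaussian_pair': "(\<lambda>x. gaussian_pair (fst x) (snd x)) \<in> measurable (real_gaussian \<Otimes>\<^sub>M real_gaussian) borel"
  by measurable

lemma prob_space_complex_gaussian: "prob_space complex_gaussian"
proof -
  interpret G: prob_space real_gaussian by (rule prob_space_real_gaussian)
  interpret GG: pair_prob_space real_gaussian real_gaussian ..
  show ?thesis unfolding complex_gaussian_alt by (rule GG.P.prob_space_distr[OF measurable_gaussian_pair'])
qed

section \<open>Moments of the complex Gaussian law\<close>

definition wirtinger_power :: "nat \<Rightarrow> nat \<Rightarrow> complex \<Rightarrow> complex" where
  "wirtinger_power p q z = z ^ p * cnj z ^ q"

lemma wirtinger_power_measurable [measurable]: "wirtinger_power p q \<in> borel_measurable borel"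
  unfolding wirtinger_power_def by (intro borel_measurable_continuous_onI continuous_intros)

lemma integrable_wirtinger_power_pair:
  "integrable (real_gaussian \<Otimes>\<^sub>M real_gaussian) (\<lambda>x. wirtinger_power p q (gaussian_pair (fst x) (snd x)))"
  "integrable (real_gaussian \<Otimes>\<^sub>M real_gaussian) (\<lambda>x. of_real (fst x) * wirtinger_power p q (gaussian_pair (fst x) (snd x)))"
  "integrable (real_gaussian \<Otimes>\<^sub>M real_gaussian) (\<lambda>x. of_real (snd x) * wirtinger_power p q (gaussian_pair (fst x) (snd x)))"
proof -
  have le: "cmod (wirtinger_power p q (gaussian_pair a b)) \<le> (1 + \<bar>a\<bar>) ^ (p + q) * (1 + \<bar>b\<bar>) ^ (p + q)" for a b
  proof -
    have "cmod (wirtinger_power p q (gaussian_pair a b)) = cmod (gaussian_pair a b) ^ (p + q)"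
      unfolding wirtinger_power_def norm_mult norm_power complex_mod_cnj power_add ..
    also have "\<dots> \<le> ((1 + \<bar>a\<bar>) * (1 + \<bar>b\<bar>)) ^ (p + q)" by (intro power_mono norm_gaussian_pair) auto
    finally show ?thesis by (simp add: power_mult_distrib)
  qed
  have le': "cmod (of_real c * wirtinger_power p q (gaussian_pair a b)) \<le> (1 + \<bar>a\<bar>) ^ Suc (p + q) * (1 + \<bar>b\<bar>) ^ Suc (p + q)"
    if "\<bar>c\<bar> \<le> (1 + \<bar>a\<bar>) * (1 + \<bar>b\<bar>)" for a b c
  proof -
    have "cmod (of_real c * wirtinger_power p q (gaussian_pair a b)) \<le> ((1 + \<bar>a\<bar>) * (1 + \<bar>b\<bar>)) * ((1 + \<bar>a\<bar>) ^ (p + q) * (1 + \<bar>b\<bar>) ^ (p + q))"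
      unfolding norm_mult using that le by (intro mult_mono) auto
    then show ?thesis by (simp add: mult_ac)
  qed
  show "integrable (real_gaussian \<Otimes>\<^sub>M real_gaussian) (\<lambda>x. wirtinger_power p q (gaussian_pair (fst x) (snd x)))"
    by (rule integrable_gaussian_pair[where m = "p + q"]) (use le in auto)
  show "integrable (real_gaussian \<Otimes>\<^sub>M real_gaussian) (\<lambda>x. of_real (fst x) * wirtinger_power p q (gaussian_pair (fst x) (snd x)))"
    by (rule integrable_gaussian_pair[where m = "Suc (p + q)"], measurable)
      (unfold fst_conv snd_conv, rule le', simp add: algebra_simps)
  show "integrable (real_gaussian \<Otimes>\<^sub>M real_gaussian) (\<lambda>x. of_real (snd x) * wirtinger_power p q (gaussian_pair (fst x) (snd x)))"
    by (rule integrable_gaussian_pair[where m = "Suc (p + q)"], measurable)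
      (unfold fst_conv snd_conv, rule le', simp add: algebra_simps)
qed

definition wirtinger_moment :: "nat \<Rightarrow> nat \<Rightarrow> complex" where
  "wirtinger_moment p q = (\<integral>z. wirtinger_power p q z \<partial>complex_gaussian)"

lemma integrable_wirtinger_power: "integrable complex_gaussian (wirtinger_power p q)"
  unfolding complex_gaussian_alt
  by (subst integrable_distr_eq[OF measurable_gaussian_pair']) (simp_all add: integrable_wirtinger_power_pair)

lemma wirtinger_moment_pair:
  "wirtinger_moment p q = (\<integral>x. wirtinger_power p q (gaussian_pair (fst x) (snd x)) \<partial>(real_gaussian \<Otimes>\<^sub>M real_gaussian))"
  unfolding wirtinger_moment_def complex_gaussian_alt
  by (subst integral_distr[OF measurable_gaussian_pair']) auto

text \<open>With one of the two real coordinates fixed, z and its conjugate are affine in the other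
  one. The slopes are both s for the first coordinate and \<i> s, - \<i> s for the second, where s =
  1 / sqrt 2.\<close>

lemma stein_wirtinger:
  fixes \<alpha> \<beta> \<alpha>' \<beta>' :: complex
  assumes u: "\<And>x. u x = (of_real x * \<alpha> + \<beta>) ^ p * (of_real x * \<alpha>' + \<beta>') ^ q"
  shows "(\<integral>x. of_real x * u x \<partial>real_gaussian) = (\<integral>x. of_nat p * \<alpha> * ((of_real x * \<alpha> + \<beta>) ^ (p - 1) * (of_real x * \<alpha>' + \<beta>') ^ q)
    + of_nat q * \<alpha>' * ((of_real x * \<alpha> + \<beta>) ^ p * (of_real x * \<alpha>' + \<beta>') ^ (q - 1)) \<partial>real_gaussian)"
proof -
  define Q where "Q = [:\<beta>, \<alpha>:] ^ p * [:\<beta>', \<alpha>':] ^ q"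
  have d: "pderiv [:\<beta>, \<alpha>:] = [:\<alpha>:]" for \<alpha> \<beta> :: complex by (simp add: pderiv_pCons)
  have "u x = poly Q (of_real x)" for x unfolding u Q_def by (simp add: algebra_simps)
  moreover have "poly (pderiv Q) (of_real x) = of_nat p * \<alpha> * ((of_real x * \<alpha> + \<beta>) ^ (p - 1) * (of_real x * \<alpha>' + \<beta>') ^ q)
    + of_nat q * \<alpha>' * ((of_real x * \<alpha> + \<beta>) ^ p * (of_real x * \<alpha>' + \<beta>') ^ (q - 1))" for x :: real
    unfolding Q_def pderiv_mult pderiv_power d by (simp add: algebra_simps)
  ultimately show ?thesis using stein_poly[of Q] by simp
qed

text \<open>Write one factor z as s a + \<i> s b and integrate by parts in \<open>a\<close>
  (\<open>A\<close>) and in \<open>b\<close> (\<open>B\<close>). The terms that differentiate the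
  power of z cancel, those that differentiate the power of its conjugate double, and s^2 = 1/2
  removes the 2. For an extra conjugate factor the roles are exchanged.\<close>

lemma wirtinger_moment_Suc:
  "wirtinger_moment (Suc p) q = of_nat q * wirtinger_moment p (q - 1)"
  "wirtinger_moment p (Suc q) = of_nat p * wirtinger_moment (p - 1) q"
proof -
  interpret G: prob_space real_gaussian by (rule prob_space_real_gaussian)
  interpret GG: pair_prob_space real_gaussian real_gaussian ..
  define s where "s = complex_of_real (1 / sqrt 2)"
  have s2: "s * s = 1 / 2" by (simp add: s_def flip: of_real_mult)
  define J where "J p q = wirtinger_moment p q" for p q
  define w where "w p q a b = wirtinger_power p q (gaussian_pair a b)" for p q a b
  have ga: "gaussian_pair a b = of_real a * s + \<i> * of_real b * s" "cnj (gaussian_pair a b) = of_real a * s + - (\<i> * of_real b * s)" for a b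
    by (auto simp: s_def Complex_eq field_simps)
  have gb: "gaussian_pair a b = of_real b * (\<i> * s) + of_real a * s" "cnj (gaussian_pair a b) = of_real b * (- \<i> * s) + of_real a * s" for a b
    by (auto simp: s_def Complex_eq field_simps)
  note int = integrable_wirtinger_power_pair[folded w_def]
  have int': "integrable (real_gaussian \<Otimes>\<^sub>M real_gaussian) (\<lambda>x. c * w p q (fst x) (snd x))" for c p q
    by (intro integrable_mult_right int)
  have J: "(\<integral>x. w p q (fst x) (snd x) \<partial>(real_gaussian \<Otimes>\<^sub>M real_gaussian)) = J p q" for p q
    unfolding J_def wirtinger_moment_pair w_def ..
  have A: "(\<integral>x. of_real (fst x) * w p q (fst x) (snd x) \<partial>(real_gaussian \<Otimes>\<^sub>M real_gaussian)) = s * (of_nat p * J (p - 1) q + of_nat q * J p (q - 1))"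
  proof -
    have inner: "(\<integral>a. of_real a * w p q a b \<partial>real_gaussian) =
        (\<integral>a. of_nat p * s * w (p - 1) q a b + of_nat q * s * w p (q - 1) a b \<partial>real_gaussian)" for b
      unfolding w_def wirtinger_power_def ga(2) unfolding ga(1) by (rule stein_wirtinger[OF refl])
    have i: "integrable (real_gaussian \<Otimes>\<^sub>M real_gaussian) (case_prod (\<lambda>a b. of_real a * w p q a b))"
      using int(2)[of p q] by (simp add: case_prod_beta')
    have i2: "integrable (real_gaussian \<Otimes>\<^sub>M real_gaussian) (case_prod (\<lambda>a b. of_nat p * s * w (p - 1) q a b + of_nat q * s * w p (q - 1) a b))"
      using Bochner_Integration.integrable_add[OF int'[of "of_nat p * s" "p - 1" q] int'[of "of_nat q * s" p "q - 1"]] by (simp add: case_prod_beta')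
    have "(\<integral>x. of_real (fst x) * w p q (fst x) (snd x) \<partial>(real_gaussian \<Otimes>\<^sub>M real_gaussian)) =
        (\<integral>b. (\<integral>a. of_real a * w p q a b \<partial>real_gaussian) \<partial>real_gaussian)"
      using GG.integral_snd[OF i] by (simp add: case_prod_beta')
    also have "\<dots> = (\<integral>b. (\<integral>a. of_nat p * s * w (p - 1) q a b + of_nat q * s * w p (q - 1) a b \<partial>real_gaussian) \<partial>real_gaussian)"
      by (simp only: inner)
    also have "\<dots> = (\<integral>x. of_nat p * s * w (p - 1) q (fst x) (snd x) + of_nat q * s * w p (q - 1) (fst x) (snd x) \<partial>(real_gaussian \<Otimes>\<^sub>M real_gaussian))"
      using GG.integral_snd[OF i2] by (simp add: case_prod_beta')
    also have "\<dots> = of_nat p * s * J (p - 1) q + of_nat q * s * J p (q - 1)"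
      by (subst Bochner_Integration.integral_add[OF int' int']) (simp add: J)
    finally show ?thesis by (simp add: algebra_simps)
  qed
  have B: "(\<integral>x. of_real (snd x) * w p q (fst x) (snd x) \<partial>(real_gaussian \<Otimes>\<^sub>M real_gaussian)) = \<i> * s * (of_nat p * J (p - 1) q - of_nat q * J p (q - 1))"
  proof -
    have inner: "(\<integral>b. of_real b * w p q a b \<partial>real_gaussian) =
        (\<integral>b. of_nat p * (\<i> * s) * w (p - 1) q a b + of_nat q * (- \<i> * s) * w p (q - 1) a b \<partial>real_gaussian)" for a
      unfolding w_def wirtinger_power_def gb(2) unfolding gb(1) by (rule stein_wirtinger[OF refl])
    have i: "integrable (real_gaussian \<Otimes>\<^sub>M real_gaussian) (case_prod (\<lambda>a b. of_real b * w p q a b))"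
      using int(3)[of p q] by (simp add: case_prod_beta')
    have i2: "integrable (real_gaussian \<Otimes>\<^sub>M real_gaussian) (case_prod (\<lambda>a b. of_nat p * (\<i> * s) * w (p - 1) q a b + of_nat q * (- \<i> * s) * w p (q - 1) a b))"
      using Bochner_Integration.integrable_add[OF int'[of "of_nat p * (\<i> * s)" "p - 1" q] int'[of "of_nat q * (- \<i> * s)" p "q - 1"]] by (simp add: case_prod_beta')
    have "(\<integral>x. of_real (snd x) * w p q (fst x) (snd x) \<partial>(real_gaussian \<Otimes>\<^sub>M real_gaussian)) =
        (\<integral>a. (\<integral>b. of_real b * w p q a b \<partial>real_gaussian) \<partial>real_gaussian)"
      using GG.integral_fst[OF i] by (simp add: case_prod_beta')
    also have "\<dots> = (\<integral>a. (\<integral>b. of_nat p * (\<i> * s) * w (p - 1) q a b + of_nat q * (- \<i> * s) * w p (q - 1) a b \<partial>real_gaussian) \<partial>real_gaussian)"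
      by (simp only: inner)
    also have "\<dots> = (\<integral>x. of_nat p * (\<i> * s) * w (p - 1) q (fst x) (snd x) + of_nat q * (- \<i> * s) * w p (q - 1) (fst x) (snd x) \<partial>(real_gaussian \<Otimes>\<^sub>M real_gaussian))"
      using GG.integral_fst[OF i2] by (simp add: case_prod_beta')
    also have "\<dots> = of_nat p * (\<i> * s) * J (p - 1) q + of_nat q * (- \<i> * s) * J p (q - 1)"
      by (subst Bochner_Integration.integral_add[OF int' int']) (simp add: J)
    finally show ?thesis by (simp add: algebra_simps)
  qed
  have "w (Suc p) q a b = s * (of_real a * w p q a b) + \<i> * s * (of_real b * w p q a b)" for a b
  proof -
    have "w (Suc p) q a b = gaussian_pair a b * w p q a b" by (simp add: w_def wirtinger_power_def)
    then show ?thesis unfolding ga(1) by (simp only: algebra_simps)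
  qed
  then have "J (Suc p) q = s * (s * (of_nat p * J (p - 1) q + of_nat q * J p (q - 1))) + \<i> * s * (\<i> * s * (of_nat p * J (p - 1) q - of_nat q * J p (q - 1)))"
    unfolding J[symmetric, of "Suc p"] A[symmetric] B[symmetric] using int(2)[of p q] int(3)[of p q]
    by simp
  also have "\<dots> = (s * s) * (2 * of_nat q * J p (q - 1))" by (simp add: algebra_simps)
  finally show "wirtinger_moment (Suc p) q = of_nat q * wirtinger_moment p (q - 1)" by (simp add: s2 J_def)
  have "w p (Suc q) a b = s * (of_real a * w p q a b) + - (\<i> * s) * (of_real b * w p q a b)" for a b
  proof -
    have "w p (Suc q) a b = cnj (gaussian_pair a b) * w p q a b" by (simp add: w_def wirtinger_power_def)
    then show ?thesis unfolding ga(2) by (simp add: algebra_simps)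
  qed
  then have "J p (Suc q) = s * (s * (of_nat p * J (p - 1) q + of_nat q * J p (q - 1))) + - (\<i> * s) * (\<i> * s * (of_nat p * J (p - 1) q - of_nat q * J p (q - 1)))"
    unfolding J[symmetric, of _ "Suc q"] A[symmetric] B[symmetric] using int(2)[of p q] int(3)[of p q]
    by simp
  also have "\<dots> = (s * s) * (2 * of_nat p * J (p - 1) q)" by (simp add: algebra_simps)
  finally show "wirtinger_moment p (Suc q) = of_nat p * wirtinger_moment (p - 1) q" by (simp add: s2 J_def)
qed

subsection \<open>The companion ensemble\<close>

lemma companion_equiv_indices: "companion_equiv k f p q \<Longrightarrow> p \<in> indices k \<Longrightarrow> q \<in> indices k"
  by (induction rule: companion_equiv_induct) auto

lemma companion_equiv_swap_iff: "companion_equiv k f (prod.swap p) (prod.swap q) \<longleftrightarrow> companion_equiv k f p q"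
  using companion_equiv_swap[of k f p q] companion_equiv_swap[of k f "prod.swap p" "prod.swap q"] by auto

text \<open>\<open>companion_equiv\<close> is invariant under simultaneous swaps, so all swaps on a
  path can be moved to its end, where they cancel in pairs.\<close>

lemma companion_swap_equiv_iff:
  assumes p: "p \<in> indices k"
  shows "companion_swap_equiv k f p q \<longleftrightarrow> companion_equiv k f p q \<or> companion_equiv k f p (prod.swap q)"
proof
  assume "companion_swap_equiv k f p q"
  then have "companion_equiv k f p q \<or> companion_equiv k f p (prod.swap q)"
    unfolding companion_swap_equiv_def
  proof (induction rule: equivclp_induct)
    case base
    show ?case by (simp add: companion_equiv_refl)
  next
    case (step y z)
    have "companion_equiv k f y z \<or> z = prod.swap y"
      using step(2) companion_equiv_sym swap_swap by metis
    then show ?case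
    proof
      assume yz: "companion_equiv k f y z"
      then have "companion_equiv k f (prod.swap y) (prod.swap z)" by (rule companion_equiv_swap)
      then show ?thesis using step(3) yz companion_equiv_trans by blast
    next
      assume "z = prod.swap y"
      then show ?thesis using step(3) by auto
    qed
  qed
  then show "companion_equiv k f p q \<or> companion_equiv k f p (prod.swap q)" .
next
  assume "companion_equiv k f p q \<or> companion_equiv k f p (prod.swap q)"
  then show "companion_swap_equiv k f p q"
  proof
    assume "companion_equiv k f p q"
    then show ?thesis unfolding companion_swap_equiv_def by (intro r_into_equivclp) simp
  next
    assume c: "companion_equiv k f p (prod.swap q)"
    then have "prod.swap q \<in> indices k" using companion_equiv_indices p by blast
    then have 1: "companion_swap_equiv k f (prod.swap q) (prod.swap (prod.swap q))"
      unfolding companion_swap_equiv_def by (intro r_into_equivclp disjI2 conjI refl)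
    have 2: "companion_swap_equiv k f p (prod.swap q)"
      using c unfolding companion_swap_equiv_def by (intro r_into_equivclp disjI1)
    show ?thesis
      using equivclp_trans[OF 2[unfolded companion_swap_equiv_def] 1[unfolded companion_swap_equiv_def]]
      unfolding companion_swap_equiv_def swap_swap .
  qed
qed

locale companion =
  fixes k :: nat and f :: "nat \<Rightarrow> nat \<Rightarrow> nat"
begin

abbreviation related (infix "\<asymp>" 50) where "p \<asymp> q \<equiv> companion_equiv k f p q"

definition cclass :: "nat \<times> nat \<Rightarrow> (nat \<times> nat) set" where
  "cclass p = equiv_class (companion_swap_equiv k f) p"

definition rep :: "nat \<times> nat \<Rightarrow> nat \<times> nat" where
  "rep p = representative (cclass p)"

definition law :: "(nat \<times> nat) set \<Rightarrow> complex measure" where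
  "law C = (if forced_real k f (representative C)
    then distr real_gaussian borel complex_of_real else complex_gaussian)"

text \<open>The entry at \<open>q\<close> is the conjugate of the entry at \<open>p\<close>. Exactly
  then the product of the two entries, without conjugation, has mean 1; otherwise it has mean
  0.\<close>

definition covariant :: "nat \<times> nat \<Rightarrow> nat \<times> nat \<Rightarrow> bool" where
  "covariant p q \<longleftrightarrow> p \<asymp> prod.swap q"

lemma related_sym: "p \<asymp> q \<longleftrightarrow> q \<asymp> p"
  using companion_equiv_sym by blast

lemma related_trans: "p \<asymp> q \<Longrightarrow> q \<asymp> r \<Longrightarrow> p \<asymp> r"
  by (rule companion_equiv_trans)

lemma related_swap: "prod.swap p \<asymp> q \<longleftrightarrow> p \<asymp> prod.swap q"
  using companion_equiv_swap_iff[of k f p "prod.swap q"] by simp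

lemma cclass_eq: 
  assumes "p \<in> indices k"
  shows "cclass p = {q. p \<asymp> q \<or> p \<asymp> prod.swap q}"
  unfolding cclass_def equiv_class_def using companion_swap_equiv_iff[OF assms] by auto

lemma cclass_eq_iff:
  assumes "p \<in> indices k" "q \<in> indices k"
  shows "cclass p = cclass q \<longleftrightarrow> p \<asymp> q \<or> p \<asymp> prod.swap q"
proof
  assume "cclass p = cclass q"
  moreover have "q \<in> cclass q" by (simp add: cclass_eq[OF assms(2)] companion_equiv_refl)
  ultimately have "q \<in> cclass p" by simp
  then show "p \<asymp> q \<or> p \<asymp> prod.swap q" by (simp add: cclass_eq[OF assms(1)])
next
  assume "p \<asymp> q \<or> p \<asymp> prod.swap q"
  then show "cclass p = cclass q"
    unfolding cclass_def equiv_class_def companion_swap_equiv_iff[OF assms(1), symmetric]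
    unfolding companion_swap_equiv_def by (auto intro: equivclp_trans equivclp_sym)
qed

lemma rep_related:
  assumes "p \<in> indices k"
  shows "rep p \<asymp> p \<or> rep p \<asymp> prod.swap p"
proof -
  have "p \<in> cclass p" by (simp add: cclass_eq[OF assms] companion_equiv_refl)
  then have "rep p \<in> cclass p" unfolding rep_def representative_def by (rule someI)
  then have "p \<asymp> rep p \<or> p \<asymp> prod.swap (rep p)" unfolding cclass_eq[OF assms] by blast
  then show ?thesis using related_sym related_swap by metis
qed

lemma forced_real_rep:
  assumes "p \<in> indices k"
  shows "forced_real k f (rep p) \<longleftrightarrow> forced_real k f p"
proof -
  have *: "forced_real k f q" if "r \<asymp> q" "forced_real k f r" for r q
    using that related_trans related_sym companion_equiv_swap[OF that(1)] by blast
  have **: "forced_real k f (prod.swap q) \<longleftrightarrow> forced_real k f q" for q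
    using related_sym by auto
  show ?thesis using rep_related[OF assms] * ** related_sym by metis
qed

text \<open>The entry at \<open>p\<close> as a function of the single value drawn for its class with
  representative \<open>r\<close>; the entries of a class thus become functions of one
  variable.\<close>

definition val :: "nat \<times> nat \<Rightarrow> nat \<times> nat \<Rightarrow> complex \<Rightarrow> complex" where
  "val r p z = (if forced_real k f r then complex_of_real (Re z) else if r \<asymp> p then z else cnj z)"

lemma companion_entry_val:
  "p \<in> indices k \<Longrightarrow> companion_entry k f x p = val (rep p) p (x (cclass p))"
  unfolding companion_entry_def val_def Let_def using forced_real_rep[of p]
  by (simp add: cclass_def[symmetric] rep_def[symmetric])

lemma hermitian_companion_entry:
  assumes p: "p \<in> indices k"
  shows "companion_entry k f x (prod.swap p) = cnj (companion_entry k f x p)"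
proof -
  have p': "prod.swap p \<in> indices k" using p by auto
  have c: "cclass (prod.swap p) = cclass p"
    unfolding cclass_eq_iff[OF p' p] by (simp add: companion_equiv_refl)
  then have r: "rep (prod.swap p) = rep p" by (simp add: rep_def)
  show ?thesis
  proof (cases "forced_real k f (rep p)")
    case True
    then show ?thesis by (simp add: companion_entry_val[OF p] companion_entry_val[OF p'] c r val_def)
  next
    case False
    \<comment> \<open>Both relations together would force the class to be real, and at least one
      holds by \<open>rep_related\<close>.\<close>
    have "rep p \<asymp> prod.swap p \<longleftrightarrow> \<not> rep p \<asymp> p"
      using rep_related[OF p] False related_trans related_sym companion_equiv_swap by (metis swap_swap)
    then show ?thesis using False by (simp add: companion_entry_val[OF p] companion_entry_val[OF p'] c r val_def)
  qed
qed

lemma prob_space_law: "prob_space (law C)"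
  unfolding law_def
  by (auto intro!: prob_space_complex_gaussian prob_space.prob_space_distr[OF prob_space_real_gaussian])

lemma sets_law [simp, measurable_cong]: "sets (law C) = sets borel"
  by (simp add: law_def)

lemma companion_base_eq: "companion_base k f = Pi\<^sub>M (cclass ` indices k) law"
  unfolding companion_base_def law_def cclass_def[abs_def] ..

lemma val_measurable [measurable]: "val r p \<in> borel_measurable borel"
  unfolding val_def by (cases "forced_real k f r"; cases "r \<asymp> p")
    (auto intro!: borel_measurable_continuous_onI continuous_intros)

definition class_moment :: "nat \<times> nat \<Rightarrow> (nat \<Rightarrow> nat \<times> nat) \<Rightarrow> nat set \<Rightarrow> complex" where
  "class_moment r e A = (\<integral>z. (\<Prod>s\<in>A. val r (e s) z)
     \<partial>(if forced_real k f r then distr real_gaussian borel complex_of_real else complex_gaussian))"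

lemma prod_val_unforced:
  assumes "finite A" "\<not> forced_real k f r"
  shows "(\<Prod>s\<in>A. val r (e s) z) = wirtinger_power (card {s\<in>A. r \<asymp> e s}) (card {s\<in>A. \<not> r \<asymp> e s}) z"
proof -
  have "(\<Prod>s\<in>A. val r (e s) z) = (\<Prod>s\<in>{s\<in>A. r \<asymp> e s} \<union> {s\<in>A. \<not> r \<asymp> e s}. val r (e s) z)"
    by (intro prod.cong) auto
  also have "\<dots> = (\<Prod>s\<in>{s\<in>A. r \<asymp> e s}. val r (e s) z) * (\<Prod>s\<in>{s\<in>A. \<not> r \<asymp> e s}. val r (e s) z)"
    using assms by (intro prod.union_disjoint) auto
  also have "(\<Prod>s\<in>{s\<in>A. r \<asymp> e s}. val r (e s) z) = (\<Prod>s\<in>{s\<in>A. r \<asymp> e s}. z)"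
    using assms by (intro prod.cong) (auto simp: val_def)
  also have "(\<Prod>s\<in>{s\<in>A. \<not> r \<asymp> e s}. val r (e s) z) = (\<Prod>s\<in>{s\<in>A. \<not> r \<asymp> e s}. cnj z)"
    using assms by (intro prod.cong) (auto simp: val_def)
  finally show ?thesis by (simp add: wirtinger_power_def)
qed

lemma measurable_of_real_gaussian: "complex_of_real \<in> measurable real_gaussian borel"
  by measurable

lemma integrable_prod_val:
  assumes "finite A"
  shows "integrable (if forced_real k f r then distr real_gaussian borel complex_of_real else complex_gaussian)
    (\<lambda>z. \<Prod>s\<in>A. val r (e s) z)"
proof (cases "forced_real k f r")
  case True
  then show ?thesis
    by (simp add: val_def integrable_distr_eq[OF measurable_of_real_gaussian]
        integrable_real_gaussian_of_real_power)
next
  case False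
  then show ?thesis using integrable_wirtinger_power by (simp add: prod_val_unforced[OF assms False])
qed

text \<open>Wick recursion inside one class. If the class is real, any two of its entries are
  covariant and the recursion is that of the real Gaussian moments. Otherwise each entry is z or its
  conjugate, entries of different kind are the covariant ones, and
  \<open>wirtinger_moment_Suc\<close> counts those of the kind opposite to
  \<open>e a\<close>.\<close>

lemma class_moment_insert:
  assumes A: "finite A" "a \<notin> A" and rel: "\<And>s. s \<in> insert a A \<Longrightarrow> r \<asymp> e s \<or> r \<asymp> prod.swap (e s)"
  shows "class_moment r e (insert a A) = (\<Sum>s\<in>A. of_bool (covariant (e a) (e s)) * class_moment r e (A - {s}))"
proof (cases "forced_real k f r")
  case True
  have m: "class_moment r e S = of_real (\<integral>x. x ^ card S \<partial>real_gaussian)" for S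
  proof -
    have "class_moment r e S = (\<integral>z. of_real (Re z) ^ card S \<partial>distr real_gaussian borel complex_of_real)"
      using True by (simp add: class_moment_def val_def)
    also have "\<dots> = (\<integral>x. of_real (x ^ card S) \<partial>real_gaussian)"
      by (subst integral_distr[OF measurable_of_real_gaussian]) auto
    finally show ?thesis by (simp only: integral_complex_of_real)
  qed
  have "covariant (e a) (e s)" if "s \<in> A" for s
  proof -
    have "r \<asymp> e a" "r \<asymp> prod.swap (e s)"
      using rel[of a] rel[of s] that True related_trans related_sym companion_equiv_swap by (metis insertCI swap_swap)+
    then show ?thesis unfolding covariant_def using related_sym related_trans by blast
  qed
  then have "(\<Sum>s\<in>A. of_bool (covariant (e a) (e s)) * class_moment r e (A - {s})) =
      (\<Sum>s\<in>A. of_real (\<integral>x. x ^ (card A - 1) \<partial>real_gaussian))"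
    using A by (intro sum.cong refl) (simp add: m)
  also have "\<dots> = of_real (real (card A) * (\<integral>x. x ^ (card A - 1) \<partial>real_gaussian))" by simp
  also have "\<dots> = class_moment r e (insert a A)"
    unfolding m card_insert_disjoint[OF A] real_gaussian_moment ..
  finally show ?thesis ..
next
  case False
  define p q where "p S = card {s\<in>S. r \<asymp> e s}" and "q S = card {s\<in>S. \<not> r \<asymp> e s}" for S
  have m: "class_moment r e S = wirtinger_moment (p S) (q S)" if "finite S" for S
    using False by (simp add: class_moment_def prod_val_unforced[OF that False] wirtinger_moment_def p_def q_def)
  have sw: "r \<asymp> prod.swap (e s) \<longleftrightarrow> \<not> r \<asymp> e s" if "s \<in> insert a A" for s
    using rel[OF that] False related_trans related_sym companion_equiv_swap by (metis swap_swap)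
  have cov: "covariant (e a) (e s) \<longleftrightarrow> (r \<asymp> e a \<longleftrightarrow> \<not> r \<asymp> e s)" if "s \<in> A" for s
  proof (cases "r \<asymp> e a")
    case True
    then have "covariant (e a) (e s) \<longleftrightarrow> r \<asymp> prod.swap (e s)"
      unfolding covariant_def using related_trans related_sym by blast
    then show ?thesis using sw[of s] that True by simp
  next
    case F: False
    then have "prod.swap r \<asymp> e a" using sw[of a] related_swap by simp
    then have "covariant (e a) (e s) \<longleftrightarrow> prod.swap r \<asymp> prod.swap (e s)"
      unfolding covariant_def using related_trans related_sym by blast
    then show ?thesis using F companion_equiv_swap_iff by simp
  qed
  show ?thesis
  proof (cases "r \<asymp> e a")
    case True
    have p1: "p (insert a A) = Suc (p A)"
    proof -
      have "{s\<in>insert a A. r \<asymp> e s} = insert a {s\<in>A. r \<asymp> e s}" using True by auto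
      then show ?thesis using A by (simp add: p_def)
    qed
    have q1: "q (insert a A) = q A"
    proof -
      have "{s\<in>insert a A. \<not> r \<asymp> e s} = {s\<in>A. \<not> r \<asymp> e s}" using True by auto
      then show ?thesis by (simp add: q_def)
    qed
    have "(\<Sum>s\<in>A. of_bool (covariant (e a) (e s)) * class_moment r e (A - {s})) =
        (\<Sum>s\<in>{s\<in>A. \<not> r \<asymp> e s}. class_moment r e (A - {s}))"
      using A True cov by (intro sum.mono_neutral_cong_right) auto
    also have "\<dots> = (\<Sum>s\<in>{s\<in>A. \<not> r \<asymp> e s}. wirtinger_moment (p A) (q A - 1))"
    proof (rule sum.cong[OF refl])
      fix s assume s: "s \<in> {s\<in>A. \<not> r \<asymp> e s}"
      have "{t\<in>A - {s}. r \<asymp> e t} = {t\<in>A. r \<asymp> e t}" "{t\<in>A - {s}. \<not> r \<asymp> e t} = {t\<in>A. \<not> r \<asymp> e t} - {s}"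
        using s by auto
      then show "class_moment r e (A - {s}) = wirtinger_moment (p A) (q A - 1)"
        using A s by (simp add: m p_def q_def)
    qed
    also have "\<dots> = of_nat (q A) * wirtinger_moment (p A) (q A - 1)" by (simp add: q_def)
    also have "\<dots> = class_moment r e (insert a A)"
      using A by (simp add: m p1 q1 wirtinger_moment_Suc)
    finally show ?thesis ..
  next
    case F: False
    have q1: "q (insert a A) = Suc (q A)"
    proof -
      have "{s\<in>insert a A. \<not> r \<asymp> e s} = insert a {s\<in>A. \<not> r \<asymp> e s}" using F by auto
      then show ?thesis using A by (simp add: q_def)
    qed
    have p1: "p (insert a A) = p A"
    proof -
      have "{s\<in>insert a A. r \<asymp> e s} = {s\<in>A. r \<asymp> e s}" using F by auto
      then show ?thesis by (simp add: p_def)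
    qed
    have "(\<Sum>s\<in>A. of_bool (covariant (e a) (e s)) * class_moment r e (A - {s})) =
        (\<Sum>s\<in>{s\<in>A. r \<asymp> e s}. class_moment r e (A - {s}))"
      using A F cov by (intro sum.mono_neutral_cong_right) auto
    also have "\<dots> = (\<Sum>s\<in>{s\<in>A. r \<asymp> e s}. wirtinger_moment (p A - 1) (q A))"
    proof (rule sum.cong[OF refl])
      fix s assume s: "s \<in> {s\<in>A. r \<asymp> e s}"
      have "{t\<in>A - {s}. \<not> r \<asymp> e t} = {t\<in>A. \<not> r \<asymp> e t}" "{t\<in>A - {s}. r \<asymp> e t} = {t\<in>A. r \<asymp> e t} - {s}"
        using s by auto
      then show "class_moment r e (A - {s}) = wirtinger_moment (p A - 1) (q A)"
        using A s by (simp add: m p_def q_def)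
    qed
    also have "\<dots> = of_nat (p A) * wirtinger_moment (p A - 1) (q A)" by (simp add: p_def)
    also have "\<dots> = class_moment r e (insert a A)"
      using A by (simp add: m p1 q1 wirtinger_moment_Suc)
    finally show ?thesis ..
  qed
qed

definition companion_moment :: "(nat \<Rightarrow> nat \<times> nat) \<Rightarrow> nat set \<Rightarrow> complex" where
  "companion_moment e A = (\<integral>x. (\<Prod>s\<in>A. companion_entry k f x (e s)) \<partial>companion_base k f)"

lemma companion_product_by_classes:
  assumes A: "finite A" "\<And>s. s \<in> A \<Longrightarrow> e s \<in> indices k"
  shows "(\<lambda>x. \<Prod>s\<in>A. companion_entry k f x (e s)) =
    (\<lambda>x. \<Prod>C\<in>cclass ` indices k. \<Prod>s\<in>{s\<in>A. cclass (e s) = C}. val (representative C) (e s) (x C))"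
proof
  fix x
  have "(\<Prod>C\<in>cclass ` indices k. \<Prod>s\<in>{s\<in>A. cclass (e s) = C}. val (representative C) (e s) (x C)) =
      (\<Prod>C\<in>cclass ` indices k. \<Prod>s\<in>{s\<in>A. cclass (e s) = C}. companion_entry k f x (e s))"
    using A by (intro prod.cong refl) (auto simp: companion_entry_val rep_def)
  also have "\<dots> = (\<Prod>s\<in>A. companion_entry k f x (e s))"
    using A by (intro prod.group) auto
  finally show "(\<Prod>s\<in>A. companion_entry k f x (e s)) =
    (\<Prod>C\<in>cclass ` indices k. \<Prod>s\<in>{s\<in>A. cclass (e s) = C}. val (representative C) (e s) (x C))" ..
qed

sublocale product_law: product_prob_space law UNIV
proof -
  have "prob_space (law C)" for C by (rule prob_space_law)
  then show "product_prob_space law" by (rule product_prob_spaceI)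
qed

lemma companion_integrable:
  assumes A: "finite A" "\<And>s. s \<in> A \<Longrightarrow> e s \<in> indices k"
  shows "integrable (companion_base k f) (\<lambda>x. \<Prod>s\<in>A. companion_entry k f x (e s))"
proof -
  have int: "integrable (law C) (\<lambda>z. \<Prod>s\<in>{s\<in>A. cclass (e s) = C}. val (representative C) (e s) z)" for C
    unfolding law_def by (rule integrable_prod_val, rule finite_subset[OF _ A(1)]) blast
  have "integrable (Pi\<^sub>M (cclass ` indices k) law)
      (\<lambda>x. \<Prod>C\<in>cclass ` indices k. \<Prod>s\<in>{s\<in>A. cclass (e s) = C}. val (representative C) (e s) (x C))"
    by (intro product_law.product_integrable_prod int) auto
  moreover have "(\<lambda>x. \<Prod>s\<in>A. companion_entry k f x (e s)) = (\<lambda>x. \<Prod>C\<in>cclass ` indices k.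
      \<Prod>s\<in>{s\<in>A. cclass (e s) = C}. val (representative C) (e s) (x C))"
    using A by (rule companion_product_by_classes)
  ultimately show ?thesis by (simp only: companion_base_eq)
qed

lemma companion_moment_by_classes:
  assumes A: "finite A" "\<And>s. s \<in> A \<Longrightarrow> e s \<in> indices k"
  shows "companion_moment e A = (\<Prod>C\<in>cclass ` indices k. class_moment (representative C) e {s\<in>A. cclass (e s) = C})"
proof -
  have int: "integrable (law C) (\<lambda>z. \<Prod>s\<in>{s\<in>A. cclass (e s) = C}. val (representative C) (e s) z)" for C
    unfolding law_def by (rule integrable_prod_val, rule finite_subset[OF _ A(1)]) blast
  have "(\<lambda>x. \<Prod>s\<in>A. companion_entry k f x (e s)) = (\<lambda>x. \<Prod>C\<in>cclass ` indices k.
      \<Prod>s\<in>{s\<in>A. cclass (e s) = C}. val (representative C) (e s) (x C))"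
    using A by (rule companion_product_by_classes)
  then have "companion_moment e A = (\<integral>x. (\<Prod>C\<in>cclass ` indices k.
      \<Prod>s\<in>{s\<in>A. cclass (e s) = C}. val (representative C) (e s) (x C)) \<partial>Pi\<^sub>M (cclass ` indices k) law)"
    by (simp only: companion_moment_def companion_base_eq)
  also have "\<dots> = (\<Prod>C\<in>cclass ` indices k. \<integral>z. (\<Prod>s\<in>{s\<in>A. cclass (e s) = C}. val (representative C) (e s) z) \<partial>law C)"
    by (intro product_law.product_integral_prod int) auto
  finally show ?thesis by (simp only: class_moment_def law_def)
qed

text \<open>The moment is a product over the classes. Only the factor of the class of
  \<open>e a\<close> changes, and there \<open>class_moment_insert\<close> applies; entries of other
  classes are not covariant with \<open>e a\<close>, so their terms in the sum vanish.\<close>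

lemma wick:
  assumes A: "finite A" "a \<notin> A" "\<And>s. s \<in> insert a A \<Longrightarrow> e s \<in> indices k"
  shows "companion_moment e (insert a A) = (\<Sum>s\<in>A. of_bool (covariant (e a) (e s)) * companion_moment e (A - {s}))"
proof -
  define C where "C = cclass (e a)"
  define \<C> where "\<C> = cclass ` indices k"
  define m where "m D S = class_moment (representative D) e {s\<in>S. cclass (e s) = D}" for D S
  have C: "C \<in> \<C>" "finite \<C>" using A by (auto simp: C_def \<C>_def)
  have mom: "companion_moment e S = m C S * (\<Prod>D\<in>\<C> - {C}. m D S)" if "S \<subseteq> insert a A" for S
  proof -
    have "finite S" using that A finite_subset by blast
    then show ?thesis using that A C companion_moment_by_classes[of S e] prod.remove[OF C(2,1), of "\<lambda>D. m D S"]
      unfolding m_def \<C>_def by auto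
  qed
  define A1 where "A1 = {s\<in>A. cclass (e s) = C}"
  have rest: "(\<Prod>D\<in>\<C> - {C}. m D S) = (\<Prod>D\<in>\<C> - {C}. m D A)" if "S - {s. cclass (e s) = C} = A - {s. cclass (e s) = C}" for S
    unfolding m_def by (intro prod.cong refl arg_cong[where f = "class_moment _ _"]) (use that in auto)
  have "m C (insert a A) = class_moment (representative C) e (insert a A1)"
    unfolding m_def by (intro arg_cong[where f = "class_moment _ _"]) (auto simp: A1_def C_def)
  also have "\<dots> = (\<Sum>s\<in>A1. of_bool (covariant (e a) (e s)) * class_moment (representative C) e (A1 - {s}))"
  proof (rule class_moment_insert)
    show "finite A1" "a \<notin> A1" using A by (auto simp: A1_def)
    fix s assume "s \<in> insert a A1"
    then have "e s \<in> indices k" "cclass (e s) = C" using A by (auto simp: A1_def C_def)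
    then show "representative C \<asymp> e s \<or> representative C \<asymp> prod.swap (e s)"
      using rep_related[of "e s"] by (simp add: rep_def)
  qed
  finally have "companion_moment e (insert a A) =
      (\<Sum>s\<in>A1. of_bool (covariant (e a) (e s)) * (class_moment (representative C) e (A1 - {s}) * (\<Prod>D\<in>\<C> - {C}. m D A)))"
    unfolding mom[OF order_refl] by (subst rest) (auto simp: C_def sum_distrib_right mult.assoc)
  also have "\<dots> = (\<Sum>s\<in>A1. of_bool (covariant (e a) (e s)) * companion_moment e (A - {s}))"
  proof (rule sum.cong[OF refl])
    fix s assume s: "s \<in> A1"
    have "{t\<in>A - {s}. cclass (e t) = C} = A1 - {s}" by (auto simp: A1_def)
    then have "m C (A - {s}) = class_moment (representative C) e (A1 - {s})" by (simp add: m_def)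
    moreover have "(\<Prod>D\<in>\<C> - {C}. m D (A - {s})) = (\<Prod>D\<in>\<C> - {C}. m D A)"
      using s by (intro rest) (auto simp: A1_def)
    moreover have "A - {s} \<subseteq> insert a A" by auto
    ultimately show "of_bool (covariant (e a) (e s)) * (class_moment (representative C) e (A1 - {s}) * (\<Prod>D\<in>\<C> - {C}. m D A))
        = of_bool (covariant (e a) (e s)) * companion_moment e (A - {s})"
      using mom by simp
  qed
  also have "\<dots> = (\<Sum>s\<in>A. of_bool (covariant (e a) (e s)) * companion_moment e (A - {s}))"
  proof (rule sum.mono_neutral_left)
    show "\<forall>s\<in>A - A1. of_bool (covariant (e a) (e s)) * companion_moment e (A - {s}) = 0"
    proof
      fix s assume s: "s \<in> A - A1"
      then have "cclass (e a) \<noteq> cclass (e s)" by (auto simp: A1_def C_def)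
      then have "\<not> covariant (e a) (e s)"
        using cclass_eq_iff[of "e a" "e s"] A s by (auto simp: covariant_def)
      then show "of_bool (covariant (e a) (e s)) * companion_moment e (A - {s}) = 0" by simp
    qed
  qed (use A in \<open>auto simp: A1_def\<close>)
  finally show ?thesis .
qed

lemma companion_moment_empty: "companion_moment e {} = 1"
proof -
  interpret prob_space "companion_base k f"
    unfolding companion_base_eq by (rule prob_space_PiM) (rule prob_space_law)
  show ?thesis by (simp add: companion_moment_def prob_space)
qed

end

subsection \<open>Block discrete Fourier transform\<close>

text \<open>Each list holds the steps of a walk from \<open>i\<close> to \<open>j\<close>, the last
  step first; the order is immaterial for the product of the entries.\<close>

primrec walks :: "nat \<Rightarrow> nat \<Rightarrow> nat \<Rightarrow> nat \<Rightarrow> (nat \<times> nat) list list" where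
  "walks k 0 i j = (if i = j then [[]] else [])"
| "walks k (Suc m) i j = concat (map (\<lambda>p. map ((#) (p, j)) (walks k m i p)) [0..<k])"

lemma walks_props:
  "i < k \<Longrightarrow> j < k \<Longrightarrow> L \<in> set (walks k m i j) \<Longrightarrow> length L = m \<and> set L \<subseteq> indices k"
proof (induction m arbitrary: j L)
  case (Suc m)
  from Suc.prems(3) obtain p L' where p: "p < k" "L' \<in> set (walks k m i p)" "L = (p, j) # L'" by auto
  with Suc.IH[OF Suc.prems(1) p(1,2)] Suc.prems(2) show ?case by simp
qed (simp split: if_splits)

lemma sum_list_map_concat: "(\<Sum>x\<leftarrow>concat xss. g x) = (\<Sum>xs\<leftarrow>xss. \<Sum>x\<leftarrow>xs. g x :: 'a :: comm_monoid_add)"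
  by (induction xss) auto

lemma length_walks: "length (walks k m i j) \<le> k ^ m"
proof (induction m arbitrary: j)
  case (Suc m)
  have "length (walks k (Suc m) i j) = (\<Sum>p<k. length (walks k m i p))"
    by (simp add: length_concat sum_list_sum_nth atLeast0LessThan)
  also have "\<dots> \<le> (\<Sum>p<k. k ^ m)" by (intro sum_mono Suc)
  finally show ?case by simp
qed auto

lemma entry_power_walks:
  fixes c :: "nat \<times> nat \<Rightarrow> 'a :: comm_ring_1"
  shows "entry_power k c m i j = (\<Sum>L\<leftarrow>walks k m i j. \<Prod>e\<leftarrow>L. c e)"
proof (induction m arbitrary: j)
  case (Suc m)
  have "(\<Sum>L\<leftarrow>walks k (Suc m) i j. \<Prod>e\<leftarrow>L. c e) = (\<Sum>p\<leftarrow>[0..<k]. \<Sum>L\<leftarrow>walks k m i p. c (p, j) * (\<Prod>e\<leftarrow>L. c e))"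
    by (simp add: sum_list_map_concat o_def)
  also have "\<dots> = (\<Sum>p<k. c (p, j) * entry_power k c m i p)"
    by (simp add: Suc sum_list_const_mult interv_sum_list_conv_sum_set_nat atLeast0LessThan)
  finally show ?case by (simp add: mult.commute)
qed auto

definition closed_walks :: "nat \<Rightarrow> nat \<Rightarrow> (nat \<times> nat) list list" where
  "closed_walks k m = concat (map (\<lambda>l. walks k m l l) [0..<k])"

lemma closed_walks_props: "L \<in> set (closed_walks k m) \<Longrightarrow> length L = m \<and> set L \<subseteq> indices k"
proof -
  assume "L \<in> set (closed_walks k m)"
  then obtain l where "l < k" "L \<in> set (walks k m l l)" by (auto simp: closed_walks_def)
  then show ?thesis using walks_props by blast
qed

lemma length_closed_walks: "length (closed_walks k m) \<le> k * k ^ m"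
proof -
  have "length (closed_walks k m) = (\<Sum>l<k. length (walks k m l l))"
    by (simp add: closed_walks_def length_concat sum_list_sum_nth atLeast0LessThan)
  also have "\<dots> \<le> (\<Sum>l<k. k ^ m)" by (intro sum_mono length_walks)
  finally show ?thesis by simp
qed

lemma power_trace_walks:
  "power_trace k c m = (\<Sum>i<length (closed_walks k m). \<Prod>s<m. c (closed_walks k m ! i ! s))"
proof -
  have "power_trace k c m = (\<Sum>L\<leftarrow>closed_walks k m. \<Prod>e\<leftarrow>L. c e)"
    unfolding power_trace_def entry_power_walks closed_walks_def
    by (simp add: sum_list_map_concat o_def interv_sum_list_conv_sum_set_nat atLeast0LessThan)
  also have "\<dots> = (\<Sum>i<length (closed_walks k m). \<Prod>e\<leftarrow>closed_walks k m ! i. c e)"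
    by (simp add: sum_list_sum_nth atLeast0LessThan)
  also have "\<dots> = (\<Sum>i<length (closed_walks k m). \<Prod>s<m. c (closed_walks k m ! i ! s))"
  proof (intro sum.cong refl)
    fix i assume "i \<in> {..<length (closed_walks k m)}"
    then have "length (closed_walks k m ! i) = m" using closed_walks_props[of _ k m] nth_mem by blast
    then show "(\<Prod>e\<leftarrow>closed_walks k m ! i. c e) = (\<Prod>s<m. c (closed_walks k m ! i ! s))"
      by (simp add: prod.list_conv_set_nth atLeast0LessThan)
  qed
  finally show ?thesis .
qed

section \<open>Block circulant matrices and their Fourier blocks\<close>

context periodic_link
begin

definition shift :: "nat \<Rightarrow> nat" where "shift i = (i + k) mod N"

definition block_circulant :: "(nat \<times> nat \<Rightarrow> complex) \<Rightarrow> bool" where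
  "block_circulant B \<longleftrightarrow> (\<forall>i<N. \<forall>j<N. B (shift i, shift j) = B (i, j))"

text \<open>Only the first block row of \<open>B\<close> enters, as it determines a block circulant
  matrix. The phase depends on the full offset c - l and not on the block number alone; this
  conjugates the usual block transform by a diagonal unitary and suits the classes, which are
  described by offsets.\<close>

definition dft :: "nat \<Rightarrow> (nat \<times> nat \<Rightarrow> complex) \<Rightarrow> nat \<times> nat \<Rightarrow> complex" where
  "dft \<theta> B = (\<lambda>(l, j). \<Sum>c\<in>columns j. B (l, c) * phase N \<theta> (int c - int l))"

lemma shift_less: "shift i < N"
  using N by (simp add: shift_def)

lemma shift_mod: "shift i mod k = i mod k"
  using N by (simp add: shift_def mod_mod_cancel)

lemma inj_on_shift: "inj_on shift {..<N}"
proof (rule inj_onI)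
  fix x y assume "x \<in> {..<N}" "y \<in> {..<N}" "shift x = shift y"
  then have "[x + k = y + k] (mod N)" "x < N" "y < N" by (auto simp: shift_def cong_def)
  then show "x = y" by (metis cong_add_rcancel_nat cong_def mod_less)
qed

lemma bij_shift: "bij_betw shift {..<N} {..<N}"
proof -
  have "shift ` {..<N} \<subseteq> {..<N}" using shift_less by auto
  then have "shift ` {..<N} = {..<N}" using endo_inj_surj[OF _ _ inj_on_shift] by blast
  then show ?thesis using inj_on_shift by (simp add: bij_betw_def)
qed

lemma bij_shift_columns: "bij_betw shift (columns j) (columns j)"
proof -
  have inj: "inj_on shift (columns j)" by (rule inj_on_subset[OF inj_on_shift]) (auto simp: columns_def)
  have "shift ` columns j \<subseteq> columns j" using shift_less shift_mod by (auto simp: columns_def)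
  then have "shift ` columns j = columns j" using endo_inj_surj[OF finite_columns _ inj] by blast
  then show ?thesis using inj by (simp add: bij_betw_def)
qed

lemma shift_invariant:
  assumes g: "\<And>p. p < N \<Longrightarrow> g (shift p) = g p" and p: "p < N"
  shows "g p = g (p mod k)"
proof -
  have "g (q + k * r) = g q" if "q < k" "q + k * r < N" for q r
    using that
  proof (induction r)
    case (Suc r)
    then have "q + k * r < N" by simp
    moreover have "shift (q + k * r) = q + k * Suc r" using Suc.prems by (simp add: shift_def algebra_simps)
    ultimately show ?case using Suc g[of "q + k * r"] by simp
  qed simp
  from this[of "p mod k" "p div k"] show ?thesis using k p by simp
qed

lemma sum_by_residues: "(\<Sum>p<N. F p) = (\<Sum>q<k. \<Sum>p\<in>columns q. F p)"
proof -
  have "(\<Sum>q<k. \<Sum>p\<in>columns q. F p) = (\<Sum>q<k. \<Sum>p\<in>{p \<in> {..<N}. p mod k = q}. F p)"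
    by (intro sum.cong refl) (auto simp: columns_def)
  also have "\<dots> = (\<Sum>p<N. F p)" using k by (intro sum.group) auto
  finally show ?thesis ..
qed

lemma phase_shift: "phase N \<theta> (int (shift c) - int (shift p)) = phase N \<theta> (int c - int p)"
proof (rule phase_cong)
  have "[int (shift i) = int i + int k] (mod int N)" for i
    by (simp add: shift_def zmod_int cong_def)
  then have "[int (shift c) - int (shift p) = (int c + int k) - (int p + int k)] (mod int N)"
    by (intro cong_diff)
  then show "[int (shift c) - int (shift p) = int c - int p] (mod int N)" by simp
qed (rule N)

text \<open>The offset splits as c - l = (p - l) + (c - p), and with it the phase. The inner sum
  \<open>g p\<close> depends on \<open>p mod k\<close> only, since both \<open>B\<close> and the
  phase are invariant under a common shift, so the sum over \<open>p\<close> factorises along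
  residues.\<close>

lemma dft_mult:
  assumes B: "block_circulant B" and lj: "l < k" "j < k"
  shows "dft \<theta> (\<lambda>(i, j). \<Sum>p<N. A (i, p) * B (p, j)) (l, j) = (\<Sum>q<k. dft \<theta> A (l, q) * dft \<theta> B (q, j))"
proof -
  define g where "g p = (\<Sum>c\<in>columns j. B (p, c) * phase N \<theta> (int c - int p))" for p
  have "g (shift p) = g p" if "p < N" for p
  proof -
    have "g (shift p) = (\<Sum>c\<in>columns j. B (shift p, shift c) * phase N \<theta> (int (shift c) - int (shift p)))"
      unfolding g_def by (rule sum.reindex_bij_betw[OF bij_shift_columns, symmetric])
    also have "\<dots> = g p"
      unfolding g_def phase_shift using B that by (intro sum.cong refl) (auto simp: block_circulant_def columns_def)
    finally show ?thesis .
  qed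
  then have g: "g p = g (p mod k)" if "p < N" for p using shift_invariant[of g p] that by simp
  have "dft \<theta> (\<lambda>(i, j). \<Sum>p<N. A (i, p) * B (p, j)) (l, j) =
      (\<Sum>c\<in>columns j. \<Sum>p<N. (A (l, p) * phase N \<theta> (int p - int l)) * (B (p, c) * phase N \<theta> (int c - int p)))"
  proof -
    have "phase N \<theta> (int c - int l) = phase N \<theta> (int p - int l) * phase N \<theta> (int c - int p)" for c p
      by (simp flip: phase_add)
    then show ?thesis unfolding dft_def case_prod_conv sum_distrib_right
      by (intro sum.cong refl) (simp only: mult_ac)
  qed
  also have "\<dots> = (\<Sum>p<N. (A (l, p) * phase N \<theta> (int p - int l)) * g p)"
    by (subst sum.swap) (simp add: g_def sum_distrib_left)
  also have "\<dots> = (\<Sum>q<k. \<Sum>p\<in>columns q. (A (l, p) * phase N \<theta> (int p - int l)) * g q)"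
    unfolding sum_by_residues using g by (intro sum.cong refl) (auto simp: columns_def)
  also have "\<dots> = (\<Sum>q<k. dft \<theta> A (l, q) * dft \<theta> B (q, j))"
    by (simp add: dft_def g_def sum_distrib_right)
  finally show ?thesis .
qed

lemma block_circulant_mult:
  assumes "block_circulant A" "block_circulant B"
  shows "block_circulant (\<lambda>(i, j). \<Sum>p<N. A (i, p) * B (p, j))"
  unfolding block_circulant_def case_prod_conv
proof (intro allI impI)
  fix i j assume ij: "i < N" "j < N"
  have "(\<Sum>p<N. A (shift i, p) * B (p, shift j)) = (\<Sum>p<N. A (shift i, shift p) * B (shift p, shift j))"
    by (rule sum.reindex_bij_betw[OF bij_shift, symmetric])
  also have "\<dots> = (\<Sum>p<N. A (i, p) * B (p, j))"
    using assms ij by (intro sum.cong refl) (auto simp: block_circulant_def)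
  finally show "(\<Sum>p<N. A (shift i, p) * B (p, shift j)) = (\<Sum>p<N. A (i, p) * B (p, j))" .
qed

lemma dft_entry_power:
  assumes a: "block_circulant a"
  shows "block_circulant (\<lambda>(i, j). entry_power N a m i j) \<and>
    (\<forall>l<k. \<forall>j<k. dft \<theta> (\<lambda>(i, j). entry_power N a m i j) (l, j) = entry_power k (dft \<theta> a) m l j)"
proof (induction m)
  case 0
  have "dft \<theta> (\<lambda>(i, j). entry_power N a 0 i j) (l, j) = entry_power k (dft \<theta> a) 0 l j" if "l < k" "j < k" for l j
  proof -
    have "dft \<theta> (\<lambda>(i, j). entry_power N a 0 i j) (l, j) = (\<Sum>c\<in>columns j. if c = l then 1 else 0)"
      unfolding dft_def by (auto intro!: sum.cong)
    also have "\<dots> = (if l = j then 1 else 0)"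
      using that N by (auto simp: finite_columns) (auto simp: columns_def)
    finally show ?thesis by simp
  qed
  moreover have "block_circulant (\<lambda>(i, j). entry_power N a 0 i j)"
    using inj_on_shift by (auto simp: block_circulant_def inj_on_def)
  ultimately show ?case by blast
next
  case (Suc m)
  define E where "E = (\<lambda>(i, j). entry_power N a m i j)"
  have eq: "(\<lambda>(i, j). entry_power N a (Suc m) i j) = (\<lambda>(i, j). \<Sum>p<N. E (i, p) * a (p, j))"
    by (simp add: E_def)
  have IH: "block_circulant E" "\<And>l j. l < k \<Longrightarrow> j < k \<Longrightarrow> dft \<theta> E (l, j) = entry_power k (dft \<theta> a) m l j"
    using Suc unfolding E_def by blast+
  show ?case unfolding eq
  proof (intro conjI allI impI)
    show "block_circulant (\<lambda>(i, j). \<Sum>p<N. E (i, p) * a (p, j))" by (rule block_circulant_mult[OF IH(1) a])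
    fix l j assume lj: "l < k" "j < k"
    show "dft \<theta> (\<lambda>(i, j). \<Sum>p<N. E (i, p) * a (p, j)) (l, j) = entry_power k (dft \<theta> a) (Suc m) l j"
      unfolding dft_mult[OF a lj] entry_power.simps using IH(2) lj by (intro sum.cong refl) simp
  qed
qed

text \<open>Fourier inversion at block offset 0: summing over \<theta> annihilates every column
  \<open>l + k * m\<close> with \<open>m > 0\<close> and multiplies the diagonal entry by n.\<close>

lemma trace_dft:
  assumes B: "block_circulant B"
  shows "(\<Sum>i<N. B (i, i)) = (\<Sum>\<theta><n. \<Sum>l<k. dft \<theta> B (l, l))"
proof -
  have "B (p, p) = B (p mod k, p mod k)" if "p < N" for p
    using shift_invariant[of "\<lambda>p. B (p, p)" p] B that by (auto simp: block_circulant_def)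
  then have "(\<Sum>i<N. B (i, i)) = (\<Sum>l<k. \<Sum>p\<in>columns l. B (l, l))"
    unfolding sum_by_residues by (intro sum.cong refl) (auto simp: columns_def)
  also have "\<dots> = (\<Sum>l<k. of_nat n * B (l, l))"
    using sum_columns[of _ "\<lambda>_. B (_, _)"] by (intro sum.cong refl) (simp add: sum_columns)
  also have "\<dots> = (\<Sum>l<k. \<Sum>\<theta><n. dft \<theta> B (l, l))"
  proof (intro sum.cong refl)
    fix l assume "l \<in> {..<k}"
    then have l: "l < k" by simp
    have "(\<Sum>\<theta><n. dft \<theta> B (l, l)) = (\<Sum>m<n. B (l, l + k * m) * (\<Sum>\<theta><n. cis (2 * pi * real \<theta> * real m / real n)))"
      unfolding dft_def case_prod_conv sum_columns[OF l] phase_column sum_distrib_left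
      by (subst sum.swap) simp
    also have "\<dots> = (\<Sum>m<n. if m = 0 then of_nat n * B (l, l) else 0)"
    proof (intro sum.cong refl)
      fix m assume "m \<in> {..<n}"
      then have "int n dvd int m \<longleftrightarrow> m = 0" by (auto dest: dvd_imp_le)
      then have "(\<Sum>\<theta><n. cis (2 * pi * real \<theta> * real m / real n)) = (if m = 0 then of_nat n else 0)"
        using sum_cis_multiples[OF n, of "int m"] by (simp add: mult_ac)
      then show "B (l, l + k * m) * (\<Sum>\<theta><n. cis (2 * pi * real \<theta> * real m / real n)) = (if m = 0 then of_nat n * B (l, l) else 0)"
        by simp
    qed
    finally show "of_nat n * B (l, l) = (\<Sum>\<theta><n. dft \<theta> B (l, l))" using n by simp
  qed
  also have "\<dots> = (\<Sum>\<theta><n. \<Sum>l<k. dft \<theta> B (l, l))" by (rule sum.swap)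
  finally show ?thesis .
qed

lemma power_trace_dft:
  assumes a: "block_circulant a"
  shows "power_trace N a m = (\<Sum>\<theta><n. power_trace k (dft \<theta> a) m)"
proof -
  have bc: "block_circulant (\<lambda>(i, j). entry_power N a m i j)" using dft_entry_power[OF a] by blast
  show ?thesis
    using trace_dft[OF bc] dft_entry_power[OF a, of m] unfolding power_trace_def by simp
qed

definition class_entries :: "((nat \<times> nat) set \<Rightarrow> real) \<Rightarrow> nat \<times> nat \<Rightarrow> complex" where
  "class_entries x p = of_real (x (equiv_class (entry_equiv k f N) p))"

lemma block_circulant_class_entries: "block_circulant (class_entries x)"
  unfolding block_circulant_def class_entries_def
proof (intro allI impI)
  fix i j assume ij: "i < N" "j < N"
  have "[int (shift i) = int i + int k] (mod int N)" for i
    by (simp add: shift_def zmod_int cong_def)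
  then have "[int (shift i) - int (shift j) = (int i + int k) - (int j + int k)] (mod int N)"
    by (intro cong_diff)
  then have "entry_equiv k f N (shift i, shift j) (i, j)"
    using ij shift_less by (intro entry_equiv_gen) (auto simp: same_diagonal_def link_eval_def shift_mod)
  then show "complex_of_real (x (equiv_class (entry_equiv k f N) (shift i, shift j))) =
      of_real (x (equiv_class (entry_equiv k f N) (i, j)))"
    by (simp only: equiv_class_entry_eq_iff[symmetric])
qed

lemma dft_class_entries:
  assumes "e \<in> indices k"
  shows "dft \<theta> (class_entries x) e = of_real (sqrt n) * linear_form entry_classes (coeff e \<theta>) x"
proof -
  obtain l j where e: "e = (l, j)" "l < k" "j < k" using assms by auto
  have "linear_form entry_classes (coeff e \<theta>) x =
      of_real (1 / sqrt n) * (\<Sum>C\<in>entry_classes. \<Sum>c\<in>fibre e C. x (cls l c) * phase N \<theta> (int c - int l))"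
    unfolding linear_form_def coeff_def sum_distrib_left sum_distrib_right e(1)
    by (intro sum.cong refl) (auto simp: fibre_def)
  also have "(\<Sum>C\<in>entry_classes. \<Sum>c\<in>fibre e C. x (cls l c) * phase N \<theta> (int c - int l)) =
      (\<Sum>c\<in>columns j. x (cls l c) * phase N \<theta> (int c - int l))"
    unfolding fibre_def e(1) fst_conv snd_conv
    by (rule sum.group) (use e finite_columns finite_classes cls_in_classes columns_less in auto)
  also have "\<dots> = dft \<theta> (class_entries x) e"
    by (simp add: dft_def e(1) class_entries_def cls_def)
  finally show ?thesis using n by simp
qed

text \<open>Each of the \<open>m\<close> steps contributes a factor sqrt n from
  \<open>dft_class_entries\<close>, and the sum over the frequencies is n times their mean.\<close>

lemma power_trace_class_entries:
  "power_trace N (class_entries x) m = of_nat n * of_real (sqrt n ^ m) *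
    (\<Sum>i<length (closed_walks k m). mean_product {..<m} entry_classes n (\<lambda>s. coeff (closed_walks k m ! i ! s)) x)"
proof -
  have "power_trace k (dft \<theta> (class_entries x)) m = of_real (sqrt n ^ m) *
      (\<Sum>i<length (closed_walks k m). \<Prod>s<m. linear_form entry_classes (coeff (closed_walks k m ! i ! s) \<theta>) x)" for \<theta>
    unfolding power_trace_walks sum_distrib_left
  proof (intro sum.cong refl)
    fix i assume i: "i \<in> {..<length (closed_walks k m)}"
    have "closed_walks k m ! i ! s \<in> indices k" if "s < m" for s
    proof -
      have L: "closed_walks k m ! i \<in> set (closed_walks k m)" using i by simp
      then show ?thesis using closed_walks_props[OF L] that nth_mem[of s "closed_walks k m ! i"] by auto
    qed
    then have "(\<Prod>s<m. dft \<theta> (class_entries x) (closed_walks k m ! i ! s)) =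
        (\<Prod>s<m. of_real (sqrt n) * linear_form entry_classes (coeff (closed_walks k m ! i ! s) \<theta>) x)"
      by (intro prod.cong refl dft_class_entries) simp
    then show "(\<Prod>s<m. dft \<theta> (class_entries x) (closed_walks k m ! i ! s)) = of_real (sqrt n ^ m) *
        (\<Prod>s<m. linear_form entry_classes (coeff (closed_walks k m ! i ! s) \<theta>) x)"
      by (simp add: prod.distrib)
  qed
  then have "power_trace N (class_entries x) m = of_real (sqrt n ^ m) *
      (\<Sum>i<length (closed_walks k m). \<Sum>\<theta><n. \<Prod>s<m. linear_form entry_classes (coeff (closed_walks k m ! i ! s) \<theta>) x)"
    unfolding power_trace_dft[OF block_circulant_class_entries] sum_distrib_left
    by (subst sum.swap) simp
  also have "\<dots> = of_real (sqrt n ^ m) * (\<Sum>i<length (closed_walks k m). of_nat n *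
      mean_product {..<m} entry_classes n (\<lambda>s. coeff (closed_walks k m ! i ! s)) x)"
    using n by (simp add: mean_product_def)
  finally show ?thesis by (simp add: sum_distrib_left mult_ac)
qed

end

subsection \<open>Convergence of the moments\<close>

context companion
begin

text \<open>The bound (2 r)! / (2^r r!) is the number of pairings of 2 r factors. In
  \<open>wick\<close> the first factor has one partner among the others and each covariance is 0 or
  1, so passing from r to r + 1 multiplies the bound by 2 r + 1.\<close>

lemma double_factorial_bound:
  assumes "finite A" "\<And>s. s \<in> A \<Longrightarrow> e s \<in> indices k" "card A = 2 * r"
  shows "cmod (companion_moment e A) \<le> fact (2 * r) / (2 ^ r * fact r)"
  using assms
proof (induction r arbitrary: A)
  case 0
  then show ?case by (simp add: companion_moment_empty)
next
  case (Suc r)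
  then obtain a A' where A': "A = insert a A'" "a \<notin> A'" "finite A'" "card A' = 2 * r + 1"
    by (metis card_Suc_eq_finite mult_Suc_right add_2_eq_Suc Suc_eq_plus1)
  have w: "companion_moment e A = (\<Sum>s\<in>A'. of_bool (covariant (e a) (e s)) * companion_moment e (A' - {s}))"
    unfolding A'(1) using A' Suc.prems by (intro wick) auto
  have "cmod (companion_moment e A) \<le> (\<Sum>s\<in>A'. fact (2 * r) / (2 ^ r * fact r))"
    unfolding w
  proof (rule sum_norm_le)
    fix s assume s: "s \<in> A'"
    have "cmod (companion_moment e (A' - {s})) \<le> fact (2 * r) / (2 ^ r * fact r)"
      using A' s Suc.prems by (intro Suc.IH) auto
    then show "cmod (of_bool (covariant (e a) (e s)) * companion_moment e (A' - {s})) \<le> fact (2 * r) / (2 ^ r * fact r)"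
      by (cases "covariant (e a) (e s)") auto
  qed
  also have "\<dots> = (2 * real r + 1) * (fact (2 * r) / (2 ^ r * fact r))" using A' by simp
  also have "\<dots> = fact (2 * Suc r) / (2 ^ Suc r * fact (Suc r))"
  proof -
    have "fact (2 * Suc r) = 2 * (real r + 1) * ((2 * real r + 1) * fact (2 * r))" by (simp add: algebra_simps)
    moreover have "2 ^ Suc r * fact (Suc r) = 2 * (real r + 1) * (2 ^ r * fact r)" by simp
    ultimately show ?thesis by (simp only: mult_divide_mult_cancel_left_if times_divide_eq_right) simp
  qed
  finally show ?case .
qed

end

lemma sqrt_le_self: "sqrt (real n) \<le> real n"
proof (rule real_le_lsqrt)
  have "n \<le> n\<^sup>2" using le_square[of n] by (simp add: power2_eq_square)
  then show "real n \<le> (real n)\<^sup>2" by (metis of_nat_le_iff of_nat_power)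
qed auto

context iid_moments
begin

text \<open>Both moments obey the same recursion, that of the companion exactly by
  \<open>wick\<close> and that of the forms up to O(1 / sqrt n) by \<open>wick_step\<close>;
  \<open>covariance\<close> compares the coefficients. The bound is uniform in the frequency, as the
  average over \<theta> requires.\<close>

lemma good_frequency_moment:
  assumes k: "k > 0"
  shows "\<exists>C\<ge>0. \<forall>A e n \<theta>. finite A \<and> card A \<le> m \<and> (\<forall>s\<in>A. e s \<in> indices k) \<and> 0 < n \<and> \<theta> < n \<and> \<not> n dvd 2 * \<theta> \<longrightarrow>
    cmod ((\<integral>x. (\<Prod>s\<in>A. linear_form (periodic_link.entry_classes k n f) (periodic_link.coeff k n f (e s) \<theta>) x)
        \<partial>P (periodic_link.entry_classes k n f)) - companion.companion_moment k f e A) \<le> C / sqrt (real n)"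
proof (induction m)
  case 0
  interpret companion k f .
  have "cmod ((\<integral>x. (\<Prod>s\<in>A. linear_form (periodic_link.entry_classes k n f) (periodic_link.coeff k n f (e s) \<theta>) x)
        \<partial>P (periodic_link.entry_classes k n f)) - companion_moment e A) \<le> 0 / sqrt (real n)"
    if "finite A" "card A \<le> 0" for A :: "nat set" and e n \<theta>
  proof -
    interpret E: prob_space "P (periodic_link.entry_classes k n f)" by (rule prob_space_P)
    show ?thesis using that by (simp add: companion_moment_empty E.prob_space)
  qed
  then show ?case by blast
next
  case (Suc m)
  interpret companion k f .
  define K where "K = (real k)\<^sup>2"
  have K0: "K \<ge> 0" by (simp add: K_def)
  have two: "1 \<le> (2 :: real)" by simp
  define D where "D n e \<theta> A = (\<integral>x. (\<Prod>s\<in>A. linear_form (periodic_link.entry_classes k n f) (periodic_link.coeff k n f (e s) \<theta>) x)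
        \<partial>P (periodic_link.entry_classes k n f))" for n e \<theta> and A :: "nat set"
  from Suc[folded D_def] obtain C where C: "C \<ge> 0" and *: "\<forall>A e n \<theta>. finite A \<and> card A \<le> m \<and> (\<forall>s\<in>A. e s \<in> indices k) \<and>
      0 < n \<and> \<theta> < n \<and> \<not> n dvd 2 * \<theta> \<longrightarrow> cmod (D n e \<theta> A - companion_moment e A) \<le> C / sqrt (real n)"
    by (elim exE conjE)
  have IH: "cmod (D n e \<theta> A - companion_moment e A) \<le> C / sqrt (real n)"
    if "finite A" "card A \<le> m" "\<forall>s\<in>A. e s \<in> indices k" "0 < n" "\<theta> < n" "\<not> n dvd 2 * \<theta>" for A e n \<theta>
    by (rule *[rule_format]) (use that in blast)
  obtain B where B: "B \<ge> 1" and Bb: "\<And>(A :: nat set) (I :: (nat \<times> nat) set set) h a. finite A \<Longrightarrow> card A \<le> Suc m \<Longrightarrow>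
      small_coeffs K 2 A I h a \<Longrightarrow> cmod (\<integral>x. (\<Prod>s\<in>A. linear_form I (a s) x) \<partial>P I) \<le> B"
    using moment_bound[OF K0 two, of "Suc m"] by blast
  obtain C0 where C0: "C0 \<ge> 0" and ws0: "\<forall>(A :: nat set) (I :: (nat \<times> nat) set set) h a a0. finite A \<and> card A \<le> m \<and> a0 \<notin> A \<and>
      small_coeffs K 2 (insert a0 A) I h a \<longrightarrow>
    cmod ((\<integral>x. (\<Prod>s\<in>insert a0 A. linear_form I (a s) x) \<partial>P I) -
      (\<Sum>s\<in>A. (\<Sum>i\<in>I. a a0 i * a s i) * (\<integral>x. (\<Prod>s\<in>A - {s}. linear_form I (a s) x) \<partial>P I))) \<le> C0 * h"
    using wick_step[OF K0 two, of m, where 's = nat and 'i = "(nat \<times> nat) set"] by (elim exE conjE)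
  have "cmod (D n e \<theta> A - companion_moment e A) \<le> (C + C0 + real m * (3 * B + C)) / sqrt (real n)"
    if A: "finite A" "card A \<le> Suc m" "\<forall>s\<in>A. e s \<in> indices k" and hn: "0 < n" "\<theta> < n" "\<not> n dvd 2 * \<theta>" for A e n \<theta>
  proof (cases "card A \<le> m")
    case True
    have "C / sqrt (real n) \<le> (C + C0 + real m * (3 * B + C)) / sqrt (real n)"
      using C C0 B by (intro divide_right_mono) auto
    then show ?thesis using IH[OF A(1) True A(3) hn] by linarith
  next
    case False
    interpret periodic_link k n f by unfold_locales (use k hn in auto)
    from False A have "A \<noteq> {}" by auto
    then obtain a where a: "a \<in> A" by blast
    define A' where "A' = A - {a}"
    have A': "A = insert a A'" "a \<notin> A'" "finite A'" "card A' = m"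
      using a A False by (auto simp: A'_def)
    have sc: "small_coeffs K 2 S entry_classes (1 / sqrt n) (\<lambda>s. coeff (e s) \<theta>)" if "S \<subseteq> A" for S
    proof -
      have "bessel_coeffs K 2 2 S entry_classes n (\<lambda>s. coeff (e s))"
        unfolding K_def using A that by (intro bessel_coeffs) auto
      then show ?thesis using hn by (simp add: bessel_coeffs_def)
    qed
    have r: "1 / real n \<le> 1 / sqrt (real n)"
      using hn by (intro divide_left_mono sqrt_le_self) auto
    define q where "q s = (\<Sum>i\<in>entry_classes. coeff (e a) \<theta> i * coeff (e s) \<theta> i)" for s
    have step: "cmod (D n e \<theta> A - (\<Sum>s\<in>A'. q s * D n e \<theta> (A' - {s}))) \<le> C0 / sqrt n"
    proof -
      have "finite A' \<and> card A' \<le> m \<and> a \<notin> A' \<and>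
          small_coeffs K 2 (insert a A') entry_classes (1 / sqrt n) (\<lambda>s. coeff (e s) \<theta>)"
        using A' sc[of "insert a A'"] by auto
      from ws0[rule_format, OF this] show ?thesis unfolding D_def q_def A'(1) by simp
    qed
    \<comment> \<open>Three sources of error: the approximate recursion, the covariances, and the
      induction hypothesis for moments with two factors fewer.\<close>
    have eq: "D n e \<theta> A - companion_moment e A = (D n e \<theta> A - (\<Sum>s\<in>A'. q s * D n e \<theta> (A' - {s}))) +
        (\<Sum>s\<in>A'. (q s - of_bool (covariant (e a) (e s))) * D n e \<theta> (A' - {s}) +
          of_bool (covariant (e a) (e s)) * (D n e \<theta> (A' - {s}) - companion_moment e (A' - {s})))"
    proof -
      have w: "companion_moment e A = (\<Sum>s\<in>A'. of_bool (covariant (e a) (e s)) * companion_moment e (A' - {s}))"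
        unfolding A'(1) using A A' by (intro wick) auto
      show ?thesis unfolding w by (simp add: algebra_simps sum.distrib sum_subtractf)
    qed
    have "cmod (D n e \<theta> A - companion_moment e A) \<le> C0 / sqrt n + (\<Sum>s\<in>A'. 3 / sqrt n * B + C / sqrt n)"
      unfolding eq
    proof (rule order_trans[OF norm_triangle_ineq add_mono[OF step sum_norm_le]])
      fix s assume s: "s \<in> A'"
      have e: "e a \<in> indices k" "e s \<in> indices k" using A A' s by auto
      have "cmod (q s - of_bool (covariant (e a) (e s))) \<le> 3 / n"
        unfolding q_def covariant_def by (rule covariance[OF e hn(3)])
      also have "\<dots> \<le> 3 / sqrt n" using r by simp
      finally have 1: "cmod (q s - of_bool (covariant (e a) (e s))) \<le> 3 / sqrt n" .
      have c: "card (A' - {s}) \<le> m" using A' s by simp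
      have 2: "cmod (D n e \<theta> (A' - {s})) \<le> B"
        unfolding D_def by (rule Bb[OF _ _ sc]) (use A' c in auto)
      have 3: "cmod (D n e \<theta> (A' - {s}) - companion_moment e (A' - {s})) \<le> C / sqrt n"
        using IH[of "A' - {s}" e n \<theta>] A A' c hn by auto
      have "cmod ((q s - of_bool (covariant (e a) (e s))) * D n e \<theta> (A' - {s})) \<le> 3 / sqrt n * B"
        unfolding norm_mult using 1 2 by (intro mult_mono) auto
      moreover have "cmod (of_bool (covariant (e a) (e s)) * (D n e \<theta> (A' - {s}) - companion_moment e (A' - {s}))) \<le> C / sqrt n"
        using 3 C by (cases "covariant (e a) (e s)") auto
      ultimately show "cmod ((q s - of_bool (covariant (e a) (e s))) * D n e \<theta> (A' - {s}) +
          of_bool (covariant (e a) (e s)) * (D n e \<theta> (A' - {s}) - companion_moment e (A' - {s}))) \<le> 3 / sqrt n * B + C / sqrt n"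
        by (rule order_trans[OF norm_triangle_ineq add_mono])
    qed
    also have "(\<Sum>s\<in>A'. 3 / sqrt n * B + C / sqrt n) = real m * (3 * B + C) / sqrt n"
      unfolding sum_constant A'(4) by (simp add: add_divide_distrib distrib_left)
    also have "C0 / sqrt n + real m * (3 * B + C) / sqrt n \<le> (C + C0 + real m * (3 * B + C)) / sqrt n"
      unfolding add_divide_distrib[symmetric] using C by (intro divide_right_mono) auto
    finally show ?thesis .
  qed
  moreover have "C + C0 + real m * (3 * B + C) \<ge> 0" using C C0 B by auto
  ultimately show ?case unfolding D_def by blast
qed

text \<open>All but at most two frequencies are within O(1 / sqrt n) of the limit. The exceptional
  ones are only known to be bounded, by \<open>moment_bound\<close>, but contribute O(1 / n) to the
  mean.\<close>

lemma expectation_mean_product_tendsto: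
  assumes k: "k > 0" and A: "finite A" "\<forall>s\<in>A. e s \<in> indices k"
  shows "(\<lambda>j. \<integral>x. mean_product A (periodic_link.entry_classes k (Suc j) f) (Suc j) (\<lambda>s. periodic_link.coeff k (Suc j) f (e s)) x
      \<partial>P (periodic_link.entry_classes k (Suc j) f)) \<longlonglongrightarrow> companion.companion_moment k f e A"
proof -
  interpret companion k f .
  define K where "K = (real k)\<^sup>2"
  have K0: "K \<ge> 0" by (simp add: K_def)
  have two: "1 \<le> (2 :: real)" by simp
  define W where "W = companion_moment e A"
  define D where "D n \<theta> = (\<integral>x. (\<Prod>s\<in>A. linear_form (periodic_link.entry_classes k n f) (periodic_link.coeff k n f (e s) \<theta>) x)
        \<partial>P (periodic_link.entry_classes k n f))" for n \<theta>
  from good_frequency_moment[OF k, of "card A" f] obtain C where C: "C \<ge> 0"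
    and *: "\<forall>A' e n \<theta>. finite A' \<and> card A' \<le> card A \<and> (\<forall>s\<in>A'. e s \<in> indices k) \<and> 0 < n \<and> \<theta> < n \<and> \<not> n dvd 2 * \<theta> \<longrightarrow>
    cmod ((\<integral>x. (\<Prod>s\<in>A'. linear_form (periodic_link.entry_classes k n f) (periodic_link.coeff k n f (e s) \<theta>) x)
        \<partial>P (periodic_link.entry_classes k n f)) - companion_moment e A') \<le> C / sqrt (real n)" by (elim exE conjE)
  have good: "cmod (D n \<theta> - W) \<le> C / sqrt (real n)" if "0 < n" "\<theta> < n" "\<not> n dvd 2 * \<theta>" for n \<theta>
    unfolding D_def W_def by (rule *[rule_format]) (use that A in blast)
  obtain B where B: "B \<ge> 1" and Bb: "\<And>(A' :: nat set) (I :: (nat \<times> nat) set set) h a. finite A' \<Longrightarrow> card A' \<le> card A \<Longrightarrow>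
      small_coeffs K 2 A' I h a \<Longrightarrow> cmod (\<integral>x. (\<Prod>s\<in>A'. linear_form I (a s) x) \<partial>P I) \<le> B"
    using moment_bound[OF K0 two, of "card A"] by blast
  define R where "R n = (\<integral>x. mean_product A (periodic_link.entry_classes k n f) n (\<lambda>s. periodic_link.coeff k n f (e s)) x
      \<partial>P (periodic_link.entry_classes k n f))" for n
  have R: "cmod (R n - W) \<le> (C + 2 * (B + cmod W)) / sqrt n" if n: "n > 0" for n
  proof -
    interpret periodic_link k n f by unfold_locales (use k n in auto)
    have sc: "small_coeffs K 2 A entry_classes (1 / sqrt n) (\<lambda>s. coeff (e s) \<theta>)" if "\<theta> < n" for \<theta>
      using bessel_coeffs[of A e] A that unfolding bessel_coeffs_def K_def by auto
    have "R n = (\<Sum>\<theta><n. D n \<theta>) / n"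
      unfolding R_def D_def mean_product_def
      by (simp add: Bochner_Integration.integral_sum integrable_poly_growth poly_growth_prod
          poly_growth_linear_form finite_classes)
    then have "R n - W = (\<Sum>\<theta><n. D n \<theta> - W) / n" using n by (simp add: sum_subtractf field_simps)
    then have "cmod (R n - W) = cmod (\<Sum>\<theta><n. D n \<theta> - W) / n" by (simp add: norm_divide)
    also have "cmod (\<Sum>\<theta><n. D n \<theta> - W) \<le> (\<Sum>\<theta><n. C / sqrt n + (if n dvd 2 * \<theta> then B + cmod W else 0))"
    proof (rule sum_norm_le)
      fix \<theta> assume \<theta>: "\<theta> \<in> {..<n}"
      show "cmod (D n \<theta> - W) \<le> C / sqrt n + (if n dvd 2 * \<theta> then B + cmod W else 0)"
      proof (cases "n dvd 2 * \<theta>")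
        case True
        have "cmod (D n \<theta>) \<le> B" unfolding D_def using \<theta> by (intro Bb[OF A(1) order_refl sc]) auto
        moreover have "C / sqrt n \<ge> 0" using C by simp
        ultimately show ?thesis using True norm_triangle_ineq4[of "D n \<theta>" W] by simp
      next
        case False
        then show ?thesis using good[OF n] \<theta> by simp
      qed
    qed
    also have "\<dots> = real n * (C / sqrt n) + real (card {\<theta>. \<theta> < n \<and> n dvd 2 * \<theta>}) * (B + cmod W)"
      by (simp add: sum.distrib sum.inter_filter[symmetric] del: sum.inter_filter)
    also have "\<dots> \<le> real n * (C / sqrt n) + 2 * (B + cmod W)"
      using card_exceptional B by (intro add_left_mono mult_right_mono) auto
    finally have "cmod (R n - W) \<le> (real n * (C / sqrt n) + 2 * (B + cmod W)) / n"
      by (simp add: divide_right_mono)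
    also have "\<dots> = C / sqrt n + 2 * (B + cmod W) / n" using n by (simp add: field_simps)
    also have "2 * (B + cmod W) / n \<le> 2 * (B + cmod W) / sqrt n"
      using n B by (intro divide_left_mono sqrt_le_self) auto
    finally show ?thesis by (simp add: add_divide_distrib)
  qed
  have "(\<lambda>j. R (Suc j) - W) \<longlonglongrightarrow> 0"
  proof (rule Lim_null_comparison[where g = "\<lambda>j. (C + 2 * (B + cmod W)) / sqrt (Suc j)"])
    show "\<forall>\<^sub>F j in sequentially. cmod (R (Suc j) - W) \<le> (C + 2 * (B + cmod W)) / sqrt (real (Suc j))"
      by (intro always_eventually allI R) simp
    show "(\<lambda>j. (C + 2 * (B + cmod W)) / sqrt (real (Suc j))) \<longlonglongrightarrow> 0"
      by real_asymp
  qed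
  then show ?thesis unfolding R_def W_def by (subst (asm) LIM_zero_iff)
qed

end

subsection \<open>Convergence from moments\<close>

text \<open>Taylor expansion to an even order, for which the remainder, an absolute moment, is an
  ordinary moment.\<close>

lemma char_moment_approx:
  assumes "real_distribution \<nu>" and int: "\<And>m. integrable \<nu> (\<lambda>x. x ^ m)"
  shows "cmod (char \<nu> t - (\<Sum>j\<le>2 * r. ((\<i> * t) ^ j / fact j) * (\<integral>x. x ^ j \<partial>\<nu>))) \<le>
    2 * \<bar>t\<bar> ^ (2 * r) / fact (2 * r) * (\<integral>x. x ^ (2 * r) \<partial>\<nu>)"
  using real_distribution.char_approx1[OF assms(1), of "2 * r" t] int
  by (simp add: power_mult)

text \<open>Integration against the mixture is exchanged for the bounded real functions cosine and
  sine; the complex identity is assembled from the two.\<close>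

lemma char_bind:
  assumes Q: "prob_space Q" and K: "K \<in> measurable Q (prob_algebra borel)"
  shows "integrable Q (\<lambda>c. char (K c) t)" "char (Q \<bind> K) t = (\<integral>c. char (K c) t \<partial>Q)"
    "real_distribution (Q \<bind> K)"
proof -
  interpret Q: prob_space Q by fact
  have K': "K \<in> measurable Q (subprob_algebra borel)" by (rule measurable_prob_algebraD[OF K])
  have Kc: "real_distribution (K c)" if "c \<in> space Q" for c
    using measurable_space[OF K that] sets_eq_imp_space_eq[of "K c" borel]
    by (auto simp: space_prob_algebra real_distribution_def real_distribution_axioms_def)
  show rd: "real_distribution (Q \<bind> K)"
  proof -
    have "prob_space (Q \<bind> K)"
      using Kc by (intro Q.prob_space_bind[OF _ K'] AE_I2) (auto simp: real_distribution_def)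
    moreover have "sets (Q \<bind> K) = sets borel"
      using Q.not_empty K' by (intro sets_bind sets_kernel) auto
    ultimately show ?thesis
      using sets_eq_imp_space_eq[of "Q \<bind> K" borel] by (auto simp: real_distribution_def real_distribution_axioms_def)
  qed
  have meas: "(\<lambda>c. char (K c) t) \<in> borel_measurable Q"
    unfolding char_def by (rule measurable_compose[OF K' integral_measurable_subprob_algebra]) simp
  show int: "integrable Q (\<lambda>c. char (K c) t)"
    using Kc by (intro Q.integrable_const_bound[where B = 1] meas AE_I2) (auto intro: real_distribution.cmod_char_le_1)
  have parts: "Re (char \<nu> t) = (\<integral>x. cos (t * x) \<partial>\<nu>)" "Im (char \<nu> t) = (\<integral>x. sin (t * x) \<partial>\<nu>)" if "real_distribution \<nu>" for \<nu>
  proof -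
    interpret R: real_distribution \<nu> by fact
    have i: "integrable \<nu> (\<lambda>x. iexp (t * x))" by (intro R.integrable_const_bound[where B = 1]) auto
    show "Re (char \<nu> t) = (\<integral>x. cos (t * x) \<partial>\<nu>)"
      unfolding char_def using integral_Re[OF i] by (simp add: Re_exp)
    show "Im (char \<nu> t) = (\<integral>x. sin (t * x) \<partial>\<nu>)"
      unfolding char_def using integral_Im[OF i] by (simp add: Im_exp)
  qed
  have b: "(\<integral>x. g x \<partial>(Q \<bind> K)) = (\<integral>c. (\<integral>x. g x \<partial>K c) \<partial>Q)"
    if "g \<in> borel_measurable borel" "\<And>x. \<bar>g x\<bar> \<le> 1" for g :: "real \<Rightarrow> real"
  proof (rule integral_bind[OF that(1) _ K' Q.finite_measure_axioms, where B = 1 and B' = 1])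
    show "AE c in Q. emeasure (K c) (space (K c)) \<le> ennreal 1"
      using Kc by (intro AE_I2) (auto simp: real_distribution_def prob_space.emeasure_space_1)
  qed (use that in auto)
  show "char (Q \<bind> K) t = (\<integral>c. char (K c) t \<partial>Q)"
  proof (rule complex_eqI)
    have "Re (char (Q \<bind> K) t) = (\<integral>c. (\<integral>x. cos (t * x) \<partial>K c) \<partial>Q)"
      unfolding parts(1)[OF rd] by (rule b) auto
    also have "\<dots> = (\<integral>c. Re (char (K c) t) \<partial>Q)"
      by (intro Bochner_Integration.integral_cong refl) (simp add: parts(1)[OF Kc])
    finally show "Re (char (Q \<bind> K) t) = Re (\<integral>c. char (K c) t \<partial>Q)" using integral_Re[OF int] by simp
    have "Im (char (Q \<bind> K) t) = (\<integral>c. (\<integral>x. sin (t * x) \<partial>K c) \<partial>Q)"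
      unfolding parts(2)[OF rd] by (rule b) auto
    also have "\<dots> = (\<integral>c. Im (char (K c) t) \<partial>Q)"
      by (intro Bochner_Integration.integral_cong refl) (simp add: parts(2)[OF Kc])
    finally show "Im (char (Q \<bind> K) t) = Im (\<integral>c. char (K c) t \<partial>Q)" using integral_Im[OF int] by simp
  qed
qed

text \<open>Taylor polynomials of the characteristic functions converge with the moments, and the
  growth condition makes the remainders small for a suitable order; Levy's continuity theorem
  concludes. The moments of the mixture enter as iterated integrals, so that only bounded functions
  are integrated against the mixture itself.\<close>

lemma converges_weakly_bind_from_moments:
  fixes \<nu> :: "nat \<Rightarrow> real measure"
  assumes Q: "prob_space Q" and K: "K \<in> measurable Q (prob_algebra borel)"
    and \<nu>: "\<And>n. real_distribution (\<nu> n)" "\<And>n m. integrable (\<nu> n) (\<lambda>x. x ^ m)"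
    and K_int: "\<And>c m. integrable (K c) (\<lambda>x. x ^ m)" "\<And>m. integrable Q (\<lambda>c. \<integral>x. x ^ m \<partial>K c)"
    and lim: "\<And>m. (\<lambda>n. \<integral>x. x ^ m \<partial>\<nu> n) \<longlonglongrightarrow> (\<integral>c. (\<integral>x. x ^ m \<partial>K c) \<partial>Q)"
    and growth: "\<And>t. (\<lambda>r. \<bar>t\<bar> ^ (2 * r) / fact (2 * r) * (\<integral>c. (\<integral>x. x ^ (2 * r) \<partial>K c) \<partial>Q)) \<longlonglongrightarrow> 0"
  shows "converges_weakly \<nu> (Q \<bind> K)"
proof -
  define \<mu> where "\<mu> m = (\<integral>c. (\<integral>x. x ^ m \<partial>K c) \<partial>Q)" for m
  have Kc: "real_distribution (K c)" if "c \<in> space Q" for c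
    using measurable_space[OF K that] sets_eq_imp_space_eq[of "K c" borel]
    by (auto simp: space_prob_algebra real_distribution_def real_distribution_axioms_def)
  have char_lim: "(\<lambda>n. char (\<nu> n) t) \<longlonglongrightarrow> char (Q \<bind> K) t" for t
  proof (rule LIMSEQ_I)
    fix \<epsilon> :: real assume \<epsilon>: "\<epsilon> > 0"
    define b where "b r = 2 * \<bar>t\<bar> ^ (2 * r) / fact (2 * r)" for r :: nat
    define a where "a j = (\<i> * t) ^ j / fact j" for j :: nat
    have "(\<lambda>r. 4 * (\<bar>t\<bar> ^ (2 * r) / fact (2 * r) * \<mu> (2 * r))) \<longlonglongrightarrow> 4 * 0"
      unfolding \<mu>_def by (intro tendsto_mult tendsto_const growth)
    then have "eventually (\<lambda>r. 4 * (\<bar>t\<bar> ^ (2 * r) / fact (2 * r) * \<mu> (2 * r)) < \<epsilon>) sequentially"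
      using \<epsilon> by (intro order_tendstoD(2)) auto
    \<comment> \<open>The remainder is counted twice: once for the mixture and once for
      \<open>\<nu> n\<close>, whose moment of order 2 r converges to
      \<open>\<mu> (2 * r)\<close>.\<close>
    then obtain r where r: "b r * \<mu> (2 * r) + b r * \<mu> (2 * r) < \<epsilon>"
      unfolding b_def eventually_sequentially by (auto simp: field_simps)
    have target: "cmod (char (Q \<bind> K) t - (\<Sum>j\<le>2 * r. a j * \<mu> j)) \<le> b r * \<mu> (2 * r)"
    proof -
      have i: "integrable Q (\<lambda>c. \<Sum>j\<le>2 * r. a j * of_real (\<integral>x. x ^ j \<partial>K c))"
        by (intro Bochner_Integration.integrable_sum integrable_mult_right integrable_of_real K_int)
      have "(\<Sum>j\<le>2 * r. a j * \<mu> j) = (\<integral>c. (\<Sum>j\<le>2 * r. a j * of_real (\<integral>x. x ^ j \<partial>K c)) \<partial>Q)"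
        unfolding \<mu>_def
        by (subst Bochner_Integration.integral_sum)
          (intro integrable_mult_right integrable_of_real K_int, simp)
      then have "char (Q \<bind> K) t - (\<Sum>j\<le>2 * r. a j * \<mu> j) =
          (\<integral>c. char (K c) t - (\<Sum>j\<le>2 * r. a j * of_real (\<integral>x. x ^ j \<partial>K c)) \<partial>Q)"
        unfolding char_bind(2)[OF Q K] using Bochner_Integration.integral_diff[OF char_bind(1)[OF Q K] i] by simp
      also have "cmod \<dots> \<le> (\<integral>c. cmod (char (K c) t - (\<Sum>j\<le>2 * r. a j * of_real (\<integral>x. x ^ j \<partial>K c))) \<partial>Q)"
        by (rule integral_norm_bound)
      also have "\<dots> \<le> (\<integral>c. b r * (\<integral>x. x ^ (2 * r) \<partial>K c) \<partial>Q)"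
        using char_moment_approx[OF Kc K_int(1), of _ t r] unfolding a_def b_def
        by (intro integral_mono integrable_norm Bochner_Integration.integrable_diff char_bind(1)[OF Q K] i[unfolded a_def]
            integrable_mult_right K_int) auto
      also have "\<dots> = b r * \<mu> (2 * r)" by (simp add: \<mu>_def)
      finally show ?thesis .
    qed
    define err where "err n = b r * (\<integral>x. x ^ (2 * r) \<partial>\<nu> n) + (\<Sum>j\<le>2 * r. cmod (a j) * \<bar>(\<integral>x. x ^ j \<partial>\<nu> n) - \<mu> j\<bar>) + b r * \<mu> (2 * r)" for n
    \<comment> \<open>With \<open>r\<close> fixed, the convergence of finitely many moments removes
      the middle sum, and the two remainders stay below \<epsilon>.\<close>
    have "err \<longlonglongrightarrow> b r * \<mu> (2 * r) + (\<Sum>j\<le>2 * r. cmod (a j) * \<bar>\<mu> j - \<mu> j\<bar>) + b r * \<mu> (2 * r)"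
      unfolding err_def using lim[folded \<mu>_def] by (intro tendsto_intros) auto
    then have "eventually (\<lambda>n. err n < \<epsilon>) sequentially" using r by (intro order_tendstoD(2)) auto
    moreover have "cmod (char (\<nu> n) t - char (Q \<bind> K) t) \<le> err n" for n
    proof -
      define X1 where "X1 = char (\<nu> n) t - (\<Sum>j\<le>2 * r. a j * (\<integral>x. x ^ j \<partial>\<nu> n))"
      define X2 where "X2 = (\<Sum>j\<le>2 * r. a j * of_real ((\<integral>x. x ^ j \<partial>\<nu> n) - \<mu> j))"
      define X3 where "X3 = char (Q \<bind> K) t - (\<Sum>j\<le>2 * r. a j * \<mu> j)"
      have "char (\<nu> n) t - char (Q \<bind> K) t = X1 + X2 - X3"
        by (simp add: X1_def X2_def X3_def algebra_simps sum_subtractf)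
      also have "cmod \<dots> \<le> cmod X1 + cmod X2 + cmod X3"
        by (rule order_trans[OF norm_triangle_ineq4 add_right_mono[OF norm_triangle_ineq]])
      also have "\<dots> \<le> err n"
        unfolding err_def
      proof (intro add_mono)
        show "cmod X1 \<le> b r * (\<integral>x. x ^ (2 * r) \<partial>\<nu> n)"
          unfolding X1_def a_def b_def by (rule char_moment_approx[OF \<nu>])
        show "cmod X2 \<le> (\<Sum>j\<le>2 * r. cmod (a j) * \<bar>(\<integral>x. x ^ j \<partial>\<nu> n) - \<mu> j\<bar>)"
          unfolding X2_def by (intro sum_norm_le) (simp add: norm_mult del: of_real_diff)
        show "cmod X3 \<le> b r * \<mu> (2 * r)" unfolding X3_def by (rule target)
      qed
      finally show ?thesis .
    qed
    ultimately have "eventually (\<lambda>n. cmod (char (\<nu> n) t - char (Q \<bind> K) t) < \<epsilon>) sequentially"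
      by (auto elim!: eventually_mono intro: le_less_trans)
    then show "\<exists>n0. \<forall>n\<ge>n0. cmod (char (\<nu> n) t - char (Q \<bind> K) t) < \<epsilon>"
      unfolding eventually_sequentially .
  qed
  have wc: "weak_conv_m \<nu> (Q \<bind> K)" by (rule levy_continuity[OF \<nu>(1) char_bind(3)[OF Q K] char_lim])
  show ?thesis unfolding converges_weakly_def
  proof (intro allI impI)
    fix g :: "real \<Rightarrow> real" assume g: "continuous_on UNIV g \<and> bounded (range g)"
    then obtain B where "\<And>x. \<bar>g x\<bar> \<le> B" unfolding bounded_iff by auto
    moreover have "isCont g x" for x using g continuous_on_eq_continuous_at[OF open_UNIV] by auto
    ultimately show "(\<lambda>n. integral\<^sup>L (\<nu> n) g) \<longlonglongrightarrow> integral\<^sup>L (Q \<bind> K) g"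
      using weak_conv_imp_integral_bdd_continuous_conv[OF \<nu>(1) char_bind(3)[OF Q K] wc, of g B] by simp
  qed
qed

subsection \<open>Almost sure convergence\<close>

lemma entry_power_cong:
  assumes "\<And>p. p \<in> indices n \<Longrightarrow> c p = c' p" "i < n" "j < n"
  shows "entry_power n c m i j = entry_power n c' m i j"
  using assms(3) by (induction m arbitrary: j) (use assms(1,2) in \<open>auto intro!: sum.cong\<close>)

lemma power_trace_cong:
  assumes "\<And>p. p \<in> indices n \<Longrightarrow> c p = c' p"
  shows "power_trace n c m = power_trace n c' m"
  unfolding power_trace_def using entry_power_cong[OF assms] by (intro sum.cong refl) auto

context companion
begin

text \<open>The \<open>m\<close>-th moment of the limit law by
  \<open>companion_spectral_moments\<close>; \<open>k\<close> comes from the uniform choice of an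
  eigenvalue and the power of sqrt \<open>k\<close> from the scaling.\<close>

definition limit_moment :: "nat \<Rightarrow> complex" where
  "limit_moment m = (\<Sum>i<length (closed_walks k m). companion_moment (\<lambda>s. closed_walks k m ! i ! s) {..<m}) /
     (of_nat k * of_real (sqrt k ^ m))"

lemma closed_walk_in_indices:
  assumes "i < length (closed_walks k m)" "s < m"
  shows "closed_walks k m ! i ! s \<in> indices k"
proof -
  have L: "closed_walks k m ! i \<in> set (closed_walks k m)" using assms by simp
  show ?thesis using closed_walks_props[OF L] assms(2) nth_mem[of s "closed_walks k m ! i"] by auto
qed

lemma prob_space_base: "prob_space (companion_base k f)"
  unfolding companion_base_eq by (rule prob_space_PiM) (rule prob_space_law)

lemma companion_matrix_measurable:
  "(\<lambda>x. restrict (companion_entry k f x) (indices k)) \<in> measurable (companion_base k f) (hermitian_matrices k)"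
  unfolding hermitian_matrices_def
proof (rule measurable_restrict_space2)
  show "(\<lambda>x. restrict (companion_entry k f x) (indices k)) \<in> space (companion_base k f) \<rightarrow>
      {c. \<forall>p\<in>indices k. c (prod.swap p) = cnj (c p)}"
  proof (intro funcsetI CollectI ballI)
    fix x p assume p: "p \<in> indices k"
    then have "prod.swap p \<in> indices k" by auto
    then show "restrict (companion_entry k f x) (indices k) (prod.swap p) = cnj (restrict (companion_entry k f x) (indices k) p)"
      using p hermitian_companion_entry[OF p] by simp
  qed
  show "(\<lambda>x. restrict (companion_entry k f x) (indices k)) \<in> measurable (companion_base k f) (Pi\<^sub>M (indices k) (\<lambda>_. borel))"
  proof (rule measurable_restrict)
    fix p assume p: "p \<in> indices k"
    have "(\<lambda>x. x (cclass p)) \<in> measurable (Pi\<^sub>M (cclass ` indices k) law) borel"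
      using measurable_component_singleton[of "cclass p" "cclass ` indices k" law] p
      by (simp add: measurable_cong_sets[OF refl sets_law])
    from measurable_compose[OF this val_measurable]
    show "(\<lambda>x. companion_entry k f x p) \<in> borel_measurable (companion_base k f)"
      unfolding companion_base_eq companion_entry_val[OF p] .
  qed
qed

lemma prob_space_companion_ensemble: "prob_space (companion_ensemble k f)"
  unfolding companion_ensemble_def by (rule prob_space.prob_space_distr[OF prob_space_base companion_matrix_measurable])

lemma companion_spectral_moments:
  assumes k: "k > 0"
  shows "integrable (companion_ensemble k f) (\<lambda>c. \<integral>x. x ^ m \<partial>spectral_measure k c)"
    and "of_real (\<integral>c. (\<integral>x. x ^ m \<partial>spectral_measure k c) \<partial>companion_ensemble k f) = limit_moment m"
proof -
  define g where "g c = (\<integral>x. x ^ m \<partial>spectral_measure k c)" for c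
  define M where "M x = restrict (companion_entry k f x) (indices k)" for x
  define F where "F x = (\<Sum>i<length (closed_walks k m). \<Prod>s<m. companion_entry k f x (closed_walks k m ! i ! s)) /
     (of_nat k * of_real (sqrt k ^ m))" for x
  have meas: "M \<in> measurable (companion_base k f) (hermitian_matrices k)"
    unfolding M_def by (rule companion_matrix_measurable)
  have gM: "of_real (g (M x)) = F x" for x
  proof -
    have "hermitian_entries k (M x)"
      unfolding hermitian_entries_def
    proof
      fix p assume p: "p \<in> indices k"
      then have "prod.swap p \<in> indices k" by auto
      then show "M x (prod.swap p) = cnj (M x p)"
        using p hermitian_companion_entry[OF p] by (simp add: M_def)
    qed
    then have "of_real (g (M x)) = power_trace k (M x) m / (of_nat k * of_real (sqrt k ^ m))"
      unfolding g_def by (rule spectral_moment[OF k])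
    also have "power_trace k (M x) m = power_trace k (companion_entry k f x) m"
      by (rule power_trace_cong) (simp add: M_def)
    finally show ?thesis by (simp only: F_def power_trace_walks)
  qed
  have intF: "integrable (companion_base k f) F"
    unfolding F_def
    by (intro Bochner_Integration.integrable_divide Bochner_Integration.integrable_sum companion_integrable)
      (auto intro: closed_walk_in_indices simp del: mem_Sigma_iff)
  have "g (M x) = Re (F x)" for x unfolding gM[symmetric] by simp
  then have intg: "integrable (companion_base k f) (\<lambda>x. g (M x))" using integrable_Re[OF intF] by simp
  have gmeas: "g \<in> borel_measurable (hermitian_matrices k)"
    unfolding g_def
    by (rule measurable_compose[OF measurable_prob_algebraD[OF measurable_spectral_measure[OF k]] integral_measurable_subprob_algebra]) simp
  show "integrable (companion_ensemble k f) (\<lambda>c. \<integral>x. x ^ m \<partial>spectral_measure k c)"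
    unfolding companion_ensemble_def M_def[symmetric] g_def[symmetric]
    using intg by (subst integrable_distr_eq[OF meas gmeas])
  have "of_real (\<integral>c. g c \<partial>companion_ensemble k f) = of_real (\<integral>x. g (M x) \<partial>companion_base k f)"
    unfolding companion_ensemble_def M_def[symmetric] by (subst integral_distr[OF meas gmeas]) simp
  also have "\<dots> = (\<integral>x. F x \<partial>companion_base k f)" unfolding gM[symmetric] by simp
  also have "\<dots> = (\<Sum>i<length (closed_walks k m). companion_moment (\<lambda>s. closed_walks k m ! i ! s) {..<m}) /
     (of_nat k * of_real (sqrt k ^ m))"
  proof -
    have "integrable (companion_base k f) (\<lambda>x. \<Prod>s<m. companion_entry k f x (closed_walks k m ! i ! s))"
      if "i < length (closed_walks k m)" for i
      by (rule companion_integrable) (use closed_walk_in_indices[OF that] in auto)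
    then show ?thesis
      unfolding F_def companion_moment_def by (simp add: Bochner_Integration.integral_sum)
  qed
  finally show "of_real (\<integral>c. (\<integral>x. x ^ m \<partial>spectral_measure k c) \<partial>companion_ensemble k f) = limit_moment m"
    by (simp only: g_def limit_moment_def)
qed

text \<open>There are at most k^(2 r + 1) closed walks of length 2 r, each with moment at most (2
  r)! / (2^r r!). The factorial (2 r)! cancels, and what is left is a term of an exponential series
  at \<open>y\<close>.\<close>

lemma limit_moment_growth:
  assumes k: "k > 0"
  shows "(\<lambda>r. \<bar>t\<bar> ^ (2 * r) / fact (2 * r) * cmod (limit_moment (2 * r))) \<longlonglongrightarrow> 0"
proof -
  define y where "y = (t * real k)\<^sup>2 / 2"
  have bound: "\<bar>t\<bar> ^ (2 * r) / fact (2 * r) * cmod (limit_moment (2 * r)) \<le> inverse (fact r) * y ^ r" for r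
  proof -
    define d :: real where "d = fact (2 * r) / (2 ^ r * fact r)"
    have k1: "1 \<le> real k * sqrt k ^ (2 * r)" "1 \<le> sqrt k ^ (2 * r)" using k by (auto intro!: one_le_power mult_ge1_I)
    have "cmod (\<Sum>i<length (closed_walks k (2 * r)). companion_moment (\<lambda>s. closed_walks k (2 * r) ! i ! s) {..<2 * r})
        \<le> (\<Sum>i<length (closed_walks k (2 * r)). d)" (is "?S \<le> _")
      unfolding d_def by (intro sum_norm_le double_factorial_bound) (auto intro: closed_walk_in_indices simp del: mem_Sigma_iff)
    also have "\<dots> \<le> real (k * k ^ (2 * r)) * d"
      unfolding sum_constant card_lessThan
      by (intro mult_right_mono of_nat_mono length_closed_walks) (simp add: d_def)
    finally have S: "?S \<le> real (k * k ^ (2 * r)) * d" .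
    have "cmod (limit_moment (2 * r)) \<le> real (k * k ^ (2 * r)) * d / (real k * sqrt k ^ (2 * r))"
    proof -
      have nz: "cmod (of_nat k * of_real (sqrt k ^ (2 * r))) = real k * sqrt k ^ (2 * r)"
        by (simp add: norm_mult norm_power)
      from S show ?thesis
        unfolding limit_moment_def norm_divide nz by (rule divide_right_mono) simp
    qed
    also have "\<dots> = real k ^ (2 * r) * d / sqrt k ^ (2 * r)" using k by simp
    also have "\<dots> \<le> real k ^ (2 * r) * d"
      using k1 divide_left_mono[of 1 "sqrt k ^ (2 * r)" "real k ^ (2 * r) * d"] by (simp add: d_def)
    finally have "\<bar>t\<bar> ^ (2 * r) / fact (2 * r) * cmod (limit_moment (2 * r)) \<le> \<bar>t\<bar> ^ (2 * r) / fact (2 * r) * (real k ^ (2 * r) * d)"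
      by (intro mult_left_mono) auto
    also have "\<dots> = inverse (fact r) * y ^ r"
    proof -
      have e: "\<bar>t\<bar> ^ (2 * r) = (t\<^sup>2) ^ r" "real k ^ (2 * r) = ((real k)\<^sup>2) ^ r"
        by (simp_all add: power_mult)
      show ?thesis
        unfolding e d_def y_def power_divide power_mult_distrib by (simp add: field_simps)
    qed
    finally show ?thesis .
  qed
  have "(\<lambda>r. inverse (fact r) * y ^ r) \<longlonglongrightarrow> 0" by (rule summable_LIMSEQ_zero[OF summable_exp])
  then show ?thesis
    by (rule Lim_null_comparison[rotated]) (use bound in \<open>auto intro!: always_eventually simp: abs_mult\<close>)
qed

end

section \<open>The random matrices of the family\<close>

locale periodic_family = prob_space \<Omega> for \<Omega> :: "'w measure" +
  fixes k :: nat and f :: "nat \<Rightarrow> nat \<Rightarrow> nat" and X :: "'w \<Rightarrow> real"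
  assumes k_pos: "k > 0" and X_meas: "X \<in> borel_measurable \<Omega>"
    and X_int: "\<And>m. integrable \<Omega> (\<lambda>\<omega>. X \<omega> ^ m)"
    and X_mean: "expectation X = 0" and X_var: "variance X = 1"
begin

sublocale iid: iid_moments "distr \<Omega> borel X"
proof -
  interpret D: prob_space "distr \<Omega> borel X" by (rule prob_space_distr[OF X_meas])
  show "iid_moments (distr \<Omega> borel X)"
    by unfold_locales (use X_meas X_int X_mean X_var in \<open>simp_all add: integrable_distr_eq integral_distr\<close>)
qed

sublocale comp: companion k f .

abbreviation ensemble :: "nat \<Rightarrow> (nat \<times> nat \<Rightarrow> real) measure" where
  "ensemble N \<equiv> periodic_ensemble k f N \<Omega> X"

definition class_matrix :: "nat \<Rightarrow> ((nat \<times> nat) set \<Rightarrow> real) \<Rightarrow> nat \<times> nat \<Rightarrow> real" where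
  "class_matrix n x = (\<lambda>p\<in>indices (k * n). x (equiv_class (entry_equiv k f (k * n)) p))"

abbreviation classes_of :: "nat \<Rightarrow> (nat \<times> nat) set set" where
  "classes_of n \<equiv> periodic_link.entry_classes k n f"

text \<open>For Hermitian entries this is the \<open>m\<close>-th moment of the spectral measure, by
  \<open>spectral_moment\<close>. As a trace it is measurable in the entries on the whole product
  space.\<close>

definition scaled_trace :: "nat \<Rightarrow> nat \<Rightarrow> (nat \<times> nat \<Rightarrow> real) \<Rightarrow> complex" where
  "scaled_trace n m B = power_trace (k * n) (\<lambda>p. of_real (B p)) m / (of_nat (k * n) * of_real (sqrt (k * n) ^ m))"

definition walk_mean :: "nat \<Rightarrow> nat \<Rightarrow> nat \<Rightarrow> ((nat \<times> nat) set \<Rightarrow> real) \<Rightarrow> complex" where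
  "walk_mean n m i = mean_product {..<m} (classes_of n) n (\<lambda>s. periodic_link.coeff k n f (closed_walks k m ! i ! s))"

lemma ensemble_eq:
  assumes "n > 0"
  shows "ensemble (k * n) = distr (iid.P (classes_of n)) (Pi\<^sub>M (indices (k * n)) (\<lambda>_. borel)) (class_matrix n)"
proof -
  interpret periodic_link k n f by unfold_locales (use k_pos assms in auto)
  show ?thesis
    unfolding periodic_ensemble_def class_matrix_def[abs_def] entry_classes_def N_def ..
qed

lemma class_matrix_measurable:
  assumes "n > 0"
  shows "class_matrix n \<in> measurable (iid.P (classes_of n)) (Pi\<^sub>M (indices (k * n)) (\<lambda>_. borel))"
proof -
  interpret periodic_link k n f by unfold_locales (use k_pos assms in auto)
  show ?thesis
    unfolding class_matrix_def[abs_def] iid.measurable_P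
    by (intro measurable_restrict measurable_component_singleton) (simp add: entry_classes_def N_def)
qed

lemma prob_space_ensemble: "n > 0 \<Longrightarrow> prob_space (ensemble (k * n))"
  unfolding ensemble_eq by (rule prob_space.prob_space_distr[OF iid.prob_space_P class_matrix_measurable])

text \<open>A position is equivalent to its transpose, so every matrix built from the classes is
  symmetric. The ensemble is a law on all entry functions, whence the statement almost
  everywhere.\<close>

lemma ensemble_hermitian:
  assumes n: "n > 0"
  shows "AE B in ensemble (k * n). hermitian_entries (k * n) (\<lambda>p. of_real (B p))"
  unfolding ensemble_eq[OF n]
proof (subst AE_distr_iff[OF class_matrix_measurable[OF n]])
  have *: "hermitian_entries (k * n) (\<lambda>p. of_real (B p)) \<longleftrightarrow> (\<forall>p\<in>indices (k * n). B (prod.swap p) = B p)" for B :: "nat \<times> nat \<Rightarrow> real"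
    by (simp add: hermitian_entries_def)
  show "{B \<in> space (Pi\<^sub>M (indices (k * n)) (\<lambda>_. borel)). hermitian_entries (k * n) (\<lambda>p. of_real (B p))}
      \<in> sets (Pi\<^sub>M (indices (k * n)) (\<lambda>_. borel))"
    unfolding * 
    by (intro sets.sets_Collect_finite_All' borel_measurable_eq measurable_component_singleton)
      (use k_pos n in \<open>auto simp: lessThan_empty_iff\<close>)
  have "hermitian_entries (k * n) (\<lambda>p. of_real (class_matrix n x p))" for x
    unfolding *
  proof
    fix p assume p: "p \<in> indices (k * n)"
    then have p': "prod.swap p \<in> indices (k * n)" by auto
    have "equiv_class (entry_equiv k f (k * n)) (prod.swap p) = equiv_class (entry_equiv k f (k * n)) p"
      unfolding equiv_class_entry_eq_iff by (rule entry_equiv_sym[OF entry_equiv_swap[OF p]])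
    then show "class_matrix n x (prod.swap p) = class_matrix n x p"
      using p p' by (simp only: class_matrix_def restrict_apply if_True)
  qed
  then show "AE x in iid.P (classes_of n). hermitian_entries (k * n) (\<lambda>p. of_real (class_matrix n x p))" by simp
qed

lemma scaled_trace_class_matrix:
  assumes n: "n > 0"
  shows "scaled_trace n m (class_matrix n x) = (\<Sum>i<length (closed_walks k m). walk_mean n m i x) / (of_nat k * of_real (sqrt k ^ m))"
proof -
  interpret periodic_link k n f by unfold_locales (use k_pos n in auto)
  have "power_trace (k * n) (\<lambda>p. of_real (class_matrix n x p)) m = power_trace N (class_entries x) m"
    unfolding N_def[symmetric] by (rule power_trace_cong) (simp add: class_matrix_def class_entries_def N_def)
  also have "\<dots> = of_nat n * of_real (sqrt n ^ m) * (\<Sum>i<length (closed_walks k m). walk_mean n m i x)"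
    unfolding power_trace_class_entries walk_mean_def ..
  finally show ?thesis
    using n by (simp add: scaled_trace_def real_sqrt_mult power_mult_distrib)
qed

lemma scaled_trace_measurable [measurable]:
  "scaled_trace n m \<in> borel_measurable (Pi\<^sub>M (indices (k * n)) (\<lambda>_. borel))"
proof -
  have "(\<lambda>B. complex_of_real (B p)) \<in> borel_measurable (Pi\<^sub>M (indices (k * n)) (\<lambda>_. borel))"
    if "p \<in> indices (k * n)" for p
  proof -
    have "complex_of_real \<in> borel_measurable borel" by measurable
    with measurable_component_singleton[OF that] show ?thesis by (rule measurable_compose)
  qed
  then have "(\<lambda>B. entry_power (k * n) (\<lambda>p. complex_of_real (B p)) m i i)
      \<in> borel_measurable (Pi\<^sub>M (indices (k * n)) (\<lambda>_. borel))" if "i < k * n" for i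
    using that by (intro measurable_entry_power)
  then show ?thesis
    unfolding scaled_trace_def[abs_def] power_trace_def
    by (intro borel_measurable_divide borel_measurable_sum borel_measurable_const) simp
qed

lemma poly_growth_walk_mean: "n > 0 \<Longrightarrow> poly_growth (classes_of n) (walk_mean n m i)"
proof -
  assume n: "n > 0"
  interpret periodic_link k n f by unfold_locales (use k_pos n in auto)
  show ?thesis unfolding walk_mean_def by (rule poly_growth_mean_product[OF finite_classes])
qed

lemma finite_classes_of: "n > 0 \<Longrightarrow> finite (classes_of n)"
proof -
  assume n: "n > 0"
  interpret periodic_link k n f by unfold_locales (use k_pos n in auto)
  show ?thesis by (rule finite_classes)
qed

definition mean_trace :: "nat \<Rightarrow> nat \<Rightarrow> complex" where
  "mean_trace n m = (\<Sum>i<length (closed_walks k m). \<integral>x. walk_mean n m i x \<partial>iid.P (classes_of n)) /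
     (of_nat k * of_real (sqrt k ^ m))"

lemma mean_trace_tendsto: "(\<lambda>j. mean_trace (Suc j) m) \<longlonglongrightarrow> comp.limit_moment m"
  unfolding mean_trace_def comp.limit_moment_def walk_mean_def
  by (intro tendsto_divide tendsto_sum tendsto_const iid.expectation_mean_product_tendsto k_pos)
    (use k_pos comp.closed_walk_in_indices in auto)

text \<open>Reduction to \<open>concentration\<close> walk by walk, the number of closed walks being
  independent of \<open>n\<close>. The nonnegative integral is the form that is summed over
  \<open>n\<close> in \<open>AE_scaled_trace_tendsto\<close>.\<close>

lemma trace_fourth_moment:
  "\<exists>C\<ge>0. \<forall>n>0. (\<integral>\<^sup>+B. ennreal (cmod (scaled_trace n m B - mean_trace n m) ^ 4) \<partial>ensemble (k * n)) \<le> ennreal (C / (n * sqrt n))"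
proof -
  define W where "W = length (closed_walks k m)"
  define Z where "Z n i x = walk_mean n m i x - (\<integral>y. walk_mean n m i y \<partial>iid.P (classes_of n))" for n i x
  have "\<exists>C. \<forall>n>0. (\<integral>x. cmod (Z n i x) ^ 4 \<partial>iid.P (classes_of n)) \<le> C / (n * sqrt n)" if i: "i < W" for i
  proof -
    have c: "0 \<le> (real k)\<^sup>2" "1 \<le> (2 :: real)" "0 \<le> (2 :: real)" "finite {..<m}" by auto
    from iid.concentration[OF c, where 'i = "(nat \<times> nat) set"]
    obtain C where C: "\<forall>(I :: (nat \<times> nat) set set) n a. bessel_coeffs ((real k)\<^sup>2) 2 2 {..<m} I n a \<longrightarrow>
      (\<integral>x. cmod (mean_product {..<m} I n a x - (\<integral>y. mean_product {..<m} I n a y \<partial>iid.P I)) ^ 4 \<partial>iid.P I)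
      \<le> C / (real n * sqrt (real n))" by (elim exE)
    have "(\<integral>x. cmod (Z n i x) ^ 4 \<partial>iid.P (classes_of n)) \<le> C / (n * sqrt n)" if n: "n > 0" for n
    proof -
      interpret periodic_link k n f by unfold_locales (use k_pos n in auto)
      have "bessel_coeffs ((real k)\<^sup>2) 2 2 {..<m} (classes_of n) n (\<lambda>s. coeff (closed_walks k m ! i ! s))"
        by (rule bessel_coeffs) (use comp.closed_walk_in_indices i in \<open>simp add: W_def del: mem_Sigma_iff\<close>)
      from C[rule_format, OF this] show ?thesis unfolding Z_def walk_mean_def .
    qed
    then show ?thesis by blast
  qed
  then have "\<exists>C. \<forall>i<W. \<forall>n>0. (\<integral>x. cmod (Z n i x) ^ 4 \<partial>iid.P (classes_of n)) \<le> C i / (n * sqrt n)"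
    by metis
  then obtain C where C: "\<And>i n. i < W \<Longrightarrow> n > 0 \<Longrightarrow> (\<integral>x. cmod (Z n i x) ^ 4 \<partial>iid.P (classes_of n)) \<le> C i / (n * sqrt n)"
    by blast
  define D where "D = real W ^ 3 * (\<Sum>i<W. \<bar>C i\<bar>)"
  have D0: "D \<ge> 0" unfolding D_def by (intro mult_nonneg_nonneg sum_nonneg) auto
  have "(\<integral>\<^sup>+B. ennreal (cmod (scaled_trace n m B - mean_trace n m) ^ 4) \<partial>ensemble (k * n)) \<le> ennreal (D / (n * sqrt n))" if n: "n > 0" for n
  proof -
    note fin = finite_classes_of[OF n]
    have Z: "poly_growth (classes_of n) (Z n i)" for i
      unfolding Z_def by (intro poly_growth_diff poly_growth_const poly_growth_walk_mean[OF n])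
    have meas: "(\<lambda>B. ennreal (cmod (scaled_trace n m B - mean_trace n m) ^ 4)) \<in> borel_measurable (Pi\<^sub>M (indices (k * n)) (\<lambda>_. borel))"
      using scaled_trace_measurable by measurable
    have pw: "cmod (scaled_trace n m (class_matrix n x) - mean_trace n m) ^ 4 \<le> real W ^ 3 * (\<Sum>i<W. cmod (Z n i x) ^ 4)" for x
    proof -
      \<comment> \<open>The normalisation is at least 1, so that omitting it from the denominator
        only enlarges the bound.\<close>
      have k1: "1 \<le> real k * sqrt k ^ m" using k_pos by (intro mult_ge1_I one_le_power) auto
      have "scaled_trace n m (class_matrix n x) - mean_trace n m = (\<Sum>i<W. Z n i x) / (of_nat k * of_real (sqrt k ^ m))"
        unfolding scaled_trace_class_matrix[OF n] mean_trace_def Z_def W_def by (simp add: sum_subtractf diff_divide_distrib)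
      then have "cmod (scaled_trace n m (class_matrix n x) - mean_trace n m) = cmod (\<Sum>i<W. Z n i x) / (real k * sqrt k ^ m)"
        by (simp add: norm_divide norm_mult norm_power)
      also have "\<dots> \<le> cmod (\<Sum>i<W. Z n i x)" 
      proof -
        have pos: "0 < real k * sqrt k ^ m" using k1 by linarith
        show ?thesis unfolding pos_divide_le_eq[OF pos] using mult_left_mono[OF k1, of "cmod (\<Sum>i<W. Z n i x)"] by simp
      qed
      also have "\<dots> \<le> (\<Sum>i<W. cmod (Z n i x))" by (rule norm_sum)
      finally have "cmod (scaled_trace n m (class_matrix n x) - mean_trace n m) ^ 4 \<le> (\<Sum>i<W. cmod (Z n i x)) ^ 4"
        by (intro power_mono) auto
      also have "\<dots> \<le> real W ^ 3 * (\<Sum>i<W. cmod (Z n i x) ^ 4)"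
        using sum_fourth_power_le[of "\<lambda>i. cmod (Z n i x)" "{..<W}"] by simp
      finally show ?thesis .
    qed
    have int4: "integrable (iid.P (classes_of n)) (\<lambda>x. cmod (Z n i x) ^ 4)" for i
      by (intro iid.integrable_poly_growth[OF fin] poly_growth_power poly_growth_norm Z)
    have "(\<integral>\<^sup>+B. ennreal (cmod (scaled_trace n m B - mean_trace n m) ^ 4) \<partial>ensemble (k * n)) =
        (\<integral>\<^sup>+x. ennreal (cmod (scaled_trace n m (class_matrix n x) - mean_trace n m) ^ 4) \<partial>iid.P (classes_of n))"
      unfolding ensemble_eq[OF n] by (rule nn_integral_distr[OF class_matrix_measurable[OF n]]) (use meas in simp)
    also have "\<dots> \<le> (\<integral>\<^sup>+x. ennreal (real W ^ 3 * (\<Sum>i<W. cmod (Z n i x) ^ 4)) \<partial>iid.P (classes_of n))"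
      by (intro nn_integral_mono ennreal_leI pw)
    also have "\<dots> = ennreal (\<integral>x. real W ^ 3 * (\<Sum>i<W. cmod (Z n i x) ^ 4) \<partial>iid.P (classes_of n))"
      by (intro nn_integral_eq_integral integrable_mult_right Bochner_Integration.integrable_sum int4 AE_I2
          mult_nonneg_nonneg sum_nonneg) auto
    also have "(\<integral>x. real W ^ 3 * (\<Sum>i<W. cmod (Z n i x) ^ 4) \<partial>iid.P (classes_of n)) = real W ^ 3 * (\<Sum>i<W. \<integral>x. cmod (Z n i x) ^ 4 \<partial>iid.P (classes_of n))"
      using int4 by simp
    also have "\<dots> \<le> real W ^ 3 * (\<Sum>i<W. \<bar>C i\<bar> / (n * sqrt n))"
    proof (intro mult_left_mono sum_mono)
      fix i assume "i \<in> {..<W}"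
      then have "(\<integral>x. cmod (Z n i x) ^ 4 \<partial>iid.P (classes_of n)) \<le> C i / (n * sqrt n)" using C n by simp
      also have "\<dots> \<le> \<bar>C i\<bar> / (n * sqrt n)" by (intro divide_right_mono) auto
      finally show "(\<integral>x. cmod (Z n i x) ^ 4 \<partial>iid.P (classes_of n)) \<le> \<bar>C i\<bar> / (n * sqrt n)" .
    qed auto
    also have "\<dots> = D / (n * sqrt n)" by (simp add: D_def flip: sum_divide_distrib)
    finally show ?thesis by (simp add: ennreal_leI)
  qed
  then show ?thesis using D0 by blast
qed

definition sample_space :: "(nat \<Rightarrow> nat \<times> nat \<Rightarrow> real) measure" where
  "sample_space = Pi\<^sub>M (positive_multiples k) (\<lambda>N. ensemble N)"

lemma positive_multiples_iff: "N \<in> positive_multiples k \<longleftrightarrow> (\<exists>n>0. N = k * n)"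
  using k_pos by (auto simp: positive_multiples_def)

text \<open>The fourth powers of the deviations have summable means, hence their sum is almost
  surely finite and its terms tend to 0. Only the marginals of the product measure enter; the means
  converge by \<open>mean_trace_tendsto\<close>.\<close>

lemma AE_scaled_trace_tendsto:
  "AE A in sample_space. (\<lambda>j. scaled_trace (Suc j) m (A (k * Suc j))) \<longlonglongrightarrow> comp.limit_moment m"
proof -
  from trace_fourth_moment[of m] obtain C where C0: "C \<ge> 0" and C: "\<And>n. n > 0 \<Longrightarrow>
    (\<integral>\<^sup>+B. ennreal (cmod (scaled_trace n m B - mean_trace n m) ^ 4) \<partial>ensemble (k * n)) \<le> ennreal (C / (n * sqrt n))"
    by blast
  define h where "h j A = cmod (scaled_trace (Suc j) m (A (k * Suc j)) - mean_trace (Suc j) m) ^ 4" for j and A :: "nat \<Rightarrow> nat \<times> nat \<Rightarrow> real"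
  have prob: "prob_space (ensemble N)" if "N \<in> positive_multiples k" for N
    using that prob_space_ensemble unfolding positive_multiples_iff by auto
  have idx: "k * Suc j \<in> positive_multiples k" for j unfolding positive_multiples_iff by blast
  have comp_meas: "(\<lambda>A. A (k * Suc j)) \<in> measurable sample_space (ensemble (k * Suc j))" for j
    unfolding sample_space_def by (rule measurable_component_singleton[OF idx])
  have trace_meas: "(\<lambda>B. ennreal (cmod (scaled_trace (Suc j) m B - mean_trace (Suc j) m) ^ 4)) \<in> borel_measurable (ensemble (k * Suc j))" for j
  proof -
    have s: "sets (ensemble (k * Suc j)) = sets (Pi\<^sub>M (indices (k * Suc j)) (\<lambda>_. borel))"
      by (simp add: periodic_ensemble_def)
    have "(\<lambda>B. ennreal (cmod (scaled_trace (Suc j) m B - mean_trace (Suc j) m) ^ 4)) \<in> borel_measurable (Pi\<^sub>M (indices (k * Suc j)) (\<lambda>_. borel))"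
      using scaled_trace_measurable by measurable
    then show ?thesis by (subst measurable_cong_sets[OF s refl])
  qed
  have h_meas: "(\<lambda>A. ennreal (h j A)) \<in> borel_measurable sample_space" for j
    unfolding h_def by (rule measurable_compose[OF comp_meas trace_meas])
  have h_int: "(\<integral>\<^sup>+A. ennreal (h j A) \<partial>sample_space) \<le> ennreal (C / (Suc j * sqrt (Suc j)))" for j
  proof -
    have "(\<integral>\<^sup>+A. ennreal (h j A) \<partial>sample_space) =
        (\<integral>\<^sup>+B. ennreal (cmod (scaled_trace (Suc j) m B - mean_trace (Suc j) m) ^ 4) \<partial>distr sample_space (ensemble (k * Suc j)) (\<lambda>A. A (k * Suc j)))"
      unfolding h_def by (rule nn_integral_distr[OF comp_meas, symmetric]) (use trace_meas in simp)
    also have "distr sample_space (ensemble (k * Suc j)) (\<lambda>A. A (k * Suc j)) = ensemble (k * Suc j)"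
      unfolding sample_space_def by (rule distr_PiM_component[OF prob idx])
    also have "(\<integral>\<^sup>+B. ennreal (cmod (scaled_trace (Suc j) m B - mean_trace (Suc j) m) ^ 4) \<partial>ensemble (k * Suc j)) \<le> ennreal (C / (Suc j * sqrt (Suc j)))"
      by (rule C) simp
    finally show ?thesis .
  qed
  have summ: "summable (\<lambda>j. C / (Suc j * sqrt (Suc j)))"
  proof -
    have "summable (\<lambda>j. C * real (Suc j) powr (- 3 / 2))"
      by (intro summable_mult) (subst summable_Suc_iff, simp add: summable_real_powr_iff)
    moreover have "C * real (Suc j) powr (- 3 / 2) = C / (Suc j * sqrt (Suc j))" for j
    proof -
      define x where "x = real (Suc j)"
      have x: "x > 0" by (simp add: x_def)
      have "x powr (3 / 2) = x powr (1 + 1 / 2)" by simp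
      also have "\<dots> = x * sqrt x" using x by (subst powr_add) (simp add: powr_half_sqrt)
      finally have "x powr (- 3 / 2) = inverse (x * sqrt x)" using powr_minus[of x "3 / 2"] by simp
      then show ?thesis unfolding x_def[symmetric] by (simp only: divide_inverse)
    qed
    ultimately show ?thesis by (simp only:)
  qed
  have "(\<integral>\<^sup>+A. (\<Sum>j. ennreal (h j A)) \<partial>sample_space) = (\<Sum>j. \<integral>\<^sup>+A. ennreal (h j A) \<partial>sample_space)"
    by (rule nn_integral_suminf[OF h_meas])
  also have "\<dots> \<le> (\<Sum>j. ennreal (C / (Suc j * sqrt (Suc j))))" by (intro suminf_le h_int) auto
  also have "\<dots> < \<top>"
    using C0 summ by (subst suminf_ennreal2) auto
  finally have "AE A in sample_space. (\<Sum>j. ennreal (h j A)) \<noteq> \<infinity>"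
    by (intro nn_integral_noteq_infinite borel_measurable_suminf_order h_meas) auto
  then show ?thesis
  proof (rule AE_mp, intro AE_I2 impI)
    fix A assume "(\<Sum>j. ennreal (h j A)) \<noteq> \<infinity>"
    then have "summable (\<lambda>j. h j A)" by (intro summable_suminf_not_top) (auto simp: h_def)
    then have "(\<lambda>j. h j A) \<longlonglongrightarrow> 0" by (rule summable_LIMSEQ_zero)
    \<comment> \<open>Two square roots undo the fourth power.\<close>
    then have "(\<lambda>j. sqrt (sqrt (h j A))) \<longlonglongrightarrow> sqrt (sqrt 0)" by (intro tendsto_real_sqrt)
    moreover have "sqrt (sqrt (h j A)) = cmod (scaled_trace (Suc j) m (A (k * Suc j)) - mean_trace (Suc j) m)" for j
    proof -
      have hj: "h j A = ((cmod (scaled_trace (Suc j) m (A (k * Suc j)) - mean_trace (Suc j) m))\<^sup>2)\<^sup>2"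
        by (simp add: h_def flip: power_mult)
      show ?thesis unfolding hj by (simp only: real_sqrt_abs abs_power2 abs_norm_cancel)
    qed
    ultimately have "(\<lambda>j. cmod (scaled_trace (Suc j) m (A (k * Suc j)) - mean_trace (Suc j) m)) \<longlonglongrightarrow> 0"
      by (simp only: real_sqrt_zero)
    then have "(\<lambda>j. scaled_trace (Suc j) m (A (k * Suc j)) - mean_trace (Suc j) m) \<longlonglongrightarrow> 0"
      by (rule tendsto_norm_zero_cancel)
    from tendsto_add[OF this mean_trace_tendsto[of m]]
    show "(\<lambda>j. scaled_trace (Suc j) m (A (k * Suc j))) \<longlonglongrightarrow> comp.limit_moment m" by simp
  qed
qed

lemma AE_hermitian:
  "AE A in sample_space. \<forall>j. hermitian_entries (k * Suc j) (\<lambda>p. of_real (A (k * Suc j) p))"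
  unfolding AE_all_countable sample_space_def
proof
  fix j
  have prob: "prob_space (ensemble N)" if "N \<in> positive_multiples k" for N
    using that prob_space_ensemble unfolding positive_multiples_iff by auto
  have idx: "k * Suc j \<in> positive_multiples k" unfolding positive_multiples_iff by blast
  show "AE A in Pi\<^sub>M (positive_multiples k) ensemble. hermitian_entries (k * Suc j) (\<lambda>p. of_real (A (k * Suc j) p))"
    using AE_PiM_component[of "positive_multiples k" ensemble "k * Suc j"
        "\<lambda>B. hermitian_entries (k * Suc j) (\<lambda>p. of_real (B p))"] prob idx ensemble_hermitian[of "Suc j"]
    by blast
qed

text \<open>There are countably many moments and matrix sizes, so almost surely all moments converge
  and all matrices are Hermitian. For such a sample the claim is deterministic and follows from
  \<open>converges_weakly_bind_from_moments\<close>.\<close>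

lemma AE_converges_weakly:
  "AE A in sample_space. converges_weakly
      (\<lambda>m. spectral_measure (k * Suc m) (\<lambda>p. complex_of_real (A (k * Suc m) p)))
      (eigenvalue_distribution k (companion_ensemble k f))"
proof -
  have "AE A in sample_space. \<forall>m. (\<lambda>j. scaled_trace (Suc j) m (A (k * Suc j))) \<longlonglongrightarrow> comp.limit_moment m"
    unfolding AE_all_countable using AE_scaled_trace_tendsto by blast
  with AE_hermitian show ?thesis
  proof eventually_elim
    case (elim A)
    define \<nu> where "\<nu> j = spectral_measure (k * Suc j) (\<lambda>p. complex_of_real (A (k * Suc j) p))" for j
    define \<mu> where "\<mu> m = (\<integral>c. (\<integral>x. x ^ m \<partial>spectral_measure k c) \<partial>companion_ensemble k f)" for m
    have \<mu>: "of_real (\<mu> m) = comp.limit_moment m" for m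
      unfolding \<mu>_def by (rule comp.companion_spectral_moments(2)[OF k_pos])
    have pos: "k * Suc j > 0" for j using k_pos by simp
    show ?case
      unfolding eigenvalue_distribution_def \<nu>_def[symmetric]
    proof (rule converges_weakly_bind_from_moments)
      show "prob_space (companion_ensemble k f)" by (rule comp.prob_space_companion_ensemble)
      show "spectral_measure k \<in> measurable (companion_ensemble k f) (prob_algebra borel)"
        using measurable_spectral_measure[OF k_pos] by (simp add: companion_ensemble_def)
      show "real_distribution (\<nu> n)" for n unfolding \<nu>_def by (rule real_distribution_spectral_measure)
      show "integrable (\<nu> n) (\<lambda>x. x ^ m)" for n m
        unfolding \<nu>_def by (rule integral_spectral_measure(1)[OF pos]) simp
      show "integrable (spectral_measure k c) (\<lambda>x. x ^ m)" for c m
        by (rule integral_spectral_measure(1)[OF k_pos]) simp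
      show "integrable (companion_ensemble k f) (\<lambda>c. \<integral>x. x ^ m \<partial>spectral_measure k c)" for m
        by (rule comp.companion_spectral_moments(1)[OF k_pos])
      show "(\<lambda>n. \<integral>x. x ^ m \<partial>\<nu> n) \<longlonglongrightarrow> (\<integral>c. (\<integral>x. x ^ m \<partial>spectral_measure k c) \<partial>companion_ensemble k f)" for m
      proof -
        have "complex_of_real (\<integral>x. x ^ m \<partial>\<nu> j) = scaled_trace (Suc j) m (A (k * Suc j))" for j
          unfolding \<nu>_def scaled_trace_def by (rule spectral_moment[OF pos]) (use elim(1) in blast)
        then have "(\<lambda>j. complex_of_real (\<integral>x. x ^ m \<partial>\<nu> j)) \<longlonglongrightarrow> complex_of_real (\<mu> m)"
          using elim(2) by (simp add: \<mu>)
        then show ?thesis unfolding tendsto_of_real_iff \<mu>_def .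
      qed
      show "(\<lambda>r. \<bar>t\<bar> ^ (2 * r) / fact (2 * r) * (\<integral>c. (\<integral>x. x ^ (2 * r) \<partial>spectral_measure k c) \<partial>companion_ensemble k f)) \<longlonglongrightarrow> 0" for t
      proof (rule Lim_null_comparison[OF _ comp.limit_moment_growth[OF k_pos, of t]])
        have "\<bar>\<mu> (2 * r)\<bar> = cmod (comp.limit_moment (2 * r))" for r
          unfolding \<mu>[symmetric] by simp
        then show "\<forall>\<^sub>F r in sequentially. norm (\<bar>t\<bar> ^ (2 * r) / fact (2 * r) *
            (\<integral>c. (\<integral>x. x ^ (2 * r) \<partial>spectral_measure k c) \<partial>companion_ensemble k f)) \<le> \<bar>t\<bar> ^ (2 * r) / fact (2 * r) * cmod (comp.limit_moment (2 * r))"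
          unfolding \<mu>_def[symmetric] by (intro always_eventually allI) (simp add: abs_mult power_abs)
      qed
    qed
  qed
qed

end

theorem theorem2p11:
  fixes k :: nat and f :: "nat \<Rightarrow> nat \<Rightarrow> nat"
    and \<Omega> :: "'w measure" and X :: "'w \<Rightarrow> real"
  assumes "k > 0"
    and "link_function k f"
    and "prob_space \<Omega>"
    and "X \<in> borel_measurable \<Omega>"
    and "\<And>m::nat. integrable \<Omega> (\<lambda>\<omega>. X \<omega> ^ m)"
    and "prob_space.expectation \<Omega> X = 0"
    and "prob_space.variance \<Omega> X = 1"
  shows "AE A in (\<Pi>\<^sub>M N\<in>positive_multiples k. periodic_ensemble k f N \<Omega> X).
    converges_weakly
      (\<lambda>m. spectral_measure (k * Suc m) (\<lambda>p. complex_of_real (A (k * Suc m) p)))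
      (eigenvalue_distribution k (companion_ensemble k f))"
proof -
  interpret prob_space \<Omega> by fact
  interpret periodic_family \<Omega> k f X
    by unfold_locales (fact assms)+
  show ?thesis using AE_converges_weakly unfolding sample_space_def .
qed

end
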